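(* Suppose $\mathbb X$ is unimodular and that $\mathfrak m$ is a flow-adapted simple point process with intensity $\gamma\in(0,\infty)$ that is connectible in a flow-adapted way. Then the Palm version of $\mathfrak m$ is an $\mathbb X$-embedding of some unimodular network.
   Context: Point processes. $\mathbb X$ is a locally compact second-countable Hausdorff topological group with neutral element $e$, Borel sets $\mathcal B(\mathbb X)$ and a fixed left Haar measure $\lambda$; unimodular means $\lambda$ is also right-invariant. $(\Omega,\mathcal A,\theta,\mathbf P)$ is a stationary framework: a probability space with a (jointly) measurable left action $\theta:\mathbb X\times\Omega\to\Omega$, $\theta_x\omega=\theta(x,\omega)$, preserving $\mathbf P$. $\mathbf M$ is the space of locally finite counting measures on $\mathbb X$ with the $\sigma$-algebra generated by $\mu\mapsto\mu(B)$, $B\in\mathcal B(\mathbb X)$; $T_x\mu(B):=\mu(x^{-1}B)$. A simple point process is a random element $\mathfrak m$ of $\mathbf M$ with all atoms of mass $1$, identified with its support; it is flow-adapted if $\mathfrak m(\theta_x\omega,B)=\mathfrak m(\omega,x^{-1}B)$ for all $x,\omega,B$. The intensity is $\gamma=\mathbf E[\mathfrak m(B)]/\lambda(B)$ for any $B$ with $\lambda(B)\in(0,\infty)$. The Palm probability measure is $\mathbf P^{\mathfrak m}(A):=\frac1\gamma\mathbf E\int_{\mathbb X}1_{\theta_x^{-1}\omega\in A}w(x)\,\mathfrak m(dx)$, for any measurable $w\ge0$ with $\int w\,d\lambda=1$; $\mathbf P^{\mathfrak m}$-a.s. $e\in\mathfrak m$. Connectible. $\mathfrak m$ is connectible in a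 flow-adapted way if there is a connected, locally finite, undirected graph $\boldsymbol G=\boldsymbol G(\omega)$ with $V(\boldsymbol G)=\mathfrak m=\sum_i\delta_{Y_i}$ almost surely, such that each $1_{\{Y_i,Y_j\}\in E(\boldsymbol G)}$ is measurable, and which is flow-adapted: for all $\omega$ and all $X,Y,z\in\mathbb X$, $X\in V(\boldsymbol G(\omega))$ iff $zX\in V(\boldsymbol G(\theta_z\omega))$, and $\{X,Y\}\in E(\boldsymbol G(\omega))$ iff $\{zX,zY\}\in E(\boldsymbol G(\theta_z\omega))$. Networks. A network is a connected, locally finite undirected graph $G=(V,E)$ with a complete separable metric mark space $\Xi$ and maps $\xi_V:V\to\Xi$ and $\xi_E:\{(v,g)\in V\times E: v \text{ is an endpoint of } g\}\to\Xi$. An isomorphism of networks $G_1,G_2$ with common mark space is a pair of bijections $\varphi_V:V_1\to V_2$, $\varphi_E:E_1\to E_2$ with $\{v,v'\}\in E_1$ iff $\{\varphi_V(v),\varphi_V(v')\}\in E_2$, $\varphi_E(\{v,v'\})=\{\varphi_V(v),\varphi_V(v')\}$, $\xi_{V_1}=\xi_{V_2}\circ\varphi_V$, and $\xi_{E_1}(v,g)=\xi_{E_2}(\varphi_V(v),\varphi_E(g))$. A rooted network $(G,o)$ is a network with a distinguished vertex $o$; rooted isomorphisms also preserve the root. $\mathcal G_*$ is the set of isomorphism classes $[G,o]$ of rooted networks, $\mathcal G_{**}$ the set of isomorphism classes $[G,o,v]$ of networks with an ordered pair of distinguished vertices. $\mathcal G_*$ is metrized by letting the distance of $[G,o],[G',o']$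 be $2^{-\alpha}$, where $\alpha$ is the supremum of those $r>0$ for which there is a rooted isomorphism between the graph balls of radius $\lceil r\rceil$ about $o$ and $o'$ such that the marks of corresponding elements are at distance at most $1/r$; $\mathcal G_{**}$ is metrized similarly; both carry their Borel $\sigma$-algebras. A random network $[\boldsymbol G,\boldsymbol o]$ is a random element of $\mathcal G_*$; it is unimodular (with respect to a given probability measure on $\Omega$ with expectation $\mathbb E$) if for all measurable $g:\mathcal G_{**}\to[0,\infty)$, $\mathbb E\sum_{v\in V(\boldsymbol G)}g[\boldsymbol G,\boldsymbol o,v]=\mathbb E\sum_{v\in V(\boldsymbol G)}g[\boldsymbol G,v,\boldsymbol o]$. Embeddings. An $\mathbb X$-embedding of a unimodular network $[\boldsymbol G,\boldsymbol o]$ with respect to a probability measure $\mathcal P$ on $\Omega$ is a map $\eta:\mathcal G_*\to\mathbf M$ such that: (i) $\eta$ is measurable; (ii) $e\in\eta[G,o]$ for all rooted networks $(G,o)$; (iii) there is a measurable $\mathfrak t:\mathcal G_{**}\to\mathbb X$ such that for every rooted network $(G,o)$ and every $v\in V(G)$, $\eta[G,v]=T_{\mathfrak t[G,o,v]^{-1}}\eta[G,o]$ and $\mathfrak t[G,v,o]=\mathfrak t[G,o,v]^{-1}$; (iv) $\mathcal P$-a.s. the map $v\mapsto\mathfrak t[\boldsymbol G,\boldsymbol o,v]$ is a bijection between $V(\boldsymbol G)$ and the support of $\eta[\boldsymbol G,\boldsymbol o]$. The Palm version of $\mathfrak m$ is an $\mathbb X$-embedding of $[\boldsymbol G,\boldsymbol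 o]$ if there is an $\mathbb X$-embedding $\eta$ of $[\boldsymbol G,\boldsymbol o]$ with respect to $\mathbf P^{\mathfrak m}$ (unimodularity of the network being understood under $\mathbf P^{\mathfrak m}$) such that $\mathbf P^{\mathfrak m}$-a.s. $\mathfrak m=\eta[\boldsymbol G,\boldsymbol o]$. *)

theory Defs
  imports "HOL-Probability.Probability"
begin

text \<open>
  The library has no type class of non-commutative multiplicative groups. The group is therefore a
  type of class \<^class>\<open>topological_group_add\<close>, which is not assumed commutative and is written
  additively: \<open>x + y\<close>, \<open>- x\<close> and \<open>0\<close> stand for \<open>xy\<close>, the inverse of \<open>x\<close> and the neutral element.
  The order of summands matters throughout.
\<close>

section \<open>Haar measure and stationary frameworks\<close>

definition left_haar_measure :: "'x::topological_group_add measure \<Rightarrow> bool" where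
  "left_haar_measure lam \<longleftrightarrow>
     sets lam = sets borel \<and>
     emeasure lam UNIV \<noteq> 0 \<and>
     (\<forall>K. compact K \<longrightarrow> emeasure lam K < \<top>) \<and>
     (\<forall>x. \<forall>B\<in>sets borel. emeasure lam ((\<lambda>y. x + y) ` B) = emeasure lam B)"

definition right_invariant :: "'x::topological_group_add measure \<Rightarrow> bool" where
  "right_invariant lam \<longleftrightarrow> (\<forall>x. \<forall>B\<in>sets borel. emeasure lam ((\<lambda>y. y + x) ` B) = emeasure lam B)"

definition stationary_framework ::
  "'w measure \<Rightarrow> ('x::topological_group_add \<Rightarrow> 'w \<Rightarrow> 'w) \<Rightarrow> bool" where
  "stationary_framework P \<theta> \<longleftrightarrow>
     prob_space P \<and>
     (\<lambda>(x, \<omega>). \<theta> x \<omega>) \<in> measurable (borel \<Otimes>\<^sub>M P) P \<and>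
     (\<forall>\<omega>\<in>space P. \<theta> 0 \<omega> = \<omega>) \<and>
     (\<forall>x y. \<forall>\<omega>\<in>space P. \<theta> (x + y) \<omega> = \<theta> x (\<theta> y \<omega>)) \<and>
     (\<forall>x. distr P P (\<theta> x) = P)"

section \<open>Point processes and Palm measures\<close>

definition lf_counting_measures :: "'x::topological_space measure set" where
  "lf_counting_measures =
     {\<mu>. sets \<mu> = sets borel \<and>
         (\<forall>B\<in>sets borel. emeasure \<mu> B \<in> insert \<top> (range of_nat)) \<and>
         (\<forall>K. compact K \<longrightarrow> emeasure \<mu> K < \<top>)}"

definition counting_measure_space :: "'x::topological_space measure measure" where
  "counting_measure_space =
     (SUP B\<in>sets borel. vimage_algebra lf_counting_measures (\<lambda>\<mu>. emeasure \<mu> B) borel)"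

text \<open>The set of atoms, which for a locally finite counting measure is its support.\<close>

definition points :: "'x measure \<Rightarrow> 'x set" where
  "points \<mu> = {x. emeasure \<mu> {x} \<noteq> 0}"

definition translate :: "'x::topological_group_add \<Rightarrow> 'x measure \<Rightarrow> 'x measure" where
  "translate x \<mu> = distr \<mu> borel (\<lambda>y. x + y)"

definition simple_point_process ::
  "'w measure \<Rightarrow> ('w \<Rightarrow> 'x::topological_space measure) \<Rightarrow> bool" where
  "simple_point_process P m \<longleftrightarrow>
     m \<in> measurable P counting_measure_space \<and>
     (\<forall>\<omega>\<in>space P. \<forall>x\<in>points (m \<omega>). emeasure (m \<omega>) {x} = 1)"

definition flow_adapted ::
  "'w measure \<Rightarrow> ('x::topological_group_add \<Rightarrow> 'w \<Rightarrow> 'w) \<Rightarrow> ('w \<Rightarrow> 'x measure) \<Rightarrow> bool" where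
  "flow_adapted P \<theta> m \<longleftrightarrow>
     (\<forall>x. \<forall>\<omega>\<in>space P. \<forall>B\<in>sets borel.
        emeasure (m (\<theta> x \<omega>)) B = emeasure (m \<omega>) ((\<lambda>y. - x + y) ` B))"

definition intensity ::
  "'x::topological_group_add measure \<Rightarrow> 'w measure \<Rightarrow> ('w \<Rightarrow> 'x measure) \<Rightarrow> ennreal" where
  "intensity lam P m =
     (THE \<gamma>. \<forall>B\<in>sets borel. 0 < emeasure lam B \<and> emeasure lam B < \<top> \<longrightarrow>
        \<gamma> = (\<integral>\<^sup>+\<omega>. emeasure (m \<omega>) B \<partial>P) / emeasure lam B)"

text \<open>The weight function \<open>w\<close> is meant to be measurable with \<open>lam\<close>-integral 1.\<close>

definition palm_measure ::
  "'x::topological_group_add measure \<Rightarrow> 'w measure \<Rightarrow> ('x \<Rightarrow> 'w \<Rightarrow> 'w) \<Rightarrow> ('w \<Rightarrow> 'x measure) \<Rightarrow>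
   ('x \<Rightarrow> ennreal) \<Rightarrow> 'w measure" where
  "palm_measure lam P \<theta> m w =
     measure_of (space P) (sets P)
       (\<lambda>A. (\<integral>\<^sup>+\<omega>. (\<integral>\<^sup>+x. indicator A (\<theta> (- x) \<omega>) * w x \<partial>m \<omega>) \<partial>P) / intensity lam P m)"

section \<open>Graphs and connectibility\<close>

definition simple_graph :: "'v set \<Rightarrow> 'v set set \<Rightarrow> bool" where
  "simple_graph V E \<longleftrightarrow> (\<forall>e\<in>E. \<exists>u\<in>V. \<exists>v\<in>V. u \<noteq> v \<and> e = {u, v})"

definition adj :: "'v set set \<Rightarrow> ('v \<times> 'v) set" where
  "adj E = {(u, v). {u, v} \<in> E}"

text \<open>Connectedness here admits the empty graph, as a point process may have no points at all.\<close>

definition connected_graph :: "'v set \<Rightarrow> 'v set set \<Rightarrow> bool" where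
  "connected_graph V E \<longleftrightarrow> (\<forall>u\<in>V. \<forall>v\<in>V. (u, v) \<in> (adj E)\<^sup>*)"

definition locally_finite_graph :: "'v set \<Rightarrow> 'v set set \<Rightarrow> bool" where
  "locally_finite_graph V E \<longleftrightarrow> (\<forall>v\<in>V. finite {e\<in>E. v \<in> e})"

text \<open>
  \<open>Y 0 \<omega>, Y 1 \<omega>, \<dots>\<close> enumerates the points of \<open>m \<omega>\<close>; only indices below the total mass of \<open>m \<omega>\<close>
  (possibly infinite) are meaningful.
\<close>

definition connectible ::
  "'w measure \<Rightarrow> ('x::topological_group_add \<Rightarrow> 'w \<Rightarrow> 'w) \<Rightarrow> ('w \<Rightarrow> 'x measure) \<Rightarrow> bool" where
  "connectible P \<theta> m \<longleftrightarrow>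
     (\<exists>(V :: 'w \<Rightarrow> 'x set) (E :: 'w \<Rightarrow> 'x set set) (Y :: nat \<Rightarrow> 'w \<Rightarrow> 'x).
        (\<forall>\<omega>\<in>space P. simple_graph (V \<omega>) (E \<omega>) \<and> connected_graph (V \<omega>) (E \<omega>) \<and>
           locally_finite_graph (V \<omega>) (E \<omega>)) \<and>
        (\<forall>i. Y i \<in> borel_measurable P) \<and>
        (AE \<omega> in P. V \<omega> = points (m \<omega>) \<and>
           (\<forall>B\<in>sets borel. emeasure (m \<omega>) B =
              (\<Sum>i. if of_nat i < emeasure (m \<omega>) UNIV then indicator B (Y i \<omega>) else 0))) \<and>
        (\<forall>i j. {\<omega>\<in>space P. of_nat i < emeasure (m \<omega>) UNIV \<and> of_nat j < emeasure (m \<omega>) UNIV \<and>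
                  {Y i \<omega>, Y j \<omega>} \<in> E \<omega>} \<in> sets P) \<and>
        (\<forall>\<omega>\<in>space P. \<forall>a b z.
           (a \<in> V \<omega> \<longleftrightarrow> z + a \<in> V (\<theta> z \<omega>)) \<and>
           ({a, b} \<in> E \<omega> \<longleftrightarrow> {z + a, z + b} \<in> E (\<theta> z \<omega>))))"

section \<open>Networks and the spaces of isomorphism classes\<close>

text \<open>
  Mark spaces are metric spaces whose carrier is a subset of \<^typ>\<open>'m\<close>. A separable metric space has at
  most continuum many points, so with \<^typ>\<open>real\<close> for \<^typ>\<open>'m\<close> every complete separable metric
  space occurs up to isometry.
\<close>

record ('v, 'm) network =
  verts :: "'v set"
  edges :: "'v set set"
  vmark :: "'v \<Rightarrow> 'm"
  emark :: "'v \<Rightarrow> 'v set \<Rightarrow> 'm"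

definition is_network :: "'m metric \<Rightarrow> ('v, 'm) network \<Rightarrow> bool" where
  "is_network Xi N \<longleftrightarrow>
     simple_graph (verts N) (edges N) \<and>
     connected_graph (verts N) (edges N) \<and>
     locally_finite_graph (verts N) (edges N) \<and>
     (\<forall>v\<in>verts N. vmark N v \<in> mspace Xi) \<and>
     (\<forall>e\<in>edges N. \<forall>v\<in>e. emark N v e \<in> mspace Xi)"

text \<open>
  Isomorphisms of the underlying graphs. The lists \<open>os\<close>, \<open>os'\<close> hold the distinguished vertices:
  one for rooted networks, two for networks with an ordered pair of distinguished vertices.
\<close>

definition rooted_graph_iso ::
  "('u, 'm) network \<Rightarrow> 'u list \<Rightarrow> ('v, 'm) network \<Rightarrow> 'v list \<Rightarrow>
   ('u \<Rightarrow> 'v) \<Rightarrow> ('u set \<Rightarrow> 'v set) \<Rightarrow> bool" where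
  "rooted_graph_iso N os N' os' f g \<longleftrightarrow>
     bij_betw f (verts N) (verts N') \<and>
     bij_betw g (edges N) (edges N') \<and>
     (\<forall>u\<in>verts N. \<forall>v\<in>verts N. {u, v} \<in> edges N \<longleftrightarrow> {f u, f v} \<in> edges N') \<and>
     (\<forall>u v. {u, v} \<in> edges N \<longrightarrow> g {u, v} = {f u, f v}) \<and>
     map f os = os'"

definition rooted_iso ::
  "('u, 'm) network \<Rightarrow> 'u list \<Rightarrow> ('v, 'm) network \<Rightarrow> 'v list \<Rightarrow> bool" where
  "rooted_iso N os N' os' \<longleftrightarrow>
     (\<exists>f g. rooted_graph_iso N os N' os' f g \<and>
        (\<forall>v\<in>verts N. vmark N v = vmark N' (f v)) \<and>
        (\<forall>e\<in>edges N. \<forall>v\<in>e. emark N v e = emark N' (f v) (g e)))"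

definition rooted_iso_upto ::
  "'m metric \<Rightarrow> real \<Rightarrow> ('u, 'm) network \<Rightarrow> 'u list \<Rightarrow> ('v, 'm) network \<Rightarrow> 'v list \<Rightarrow> bool" where
  "rooted_iso_upto Xi \<epsilon> N os N' os' \<longleftrightarrow>
     (\<exists>f g. rooted_graph_iso N os N' os' f g \<and>
        (\<forall>v\<in>verts N. mdist Xi (vmark N v) (vmark N' (f v)) \<le> \<epsilon>) \<and>
        (\<forall>e\<in>edges N. \<forall>v\<in>e. mdist Xi (emark N v e) (emark N' (f v) (g e)) \<le> \<epsilon>))"

text \<open>The subnetwork induced by the vertices at graph distance at most \<open>n\<close> from some vertex in \<open>os\<close>.\<close>

definition graph_ball :: "('v, 'm) network \<Rightarrow> 'v list \<Rightarrow> nat \<Rightarrow> ('v, 'm) network" where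
  "graph_ball N os n =
     (let B = {v\<in>verts N. \<exists>u\<in>set os. \<exists>k\<le>n. (u, v) \<in> adj (edges N) ^^ k}
      in N\<lparr>verts := B, edges := {e\<in>edges N. e \<subseteq> B}\<rparr>)"

type_synonym 'm net_class = "((nat, 'm) network \<times> nat list) set"

text \<open>
  A connected locally finite graph has countably many vertices, so each isomorphism class has
  representatives with vertices in \<^typ>\<open>nat\<close>, and a class is encoded as the set of these.
\<close>

definition net_class :: "'m metric \<Rightarrow> (nat, 'm) network \<Rightarrow> nat list \<Rightarrow> 'm net_class" where
  "net_class Xi N os =
     {(N', os'). is_network Xi N' \<and> set os' \<subseteq> verts N' \<and> rooted_iso N os N' os'}"

definition net_classes :: "'m metric \<Rightarrow> nat \<Rightarrow> 'm net_class set" where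
  "net_classes Xi k =
     {net_class Xi N os | N os. is_network Xi N \<and> set os \<subseteq> verts N \<and> length os = k}"

text \<open>
  \<open>2\<close> to the power \<open>-\<alpha>\<close>; by convention \<open>\<alpha> = 0\<close> if no radius qualifies, and the distance is \<open>0\<close> if
  \<open>\<alpha>\<close> is infinite.
\<close>

definition net_dist :: "'m metric \<Rightarrow> 'm net_class \<Rightarrow> 'm net_class \<Rightarrow> real" where
  "net_dist Xi c c' =
     (let \<alpha> = (SUP r\<in>{r::real. r > 0 \<and>
                  (\<exists>(N, os)\<in>c. \<exists>(N', os')\<in>c'.
                     rooted_iso_upto Xi (1 / r)
                       (graph_ball N os (nat \<lceil>r\<rceil>)) os (graph_ball N' os' (nat \<lceil>r\<rceil>)) os')}. ennreal r)
      in if \<alpha> = \<top> then 0 else 2 powr (- enn2real \<alpha>))"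

text \<open>
  The Borel structure of the topology in which a set is open if it contains a ball about each of
  its points. This is spelled out instead of using \<^const>\<open>Metric_space.mtopology\<close> because the distance,
  with marks compared at precision \<open>1/r\<close>, satisfies the triangle inequality only in a relaxed form.
\<close>

definition net_space :: "'m metric \<Rightarrow> nat \<Rightarrow> 'm net_class measure" where
  "net_space Xi k =
     sigma (net_classes Xi k)
       {U. U \<subseteq> net_classes Xi k \<and>
           (\<forall>c\<in>U. \<exists>\<epsilon>>0. \<forall>c'\<in>net_classes Xi k. net_dist Xi c c' < \<epsilon> \<longrightarrow> c' \<in> U)}"

abbreviation "G_star Xi \<equiv> net_space Xi 1"
abbreviation "G_star_star Xi \<equiv> net_space Xi 2"

text \<open>
  Random elements of \<open>G_star\<close> are given by representatives \<open>(G \<omega>, rt \<omega>)\<close>, of which only the class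
  has to depend measurably on \<open>\<omega>\<close>.
\<close>

definition unimodular_network ::
  "'m metric \<Rightarrow> 'w measure \<Rightarrow> ('w \<Rightarrow> (nat, 'm) network) \<Rightarrow> ('w \<Rightarrow> nat) \<Rightarrow> bool" where
  "unimodular_network Xi Q G rt \<longleftrightarrow>
     mcomplete_of Xi \<and> separable_space (mtopology_of Xi) \<and>
     (\<forall>\<omega>\<in>space Q. is_network Xi (G \<omega>) \<and> rt \<omega> \<in> verts (G \<omega>)) \<and>
     (\<lambda>\<omega>. net_class Xi (G \<omega>) [rt \<omega>]) \<in> measurable Q (G_star Xi) \<and>
     (\<forall>g \<in> borel_measurable (G_star_star Xi). (\<forall>c\<in>space (G_star_star Xi). 0 \<le> g c) \<longrightarrow>
        (\<integral>\<^sup>+\<omega>. (\<integral>\<^sup>+v. ennreal (g (net_class Xi (G \<omega>) [rt \<omega>, v])) \<partial>count_space (verts (G \<omega>))) \<partial>Q) =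
        (\<integral>\<^sup>+\<omega>. (\<integral>\<^sup>+v. ennreal (g (net_class Xi (G \<omega>) [v, rt \<omega>])) \<partial>count_space (verts (G \<omega>))) \<partial>Q))"

section \<open>Embeddings\<close>

definition embedding ::
  "'m metric \<Rightarrow> 'w measure \<Rightarrow> ('w \<Rightarrow> (nat, 'm) network) \<Rightarrow> ('w \<Rightarrow> nat) \<Rightarrow>
   ('m net_class \<Rightarrow> 'x::topological_group_add measure) \<Rightarrow> bool" where
  "embedding Xi Q G rt \<eta> \<longleftrightarrow>
     prob_space Q \<and>
     unimodular_network Xi Q G rt \<and>
     \<eta> \<in> measurable (G_star Xi) counting_measure_space \<and>
     (\<forall>c\<in>space (G_star Xi). 0 \<in> points (\<eta> c)) \<and>
     (\<exists>t \<in> borel_measurable (G_star_star Xi).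
        (\<forall>N. is_network Xi N \<longrightarrow> (\<forall>u\<in>verts N. \<forall>v\<in>verts N.
           \<eta> (net_class Xi N [v]) = translate (- t (net_class Xi N [u, v])) (\<eta> (net_class Xi N [u])) \<and>
           t (net_class Xi N [v, u]) = - t (net_class Xi N [u, v]))) \<and>
        (AE \<omega> in Q. bij_betw (\<lambda>v. t (net_class Xi (G \<omega>) [rt \<omega>, v])) (verts (G \<omega>))
                      (points (\<eta> (net_class Xi (G \<omega>) [rt \<omega>])))))"

text \<open>\<open>Q\<close> is meant to be the Palm probability measure of \<open>m\<close>.\<close>

definition palm_version_is_embedding ::
  "'m metric \<Rightarrow> 'w measure \<Rightarrow> ('w \<Rightarrow> 'x::topological_group_add measure) \<Rightarrow>
   ('w \<Rightarrow> (nat, 'm) network) \<Rightarrow> ('w \<Rightarrow> nat) \<Rightarrow> bool" where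
  "palm_version_is_embedding Xi Q m G rt \<longleftrightarrow>
     (\<exists>\<eta>. embedding Xi Q G rt \<eta> \<and> (AE \<omega> in Q. m \<omega> = \<eta> (net_class Xi (G \<omega>) [rt \<omega>])))"

end

theory Submission
  imports Defs
begin

text \<open>
  The connecting graph becomes a network when every half-edge $(X,\{X,Z\})$ is marked with the
  displacement $X^{-1}Z$, in the additive notation \<open>- X + Z\<close>. Left translations do not change these
  marks, so the isomorphism class of the network rooted at a point does not know where the points
  lie; but it knows where they lie relative to the root, because the marks along any path from the
  root to a vertex add up to the position of that vertex seen from the root. This gives the
  embedding: \<open>\<eta>\<close> puts a point at the displacement of every vertex from the root, and \<open>t\<close> is the
  displacement between two vertices. Networks whose marks are inconsistent, or whose displacements
  accumulate, are sent to the point mass at \<open>0\<close> with \<open>t = 0\<close>; both sorts of networks are closed under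
  changing the root, so the covariance conditions hold for every network
  (\<open>class_embed_covariant\<close>).

  Unimodularity of the network under the Palm measure is the mass transport principle
  (\<open>mass_exchange\<close>): for a quantity \<open>H \<omega> x y\<close> that is invariant under simultaneous translation, Tonelli,
  stationarity and the two-sided invariance of Haar measure show that the expected sum of
  \<open>w x * H \<omega> x y\<close> over all pairs of points equals that of \<open>w y * H \<omega> x y\<close>. The same lemma with
  \<open>H\<close> the indicator of the diagonal says that the mean measure of the process is proportional to
  Haar measure, which is what makes the intensity well defined (\<open>campbell\<close>).

  Three points need care beyond this.

  \<^item> The Borel structure of the spaces of isomorphism classes. The group is coded into the Cantor
    space, which is transported to the reals as an ultrametric \<open>mark_metric\<close>. For it, agreement of
    marks up to \<open>1/r\<close> is an equivalence relation, so the open sets are generated by the properties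
    that depend only on a finite ball and finitely many bits of the marks. Measurability is
    then decided on concrete rooted networks (\<open>rooted_space\<close>), and transferred to classes by
    \<open>cls_measurable\<close> and \<open>rep_measurable\<close>.

  \<^item> Measurability of the displacement, which is defined by the existence of paths. Existential
    quantification over a vertex is a projection, and it preserves measurability because balls
    contain finitely many vertices: the number of vertices of a ball with a given property
    depends measurably on the network (\<open>ext_count_measurable\<close>).

  \<^item> Null sets. The enumeration of the points is only good almost surely under \<open>P\<close>, and a \<open>P\<close>-null
    set may have full Palm measure, as the event that \<open>0\<close> is a point often does. However, for Haar-almost
    every \<open>z\<close> the translation by \<open>z\<close> takes Palm-almost every \<open>\<omega>\<close> out of a given \<open>P\<close>-null
    set (\<open>ex_good_shift\<close>). Enumerating the points of the translate and translating back yields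
    an enumeration that is good Palm-almost surely.
\<close>

section \<open>Marks: an ultrametric of the Cantor space on the reals\<close>

text \<open>
  An arbitrary bijection with the subsets of the natural numbers: the reals serve as a set of the
  cardinality of the Cantor space.
\<close>

definition mark_bits :: "real \<Rightarrow> nat set" where
  "mark_bits = (SOME f. bij f)"

lemma bij_mark_bits: "bij mark_bits"
proof -
  have "\<exists>f :: real \<Rightarrow> nat set. bij f"
    using nat_sets_eqpoll_reals eqpoll_sym unfolding eqpoll_def by blast
  then show ?thesis
    unfolding mark_bits_def by (rule someI_ex)
qed

lemma mark_bits_eq_iff [simp]: "mark_bits a = mark_bits b \<longleftrightarrow> a = b"
  using bij_mark_bits by (auto simp: bij_def inj_eq)

lemma mark_bits_surj: obtains a where "mark_bits a = S"
  using bij_mark_bits by (metis bij_pointE)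

text \<open>
  Agreement in the first \<open>n\<close> bits. By the lemma \<open>mark_dist_le_iff\<close> below, closeness of marks is
  such an agreement, hence transitive without any loss of precision.
\<close>

definition mark_agree :: "nat \<Rightarrow> real \<Rightarrow> real \<Rightarrow> bool" where
  "mark_agree n a b \<longleftrightarrow> mark_bits a \<inter> {..<n} = mark_bits b \<inter> {..<n}"

lemma mark_agree_iff: "mark_agree n a b \<longleftrightarrow> (\<forall>i<n. i \<in> mark_bits a \<longleftrightarrow> i \<in> mark_bits b)"
  unfolding mark_agree_def by auto

lemma mark_agree_refl [simp]: "mark_agree n a a"
  by (simp add: mark_agree_def)

lemma mark_agree_sym: "mark_agree n a b \<Longrightarrow> mark_agree n b a"
  by (simp add: mark_agree_def)

lemma mark_agree_trans: "mark_agree n a b \<Longrightarrow> mark_agree n b c \<Longrightarrow> mark_agree n a c"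
  by (simp add: mark_agree_def)

lemma mark_agree_mono: "mark_agree n a b \<Longrightarrow> k \<le> n \<Longrightarrow> mark_agree k a b"
  by (auto simp: mark_agree_iff)

definition mark_dist :: "real \<Rightarrow> real \<Rightarrow> real" where
  "mark_dist a b = (if a = b then 0 else 1 / real (Suc (LEAST i. \<not> (i \<in> mark_bits a \<longleftrightarrow> i \<in> mark_bits b))))"

lemma mark_dist_le_iff: "mark_dist a b \<le> 1 / real (Suc n) \<longleftrightarrow> mark_agree n a b"
proof (cases "a = b")
  case True
  then show ?thesis by (simp add: mark_dist_def)
next
  case False
  define k where "k = (LEAST i. \<not> (i \<in> mark_bits a \<longleftrightarrow> i \<in> mark_bits b))"
  have "\<exists>i. \<not> (i \<in> mark_bits a \<longleftrightarrow> i \<in> mark_bits b)"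
    using False mark_bits_eq_iff by blast
  then have k: "\<not> (k \<in> mark_bits a \<longleftrightarrow> k \<in> mark_bits b)"
    unfolding k_def by (rule LeastI_ex)
  have l: "i \<in> mark_bits a \<longleftrightarrow> i \<in> mark_bits b" if "i < k" for i
    using not_less_Least[of i] that unfolding k_def by blast
  have "mark_dist a b \<le> 1 / real (Suc n) \<longleftrightarrow> n \<le> k"
    using False unfolding mark_dist_def k_def[symmetric] by (simp add: field_simps)
  also have "\<dots> \<longleftrightarrow> mark_agree n a b"
    unfolding mark_agree_iff using k l by (meson leI le_less_trans less_le_trans not_le)
  finally show ?thesis .
qed

lemma mark_dist_nonneg: "0 \<le> mark_dist a b"
  by (simp add: mark_dist_def)

lemma mark_dist_self [simp]: "mark_dist a a = 0"
  by (simp add: mark_dist_def)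

lemma mark_dist_ultra: "mark_dist a c \<le> max (mark_dist a b) (mark_dist b c)"
proof (cases "a = b \<or> b = c \<or> a = c")
  case True
  then show ?thesis
    using mark_dist_nonneg mark_dist_self by (auto simp: le_max_iff_disj)
next
  case False
  obtain k l where k: "mark_dist a b = 1 / real (Suc k)" and l: "mark_dist b c = 1 / real (Suc l)"
    using False unfolding mark_dist_def by metis
  have "mark_agree (min k l) a b" "mark_agree (min k l) b c"
    using mark_dist_le_iff[of a b k] mark_dist_le_iff[of b c l] k l
    by (auto intro: mark_agree_mono)
  then have "mark_dist a c \<le> 1 / real (Suc (min k l))"
    by (metis mark_agree_trans mark_dist_le_iff)
  then show ?thesis
    by (auto simp: k l min_def max_def field_simps split: if_splits)
qed

lemma mark_metric_space: "Metric_space UNIV mark_dist"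
proof
  fix a b c
  show "mark_dist a c \<le> mark_dist a b + mark_dist b c"
    using mark_dist_ultra[of a c b] mark_dist_nonneg[of a b] mark_dist_nonneg[of b c] by linarith
  show "mark_dist a b = mark_dist b a"
    by (simp add: mark_dist_def eq_commute)
qed (auto simp: mark_dist_def)

definition mark_metric :: "real metric" where
  "mark_metric = metric (UNIV, mark_dist)"

lemma mspace_mark_metric [simp]: "mspace mark_metric = UNIV"
  by (simp add: mark_metric_def Metric_space.mspace_metric[OF mark_metric_space])

lemma mdist_mark_metric [simp]: "mdist mark_metric = mark_dist"
  by (simp add: mark_metric_def Metric_space.mdist_metric[OF mark_metric_space])

lemma ex_small_precision: "\<epsilon> > 0 \<Longrightarrow> \<exists>n. 1 / real (Suc n) < \<epsilon>"
  by (metis inverse_eq_divide reals_Archimedean)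

text \<open>
  Every bit of a Cauchy sequence is eventually constant, and the limit consists of the eventual bits.
\<close>

lemma mark_metric_complete: "mcomplete_of mark_metric"
proof -
  interpret Metric_space UNIV mark_dist by (rule mark_metric_space)
  have "\<exists>x. limitin mtopology s x sequentially" if s: "MCauchy s" for s
  proof -
    have "\<exists>N. \<forall>j\<ge>N. \<forall>k\<ge>N. mark_agree n (s j) (s k)" for n
    proof -
      have "1 / real (Suc n) > 0" by simp
      then obtain N where "\<And>j k. N \<le> j \<Longrightarrow> N \<le> k \<Longrightarrow> mark_dist (s j) (s k) < 1 / real (Suc n)"
        using s unfolding MCauchy_def by blast
      then show ?thesis
        by (metis less_imp_le mark_dist_le_iff)
    qed
    then obtain N where N: "\<And>n j k. N n \<le> j \<Longrightarrow> N n \<le> k \<Longrightarrow> mark_agree n (s j) (s k)"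
      by metis
    obtain x where x: "mark_bits x = {i. i \<in> mark_bits (s (N (Suc i)))}"
      by (rule mark_bits_surj)
    have lim: "mark_agree n (s j) x" if "\<forall>i\<le>n. N i \<le> j" for n j
      unfolding mark_agree_iff
    proof (intro allI impI)
      fix i assume "i < n"
      then have "mark_agree (Suc i) (s j) (s (N (Suc i)))"
        using that N by simp
      then show "i \<in> mark_bits (s j) \<longleftrightarrow> i \<in> mark_bits x"
        by (auto simp: x mark_agree_iff)
    qed
    have "limitin mtopology s x sequentially"
      unfolding limit_metric_sequentially
    proof (intro conjI allI impI)
      fix \<epsilon> :: real assume "\<epsilon> > 0"
      then obtain n where n: "1 / real (Suc n) < \<epsilon>" using ex_small_precision by blast
      have "\<forall>j\<ge>(\<Sum>i\<le>n. N i). s j \<in> UNIV \<and> mark_dist (s j) x < \<epsilon>"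
      proof safe
        fix j assume j: "(\<Sum>i\<le>n. N i) \<le> j"
        have "\<forall>i\<le>n. N i \<le> j"
          using j by (meson atMost_iff finite_atMost le_trans member_le_sum zero_le)
        then show "mark_dist (s j) x < \<epsilon>"
          using lim[of n j] n by (meson le_less_trans mark_dist_le_iff)
      qed simp
      then show "\<exists>N. \<forall>n\<ge>N. s n \<in> UNIV \<and> mark_dist (s n) x < \<epsilon>" by blast
    qed simp
    then show ?thesis by blast
  qed
  then show ?thesis
    unfolding mark_metric_def mcomplete_of mcomplete_def by blast
qed

text \<open>
  The marks with finitely many bits set are dense.
\<close>

lemma mark_metric_separable: "separable_space (mtopology_of mark_metric)"
proof -
  interpret Metric_space UNIV mark_dist by (rule mark_metric_space)
  let ?D = "mark_bits -` Collect finite"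
  have c: "countable ?D"
    unfolding bij_vimage_eq_inv_image[OF bij_mark_bits]
    by (rule countable_image[OF countable_Collect_finite])
  have "x \<in> mtopology closure_of ?D" for x
    unfolding metric_closure_of
  proof (safe, goal_cases)
    case (2 r)
    then obtain n where n: "1 / real (Suc n) < r" using ex_small_precision by blast
    obtain y where y: "mark_bits y = mark_bits x \<inter> {..<n}" by (rule mark_bits_surj)
    then have "mark_agree n x y" by (auto simp: mark_agree_def)
    then have "y \<in> mball x r"
      using n mark_dist_le_iff[of x y n] by auto
    moreover have "y \<in> ?D" using y by simp
    ultimately show ?case by blast
  qed simp
  then have "mtopology closure_of ?D = UNIV" by blast
  then show ?thesis
    unfolding mark_metric_def mtopology_of separable_space_def using c by auto
qed

text \<open>
  The Borel sets of the Cantor space, generated by the single bits.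
\<close>

definition mark_algebra :: "real measure" where
  "mark_algebra = sigma UNIV (range (\<lambda>i. {a. i \<in> mark_bits a}))"

lemma space_mark_algebra [simp]: "space mark_algebra = UNIV"
  by (simp add: mark_algebra_def)

lemma mark_bit_measurable [measurable]: "Measurable.pred mark_algebra (\<lambda>a. i \<in> mark_bits a)"
  unfolding pred_def mark_algebra_def by auto

lemma measurable_mark_algebraI:
  assumes "\<And>i. Measurable.pred M (\<lambda>x. i \<in> mark_bits (f x))"
  shows "f \<in> measurable M mark_algebra"
  unfolding mark_algebra_def
  by (rule measurable_measure_of) (use assms in \<open>auto simp: pred_def vimage_def Int_def conj_commute\<close>)

section \<open>Coding a locally compact group into marks\<close>

lemma compact_neighbourhood:
  fixes x :: "'x::t2_space"
  assumes lc: "locally_compact_space (euclidean :: 'x topology)" and "open U" "x \<in> U"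
  obtains V where "open V" "x \<in> V" "compact (closure V)" "closure V \<subseteq> U"
proof -
  have "Hausdorff_space (euclidean :: 'x topology)"
    unfolding Hausdorff_space_def disjnt_def by simp (meson hausdorff)
  then have "neighbourhood_base_of (\<lambda>T. compactin euclidean T \<and> closedin euclidean T) (euclidean :: 'x topology)"
    using lc locally_compact_space_neighbourhood_base_closedin[of "euclidean :: 'x topology"] by simp
  then obtain V T where VT: "open V" "compact T" "closed T" "x \<in> V" "V \<subseteq> T" "T \<subseteq> U"
    unfolding neighbourhood_base_of using assms(2,3) by (metis closed_closedin compactin_euclidean_iff open_openin)
  then have "closure V \<subseteq> T" by (simp add: closure_minimal)
  then have "compact (closure V)"
    using compact_Int_closed[OF VT(2) closed_closure[of V]] by (simp add: Int_absorb1)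
  then show ?thesis
    using that[of V] VT \<open>closure V \<subseteq> T\<close> by blast
qed

lemma relatively_compact_base:
  assumes lc: "locally_compact_space (euclidean :: 'x::{second_countable_topology,t2_space} topology)"
  obtains B :: "nat \<Rightarrow> 'x::{second_countable_topology,t2_space} set" where "topological_basis (range B)" "\<And>n. compact (closure (B n))"
    "\<And>n. open (B n)" "\<And>U x. open U \<Longrightarrow> x \<in> U \<Longrightarrow> \<exists>n. x \<in> B n \<and> B n \<subseteq> U"
proof -
  obtain A :: "'x set set" where A: "countable A" "topological_basis A"
    using ex_countable_basis by blast
  define C where "C = {U\<in>A. compact (closure U)}"
  have basis: "topological_basis C"
  proof (rule topological_basisI)
    show "open U" if "U \<in> C" for U
      using that A(2) by (auto simp: C_def topological_basis_open)
    fix U and x :: 'x assume "open U" "x \<in> U"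
    then obtain V where V: "open V" "x \<in> V" "compact (closure V)" "closure V \<subseteq> U"
      using compact_neighbourhood[OF lc] by blast
    then obtain W where W: "W \<in> A" "x \<in> W" "W \<subseteq> V"
      using topological_basisE[OF A(2)] by blast
    have "compact (closure V \<inter> closure W)"
      using V(3) by (intro compact_Int_closed) auto
    then have "compact (closure W)"
      using closure_mono[OF W(3)] by (simp add: Int_absorb1)
    then show "\<exists>W\<in>C. x \<in> W \<and> W \<subseteq> U"
      using W V closure_subset unfolding C_def by blast
  qed
  have "C \<noteq> {}"
    using basis by (metis empty_iff open_UNIV UNIV_I topological_basisE)
  moreover have "countable C" using A(1) unfolding C_def by simp
  ultimately have "range (from_nat_into C) = C"
    by (simp add: range_from_nat_into)
  then obtain B :: "nat \<Rightarrow> 'x set" where B: "range B = C" ..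
  show ?thesis
  proof (rule that)
    show "topological_basis (range B)" using basis B by simp
    have "B n \<in> C" for n using B by blast
    then show "compact (closure (B n))" "open (B n)" for n
      using A(2) by (auto simp: C_def topological_basis_open)
    show "\<exists>n. x \<in> B n \<and> B n \<subseteq> U" if U: "open U" "x \<in> U" for U x
    proof -
      obtain W where "W \<in> C" "x \<in> W" "W \<subseteq> U"
        by (rule topological_basisE[OF basis U])
      then show ?thesis using B by blast
    qed
  qed
qed

text \<open>
  A point is coded by the set of base sets that contain it. For the decoding to be measurable the
  codes must form a measurable set. This is where local compactness enters: by the finite
  intersection property in one relatively compact base set, being a code is a countable combination
  of conditions on finitely many bits each.
\<close>

lemma Borel_coding:
  assumes lc: "locally_compact_space (euclidean :: 'x::{second_countable_topology,t2_space,zero} topology)"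
  obtains code :: "'x::{second_countable_topology,t2_space,zero} \<Rightarrow> real" and decode :: "real \<Rightarrow> 'x"
  where "\<And>x. decode (code x) = x"
    "code \<in> measurable borel mark_algebra" "decode \<in> measurable mark_algebra borel"
proof -
  obtain B :: "nat \<Rightarrow> 'x set" where B: "topological_basis (range B)" "\<And>n. compact (closure (B n))"
    and opn: "\<And>n. open (B n)"
    and base: "\<And>U x. open U \<Longrightarrow> x \<in> U \<Longrightarrow> \<exists>n. x \<in> B n \<and> B n \<subseteq> U"
    by (rule relatively_compact_base[OF lc]) (rule that)
  define code where "code x = inv mark_bits {n. x \<in> B n}" for x
  have code: "mark_bits (code x) = {n. x \<in> B n}" for x
    unfolding code_def by (rule surj_f_inv_f) (rule bij_is_surj[OF bij_mark_bits])
  have inj: "x = y" if "code x = code y" for x y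
  proof (rule ccontr)
    assume "x \<noteq> y"
    then obtain U where "open U" "x \<in> U" "y \<notin> U" using t1_space by blast
    then obtain n where "x \<in> B n" "B n \<subseteq> U" using base[of U x] by auto
    moreover have "{n. x \<in> B n} = {n. y \<in> B n}"
      using that code by metis
    ultimately show False using \<open>y \<notin> U\<close> by (auto simp: set_eq_iff)
  qed
  define decode where "decode a = (if a \<in> range code then inv code a else 0)" for a
  have dec: "decode (code x) = x" for x
    using inj by (auto simp: decode_def inv_f_f inj_def)
  have nested: "\<exists>k. x \<in> B k \<and> closure (B k) \<subseteq> B n" if x: "x \<in> B n" for x n
  proof -
    obtain V where V: "open V" "x \<in> V" "compact (closure V)" "closure V \<subseteq> B n"
      by (rule compact_neighbourhood[OF lc opn x]) (rule that)
    then obtain k where "x \<in> B k" "B k \<subseteq> V" using base[of V x] by auto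
    then show ?thesis using V closure_mono[of "B k" V] by (intro exI[of _ k]) auto
  qed
  (* Consistency is required of finitely many base sets only; the closures in the second condition
     bring a point of the intersection back into the open base sets themselves. *)
  have range: "a \<in> range code \<longleftrightarrow>
     (\<exists>n. n \<in> mark_bits a) \<and>
     (\<forall>n. n \<in> mark_bits a \<longrightarrow> (\<exists>k. k \<in> mark_bits a \<and> closure (B k) \<subseteq> B n)) \<and>
     (\<forall>n. \<exists>x. \<forall>i<n. (i \<in> mark_bits a \<longrightarrow> x \<in> closure (B i)) \<and> (i \<notin> mark_bits a \<longrightarrow> x \<notin> B i))"
    (is "_ \<longleftrightarrow> ?R") for a
  proof
    assume "a \<in> range code"
    then obtain x where x: "a = code x" by blast
    have "\<exists>n. x \<in> B n"
      using base[of UNIV x] by auto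
    moreover have "\<forall>n. x \<in> B n \<longrightarrow> (\<exists>k. x \<in> B k \<and> closure (B k) \<subseteq> B n)"
      using nested by blast
    moreover have "x \<in> B i \<longrightarrow> x \<in> closure (B i)" for i
      using closure_subset by blast
    ultimately show ?R
      unfolding x code mem_Collect_eq by (intro conjI allI exI[of _ x]) simp_all
  next
    assume R: ?R
    then obtain n0 where n0: "n0 \<in> mark_bits a" by blast
    define F where "F i = (if i \<in> mark_bits a then closure (B i) else - B i)" for i
    have "closure (B n0) \<inter> (\<Inter>i\<in>UNIV. F i) \<noteq> {}"
    proof (rule compact_imp_fip_image[OF B(2)])
      show "closed (F i)" for i using opn by (simp add: F_def closed_Compl)
      fix I :: "nat set" assume I: "finite I"
      then obtain n where n: "\<forall>i\<in>insert n0 I. i < n"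
        by (meson finite_insert finite_nat_set_iff_bounded)
      then obtain x where "\<forall>i<n. (i \<in> mark_bits a \<longrightarrow> x \<in> closure (B i)) \<and> (i \<notin> mark_bits a \<longrightarrow> x \<notin> B i)"
        using R by blast
      then have "x \<in> closure (B n0) \<inter> (\<Inter>i\<in>I. F i)"
        using n n0 by (auto simp: F_def)
      then show "closure (B n0) \<inter> (\<Inter>i\<in>I. F i) \<noteq> {}" by blast
    qed
    then obtain x where x: "\<And>i. x \<in> F i" by blast
    have "mark_bits (code x) = mark_bits a"
      unfolding code
    proof (intro set_eqI iffI; unfold mem_Collect_eq)
      fix i assume "x \<in> B i" then show "i \<in> mark_bits a" using x[of i] by (auto simp: F_def split: if_splits)
    next
      fix i assume "i \<in> mark_bits a"
      then obtain k where "k \<in> mark_bits a" "closure (B k) \<subseteq> B i" using R by blast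
      then show "x \<in> B i" using x[of k] by (auto simp: F_def)
    qed
    then show "a \<in> range code" by (metis mark_bits_eq_iff rangeI)
  qed
  have [measurable]: "Measurable.pred mark_algebra (\<lambda>a. a \<in> range code)"
    unfolding range
  proof (intro pred_intros_logic pred_intros_countable)
    fix n
    (* The condition is on the pattern of the first n bits, and there are finitely many patterns. *)
    have "(\<lambda>a. \<exists>x. \<forall>i<n. (i \<in> mark_bits a \<longrightarrow> x \<in> closure (B i)) \<and> (i \<notin> mark_bits a \<longrightarrow> x \<notin> B i)) =
       (\<lambda>a. \<exists>S\<in>{S\<in>Pow {..<n}. \<exists>x. \<forall>i<n. (i \<in> S \<longrightarrow> x \<in> closure (B i)) \<and> (i \<notin> S \<longrightarrow> x \<notin> B i)}.
              \<forall>i<n. i \<in> mark_bits a \<longleftrightarrow> i \<in> S)" (is "?L = ?R")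
    proof (intro ext iffI)
      fix a assume "?L a" then show "?R a"
        by (intro bexI[of _ "mark_bits a \<inter> {..<n}"]) simp_all
    next
      fix a assume "?R a"
      then obtain S x where "\<forall>i<n. i \<in> mark_bits a \<longleftrightarrow> i \<in> S"
        "\<forall>i<n. (i \<in> S \<longrightarrow> x \<in> closure (B i)) \<and> (i \<notin> S \<longrightarrow> x \<notin> B i)"
        by blast
      then show "?L a" by (intro exI[of _ x]) simp
    qed
    moreover have "Measurable.pred mark_algebra ?R"
      by (intro pred_intros_finite pred_intros_countable pred_intros_logic mark_bit_measurable
          finite_subset[OF _ finite_Pow_iff[THEN iffD2, OF finite_lessThan[of n]]]) auto
    ultimately show "Measurable.pred mark_algebra ?L" by simp
  qed simp_all
  have "code \<in> measurable borel mark_algebra"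
    by (rule measurable_mark_algebraI) (use opn in \<open>simp add: code pred_def\<close>)
  moreover have "decode \<in> measurable mark_algebra borel"
    unfolding borel_eq_countable_basis[OF countable_image[OF countableI_type] B(1)]
  proof (rule measurable_measure_of)
    fix U assume "U \<in> range B"
    then obtain n where U: "U = B n" by blast
    have "decode a \<in> B n \<longleftrightarrow> (a \<in> range code \<and> n \<in> mark_bits a) \<or> (a \<notin> range code \<and> 0 \<in> B n)" for a
    proof (cases "a \<in> range code")
      case True
      then obtain x where "a = code x" by blast
      then show ?thesis using True dec code by simp
    next
      case False
      then show ?thesis by (simp add: decode_def)
    qed
    then have "decode -` U \<inter> space mark_algebra =
      {a\<in>space mark_algebra. (a \<in> range code \<and> n \<in> mark_bits a) \<or> (a \<notin> range code \<and> 0 \<in> B n)}"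
      unfolding U by auto
    also have "\<dots> \<in> sets mark_algebra" by measurable
    finally show "decode -` U \<inter> space mark_algebra \<in> sets mark_algebra" .
  qed auto
  ultimately show ?thesis using dec by (intro that)
qed

lemma compact_exhaustion:
  assumes lc: "locally_compact_space (euclidean :: 'x::{second_countable_topology,t2_space} topology)"
  obtains K :: "nat \<Rightarrow> 'x::{second_countable_topology,t2_space} set"
  where "\<And>n. compact (K n)" "\<And>C. compact C \<Longrightarrow> \<exists>n. C \<subseteq> K n" "incseq K" "(\<Union>n. K n) = UNIV"
proof -
  obtain B :: "nat \<Rightarrow> 'x set" where B: "topological_basis (range B)" "\<And>n. compact (closure (B n))"
    and opn: "\<And>n. open (B n)"
    and base: "\<And>U x. open U \<Longrightarrow> x \<in> U \<Longrightarrow> \<exists>n. x \<in> B n \<and> B n \<subseteq> U"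
    by (rule relatively_compact_base[OF lc]) (rule that)
  have cov: "(\<Union>n. B n) = UNIV"
  proof (intro set_eqI iffI UNIV_I)
    fix x
    obtain n where "x \<in> B n" using base[of UNIV x] by auto
    then show "x \<in> (\<Union>n. B n)" by blast
  qed
  define K where "K n = (\<Union>i\<le>n. closure (B i))" for n
  have 1: "compact (K n)" for n unfolding K_def using B(2) by auto
  have 2: "\<exists>n. C \<subseteq> K n" if C: "compact C" for C
  proof -
    obtain I where I: "finite I" "C \<subseteq> (\<Union>i\<in>I. B i)"
    proof (rule compactE_image[OF C, of UNIV B])
      show "C \<subseteq> (\<Union>i\<in>UNIV. B i)" using cov by simp
    qed (use opn in auto)
    obtain n where "\<forall>i\<in>I. i \<le> n" using I(1) by (meson finite_nat_set_iff_bounded_le)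
    then have "(\<Union>i\<in>I. B i) \<subseteq> K n"
      unfolding K_def using closure_subset[of "B _"] by (intro UN_mono) auto
    then show ?thesis using I(2) by blast
  qed
  have 3: "incseq K"
    unfolding incseq_def K_def by (intro allI impI UN_mono) auto
  have "B n \<subseteq> K n" for n using closure_subset[of "B n"] unfolding K_def by blast
  then have "(\<Union>n. B n) \<subseteq> (\<Union>n. K n)" by (rule UN_mono[OF subset_refl])
  then have "(\<Union>n. K n) = UNIV" using cov by (metis top.extremum_uniqueI)
  with 1 2 3 show ?thesis by (rule that)
qed

section \<open>Balls and isomorphisms of networks\<close>

definition nball :: "('v, 'm) network \<Rightarrow> 'v list \<Rightarrow> nat \<Rightarrow> 'v set" where
  "nball N os n = {v\<in>verts N. \<exists>u\<in>set os. \<exists>k\<le>n. (u, v) \<in> adj (edges N) ^^ k}"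

lemma graph_ball_simps [simp]:
  "verts (graph_ball N os n) = nball N os n"
  "edges (graph_ball N os n) = {e\<in>edges N. e \<subseteq> nball N os n}"
  "vmark (graph_ball N os n) = vmark N"
  "emark (graph_ball N os n) = emark N"
  by (simp_all add: graph_ball_def nball_def Let_def)

lemma nball_subset_verts: "nball N os n \<subseteq> verts N"
  by (auto simp: nball_def)

lemma nball_mono: "m \<le> n \<Longrightarrow> nball N os m \<subseteq> nball N os n"
  unfolding nball_def using le_trans by blast

lemma roots_in_nball: "set os \<subseteq> verts N \<Longrightarrow> set os \<subseteq> nball N os n"
  unfolding nball_def by (auto intro!: bexI exI[of _ 0])

lemma nball_compose:
  assumes "set ps \<subseteq> nball N os j"
  shows "nball N ps n \<subseteq> nball N os (j + n)"
proof
  fix v assume "v \<in> nball N ps n"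
  then obtain u k where u: "u \<in> set ps" "k \<le> n" "(u, v) \<in> adj (edges N) ^^ k" "v \<in> verts N"
    by (auto simp: nball_def)
  moreover obtain q i where "q \<in> set os" "i \<le> j" "(q, u) \<in> adj (edges N) ^^ i"
    using u(1) assms by (auto simp: nball_def)
  ultimately show "v \<in> nball N os (j + n)"
    unfolding nball_def by (auto intro!: bexI[of _ q] exI[of _ "i + k"] simp: relpow_add)
qed

lemma edge_verts: "simple_graph V E \<Longrightarrow> {u, v} \<in> E \<Longrightarrow> u \<in> V \<and> v \<in> V \<and> u \<noteq> v"
  unfolding simple_graph_def by (fastforce simp: doubleton_eq_iff)

lemma simple_graph_edgeE:
  assumes "simple_graph V E" "e \<in> E"
  obtains u v where "e = {u, v}" "u \<in> V" "v \<in> V" "u \<noteq> v"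
  using assms unfolding simple_graph_def by blast

lemma walk_in_nball:
  assumes "(u, v) \<in> adj (edges N) ^^ n" "u \<in> set os" "v \<in> verts N" "n \<le> k"
  shows "v \<in> nball N os k"
  using assms unfolding nball_def by blast

text \<open>
  Edges inside \<open>A\<close> are all that is needed to carry the paths of length at most \<open>n\<close>, because these stay
  inside the ball, and hence inside \<open>A\<close>.
\<close>

lemma nball_image_subset:
  assumes sg: "simple_graph (verts N) (edges N)"
    and A': "f ` A \<subseteq> verts N'"
    and edge: "\<And>u v. u \<in> A \<Longrightarrow> v \<in> A \<Longrightarrow> {u, v} \<in> edges N \<Longrightarrow> {f u, f v} \<in> edges N'"
    and sub: "nball N ps n \<subseteq> A"
  shows "f ` nball N ps n \<subseteq> nball N' (map f ps) n"
proof
  fix v' assume "v' \<in> f ` nball N ps n"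
  then obtain v where v: "v \<in> nball N ps n" "v' = f v" by blast
  then obtain u k where u: "u \<in> set ps" "k \<le> n" "(u, v) \<in> adj (edges N) ^^ k"
    by (auto simp: nball_def)
  have "(u, x) \<in> adj (edges N) ^^ i \<Longrightarrow> x \<in> verts N \<Longrightarrow> i \<le> n \<Longrightarrow> (f u, f x) \<in> adj (edges N') ^^ i" for i x
  proof (induction i arbitrary: x)
    case (Suc i)
    then obtain y where y: "(u, y) \<in> adj (edges N) ^^ i" "{y, x} \<in> edges N"
      by (auto simp: adj_def)
    have yv: "y \<in> verts N" using edge_verts[OF sg y(2)] by simp
    have "y \<in> nball N ps n" "x \<in> nball N ps n"
      using u(1) yv walk_in_nball[OF y(1)] walk_in_nball[OF Suc.prems(1)] Suc.prems(2,3) by auto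
    then have "y \<in> A" "x \<in> A" using sub by auto
    then have "{f y, f x} \<in> edges N'" using edge y(2) by simp
    then show ?case
      using Suc.IH[OF y(1) yv] Suc.prems by (auto simp: adj_def)
  qed simp
  then have "(f u, f v) \<in> adj (edges N') ^^ k"
    using u subsetD[OF nball_subset_verts v(1)] by simp
  moreover have "f v \<in> verts N'" using v sub A' by blast
  ultimately show "v' \<in> nball N' (map f ps) n"
    unfolding nball_def v(2) using u by auto
qed

lemma nball_image:
  assumes sg: "simple_graph (verts N) (edges N)" "simple_graph (verts N') (edges N')"
    and f: "bij_betw f A A'" and A: "A \<subseteq> verts N" "A' \<subseteq> verts N'"
    and edge: "\<And>u v. u \<in> A \<Longrightarrow> v \<in> A \<Longrightarrow> {u, v} \<in> edges N \<longleftrightarrow> {f u, f v} \<in> edges N'"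
    and sub: "nball N ps n \<subseteq> A" "nball N' (map f ps) n \<subseteq> A'" and ps: "set ps \<subseteq> A"
  shows "bij_betw f (nball N ps n) (nball N' (map f ps) n)"
proof -
  let ?g = "inv_into A f"
  have g: "bij_betw ?g A' A" by (rule bij_betw_inv_into[OF f])
  have gf: "?g (f x) = x" if "x \<in> A" for x using f that by (simp add: bij_betw_inv_into_left)
  have fg: "f (?g x) = x" "?g x \<in> A" if "x \<in> A'" for x
    using f g that by (auto simp: bij_betw_inv_into_right dest: bij_betwE)
  have 1: "f ` nball N ps n \<subseteq> nball N' (map f ps) n"
    by (rule nball_image_subset[OF sg(1) _ _ sub(1)]) (use f A edge in \<open>auto simp: bij_betw_def\<close>)
  have "?g ` nball N' (map f ps) n \<subseteq> nball N (map ?g (map f ps)) n"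
    by (rule nball_image_subset[OF sg(2) _ _ sub(2)])
      (use g A edge fg in \<open>auto simp: bij_betw_def\<close>)
  also have "map ?g (map f ps) = ps"
    using ps gf by (auto intro!: map_idI simp: subset_iff)
  finally have 2: "nball N' (map f ps) n \<subseteq> f ` nball N ps n"
    using sub(2) fg by (auto simp: subset_iff image_subset_iff image_iff) (metis image_eqI)
  show ?thesis
    using 1 2 f sub(1) by (auto simp: bij_betw_def intro: inj_on_subset)
qed

text \<open>
  Isomorphisms between the induced subnetworks on \<open>A\<close> and \<open>A'\<close>, with marks compared by \<open>R\<close>. The edge map
  of a graph isomorphism is determined by its vertex map, so it is not mentioned. Full isomorphisms
  compare marks exactly on all vertices; local ones compare finitely many bits on a ball.
\<close>

definition iso_between ::
  "('m \<Rightarrow> 'm \<Rightarrow> bool) \<Rightarrow> 'u set \<Rightarrow> ('u, 'm) network \<Rightarrow> 'u list \<Rightarrow>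
    'v set \<Rightarrow> ('v, 'm) network \<Rightarrow> 'v list \<Rightarrow> ('u \<Rightarrow> 'v) \<Rightarrow> bool" where
  "iso_between R A N os A' N' os' f \<longleftrightarrow>
     bij_betw f A A' \<and> map f os = os' \<and>
     (\<forall>u\<in>A. \<forall>v\<in>A. {u, v} \<in> edges N \<longleftrightarrow> {f u, f v} \<in> edges N') \<and>
     (\<forall>v\<in>A. R (vmark N v) (vmark N' (f v))) \<and>
     (\<forall>u\<in>A. \<forall>v\<in>A. {u, v} \<in> edges N \<longrightarrow> R (emark N u {u, v}) (emark N' (f u) {f u, f v}))"

abbreviation full_iso ::
  "('u, 'm) network \<Rightarrow> 'u list \<Rightarrow> ('v, 'm) network \<Rightarrow> 'v list \<Rightarrow> ('u \<Rightarrow> 'v) \<Rightarrow> bool" where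
  "full_iso N os N' os' \<equiv> iso_between (=) (verts N) N os (verts N') N' os'"

abbreviation local_iso ::
  "nat \<Rightarrow> nat \<Rightarrow> ('u, real) network \<Rightarrow> 'u list \<Rightarrow> ('v, real) network \<Rightarrow> 'v list \<Rightarrow> ('u \<Rightarrow> 'v) \<Rightarrow> bool" where
  "local_iso r n N os N' os' \<equiv> iso_between (mark_agree n) (nball N os r) N os (nball N' os' r) N' os'"

lemma iso_between_refl: "(\<And>a. R a a) \<Longrightarrow> iso_between R A N os A N os id"
  by (simp add: iso_between_def)

lemma iso_between_sym:
  assumes f: "iso_between R A N os A' N' os' f" and os: "set os \<subseteq> A" and R: "\<And>a b. R a b \<Longrightarrow> R b a"
  shows "iso_between R A' N' os' A N os (inv_into A f)"
proof -
  let ?g = "inv_into A f"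
  have b: "bij_betw f A A'" using f by (simp add: iso_between_def)
  have g: "bij_betw ?g A' A" by (rule bij_betw_inv_into[OF b])
  have gf: "?g (f x) = x" if "x \<in> A" for x using b that by (simp add: bij_betw_inv_into_left)
  have fg: "f (?g x) = x" "?g x \<in> A" if "x \<in> A'" for x
    using b g that by (auto simp: bij_betw_inv_into_right dest: bij_betwE)
  have "map ?g os' = os"
    using f os gf unfolding iso_between_def by (auto intro!: map_idI simp: subset_iff)
  then show ?thesis
    using f g fg R unfolding iso_between_def by (smt (verit))
qed

lemma iso_between_trans:
  assumes f: "iso_between R A N os A' N' os' f" and g: "iso_between R A' N' os' A'' N'' os'' g"
    and R: "\<And>a b c. R a b \<Longrightarrow> R b c \<Longrightarrow> R a c"
  shows "iso_between R A N os A'' N'' os'' (g \<circ> f)"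
proof -
  have A': "f v \<in> A'" if "v \<in> A" for v
    using f that by (auto simp: iso_between_def dest: bij_betwE)
  have "R (emark N u {u, v}) (emark N'' (g (f u)) {g (f u), g (f v)})"
    if "u \<in> A" "v \<in> A" "{u, v} \<in> edges N" for u v
    using f g that A' unfolding iso_between_def by (blast intro: R)
  moreover have "R (vmark N u) (vmark N'' (g (f u)))" if "u \<in> A" for u
    using f g that A' unfolding iso_between_def by (blast intro: R)
  ultimately show ?thesis
    using f g A' unfolding iso_between_def by (auto intro: bij_betw_trans)
qed

lemma full_iso_sym:
  "full_iso N os N' os' f \<Longrightarrow> set os \<subseteq> verts N \<Longrightarrow> full_iso N' os' N os (inv_into (verts N) f)"
  by (rule iso_between_sym) auto

lemma full_iso_trans:
  "full_iso N os N' os' f \<Longrightarrow> full_iso N' os' N'' os'' g \<Longrightarrow> full_iso N os N'' os'' (g \<circ> f)"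
  by (rule iso_between_trans) auto

lemma local_iso_sym:
  "local_iso r n N os N' os' f \<Longrightarrow> set os \<subseteq> verts N \<Longrightarrow> local_iso r n N' os' N os (inv_into (nball N os r) f)"
  by (rule iso_between_sym) (auto intro: mark_agree_sym subsetD[OF roots_in_nball])

lemma local_iso_trans:
  "local_iso r n N os N' os' f \<Longrightarrow> local_iso r n N' os' N'' os'' g \<Longrightarrow> local_iso r n N os N'' os'' (g \<circ> f)"
  by (rule iso_between_trans) (auto intro: mark_agree_trans)

text \<open>
  The induced map on edges, which supplies the edge component of a graph isomorphism.
\<close>

lemma bij_betw_image_edges:
  assumes sg: "simple_graph V E" "simple_graph V' E'" and f: "bij_betw f A A'"
    and A: "A \<subseteq> V" "A' \<subseteq> V'"
    and edge: "\<And>u v. u \<in> A \<Longrightarrow> v \<in> A \<Longrightarrow> {u, v} \<in> E \<longleftrightarrow> {f u, f v} \<in> E'"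
  shows "bij_betw ((`) f) {e\<in>E. e \<subseteq> A} {e\<in>E'. e \<subseteq> A'}"
proof (rule bij_betw_imageI)
  show "inj_on ((`) f) {e\<in>E. e \<subseteq> A}"
    using f by (auto simp: inj_on_def bij_betw_def inj_on_image_eq_iff)
  have im: "f ` A = A'" using f by (simp add: bij_betw_def)
  show "(`) f ` {e\<in>E. e \<subseteq> A} = {e\<in>E'. e \<subseteq> A'}"
  proof safe
    fix e x assume e: "e \<in> E" "e \<subseteq> A"
    obtain u v where uv: "e = {u, v}" using simple_graph_edgeE[OF sg(1) e(1)] by metis
    then show "f ` e \<in> E'" using e edge by auto
    show "x \<in> e \<Longrightarrow> f x \<in> A'" using e im by auto
  next
    fix e assume e: "e \<in> E'" "e \<subseteq> A'"
    obtain u' v' where uv': "e = {u', v'}" using simple_graph_edgeE[OF sg(2) e(1)] by metis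
    then obtain u v where uv: "u \<in> A" "v \<in> A" "u' = f u" "v' = f v"
      using e(2) im by auto
    then have "{u, v} \<in> {e\<in>E. e \<subseteq> A}" "e = f ` {u, v}"
      using e edge uv' by auto
    then show "e \<in> (`) f ` {e\<in>E. e \<subseteq> A}" by blast
  qed
qed

lemma rooted_iso_iff:
  assumes sg: "simple_graph (verts N) (edges N)" "simple_graph (verts N') (edges N')"
  shows "rooted_iso N os N' os' \<longleftrightarrow> (\<exists>f. full_iso N os N' os' f)"
proof
  assume "rooted_iso N os N' os'"
  then obtain f g where fg: "rooted_graph_iso N os N' os' f g"
    "\<forall>v\<in>verts N. vmark N v = vmark N' (f v)"
    "\<forall>e\<in>edges N. \<forall>v\<in>e. emark N v e = emark N' (f v) (g e)"
    unfolding rooted_iso_def by blast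
  then have "full_iso N os N' os' f"
    unfolding iso_between_def rooted_graph_iso_def by (metis insertI1)
  then show "\<exists>f. full_iso N os N' os' f" by blast
next
  assume "\<exists>f. full_iso N os N' os' f"
  then obtain f where f: "full_iso N os N' os' f" by blast
  have sub: "{e\<in>edges N. e \<subseteq> verts N} = edges N" "{e\<in>edges N'. e \<subseteq> verts N'} = edges N'"
    using sg by (auto simp: simple_graph_def)
  have "bij_betw ((`) f) (edges N) (edges N')"
    using bij_betw_image_edges[OF sg, of f "verts N" "verts N'"] f
    unfolding iso_between_def sub by auto
  then have 1: "rooted_graph_iso N os N' os' f ((`) f)"
    using f unfolding rooted_graph_iso_def iso_between_def by auto
  have 2: "emark N v e = emark N' (f v) (f ` e)" if ev: "e \<in> edges N" "v \<in> e" for e v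
  proof -
    obtain u w where e: "e = {u, w}" "u \<in> verts N" "w \<in> verts N"
      using simple_graph_edgeE[OF sg(1) ev(1)] by metis
    define x where "x = (if v = u then w else u)"
    have "e = {v, x}" "v \<in> verts N" "x \<in> verts N" using e ev(2) by (auto simp: x_def)
    then show ?thesis using f ev(1) unfolding iso_between_def by simp
  qed
  show "rooted_iso N os N' os'"
    unfolding rooted_iso_def
    by (rule exI[of _ f], rule exI[of _ "(`) f"]) (use f 1 2 in \<open>auto simp: iso_between_def\<close>)
qed

lemma full_iso_imp_local_iso:
  assumes sg: "simple_graph (verts N) (edges N)" "simple_graph (verts N') (edges N')"
    and f: "full_iso N os N' os' f" and os: "set os \<subseteq> verts N"
  shows "local_iso r n N os N' os' f"
proof -
  have "bij_betw f (nball N os r) (nball N' (map f os) r)"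
    by (rule nball_image[OF sg, of f "verts N" "verts N'"])
      (use f os subsetD[OF nball_subset_verts] in \<open>auto simp: iso_between_def\<close>)
  then show ?thesis
    using f nball_subset_verts[of N os r] unfolding iso_between_def by (auto simp: subset_iff)
qed

text \<open>
  Roots may be moved by distance \<open>j\<close> at the expense of \<open>j\<close> in the radius. This one statement covers
  smaller balls, fewer roots, and additional roots.
\<close>

lemma local_iso_restrict:
  assumes sg: "simple_graph (verts N) (edges N)" "simple_graph (verts N') (edges N')"
    and f: "local_iso R n N os N' os' f" and os: "set os \<subseteq> verts N"
    and ps: "set ps \<subseteq> nball N os j" and le: "j + r \<le> R" "m \<le> n"
  shows "local_iso r m N ps N' (map f ps) f"
proof -
  have b: "bij_betw f (nball N os R) (nball N' os' R)" and os': "os' = map f os"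
    and edge: "\<And>u v. u \<in> nball N os R \<Longrightarrow> v \<in> nball N os R \<Longrightarrow> {u, v} \<in> edges N \<longleftrightarrow> {f u, f v} \<in> edges N'"
    using f by (auto simp: iso_between_def)
  have sub: "nball N ps r \<subseteq> nball N os R"
    using nball_compose[OF ps, of r] nball_mono[OF le(1)] by (rule subset_trans)
  have "f ` nball N os j \<subseteq> nball N' (map f os) j"
    by (rule nball_image_subset[OF sg(1), of _ "nball N os R"])
      (use edge b le subsetD[OF nball_mono[of j R]] subsetD[OF nball_subset_verts] in \<open>auto simp: bij_betw_def\<close>)
  then have "set (map f ps) \<subseteq> nball N' os' j"
    using ps unfolding os' by auto
  then have sub': "nball N' (map f ps) r \<subseteq> nball N' os' R"
    using nball_compose[of "map f ps" N' os' j r] nball_mono[OF le(1), of N' os'] by auto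
  have "bij_betw f (nball N ps r) (nball N' (map f ps) r)"
    by (rule nball_image[OF sg b nball_subset_verts nball_subset_verts edge sub sub'])
      (use subset_trans[OF ps nball_mono[of j R]] le in \<open>auto\<close>)
  moreover have "mark_agree m (emark N u {u, v}) (emark N' (f u) {f u, f v})"
    if "u \<in> nball N ps r" "v \<in> nball N ps r" "{u, v} \<in> edges N" for u v
    using f sub le(2) that unfolding iso_between_def by (blast intro: mark_agree_mono)
  ultimately show ?thesis
    using f sub le(2) unfolding iso_between_def by (auto simp: subset_iff intro: mark_agree_mono)
qed

lemma local_iso_imp_upto:
  assumes sg: "simple_graph (verts N) (edges N)" "simple_graph (verts N') (edges N')"
    and f: "local_iso r n N os N' os' f"
  shows "rooted_iso_upto mark_metric (1 / real (Suc n)) (graph_ball N os r) os (graph_ball N' os' r) os'"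
proof -
  have edge: "\<And>u v. u \<in> nball N os r \<Longrightarrow> v \<in> nball N os r \<Longrightarrow> {u, v} \<in> edges N \<longleftrightarrow> {f u, f v} \<in> edges N'"
    and b: "bij_betw f (nball N os r) (nball N' os' r)"
    using f by (auto simp: iso_between_def)
  have bE: "bij_betw ((`) f) {e\<in>edges N. e \<subseteq> nball N os r} {e\<in>edges N'. e \<subseteq> nball N' os' r}"
    by (rule bij_betw_image_edges[OF sg b nball_subset_verts nball_subset_verts edge])
  have im: "f u \<in> nball N' os' r" if "u \<in> nball N os r" for u
    using b that by (auto dest: bij_betwE)
  have 1: "rooted_graph_iso (graph_ball N os r) os (graph_ball N' os' r) os' f ((`) f)"
    using f bE b im unfolding rooted_graph_iso_def iso_between_def by auto
  have 2: "mark_agree n (emark N v e) (emark N' (f v) (f ` e))"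
    if ev: "e \<in> edges N" "e \<subseteq> nball N os r" "v \<in> e" for e v
  proof -
    obtain u w where e: "e = {u, w}"
      using simple_graph_edgeE[OF sg(1) ev(1)] by metis
    define x where "x = (if v = u then w else u)"
    have "e = {v, x}" using e ev(3) by (auto simp: x_def)
    then show ?thesis using f ev unfolding iso_between_def by simp
  qed
  show ?thesis
    unfolding rooted_iso_upto_def
    by (rule exI[of _ f], rule exI[of _ "(`) f"])
      (use f 1 2 mark_dist_le_iff in \<open>auto simp del: of_nat_Suc simp: iso_between_def\<close>)
qed

lemma upto_imp_local_iso:
  assumes sg: "simple_graph (verts N) (edges N)" "simple_graph (verts N') (edges N')"
    and up: "rooted_iso_upto mark_metric \<epsilon> (graph_ball N os r) os (graph_ball N' os' r) os'"
    and \<epsilon>: "\<epsilon> \<le> 1 / real (Suc n)"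
  shows "\<exists>f. local_iso r n N os N' os' f"
proof -
  obtain f g where fg: "rooted_graph_iso (graph_ball N os r) os (graph_ball N' os' r) os' f g"
    "\<And>v. v \<in> nball N os r \<Longrightarrow> mark_dist (vmark N v) (vmark N' (f v)) \<le> \<epsilon>"
    "\<And>e v. e \<in> edges N \<Longrightarrow> e \<subseteq> nball N os r \<Longrightarrow> v \<in> e \<Longrightarrow> mark_dist (emark N v e) (emark N' (f v) (g e)) \<le> \<epsilon>"
    using up unfolding rooted_iso_upto_def by auto
  have b: "bij_betw f (nball N os r) (nball N' os' r)"
    using fg(1) by (simp add: rooted_graph_iso_def)
  have im: "f u \<in> nball N' os' r" if "u \<in> nball N os r" for u
    using b that by (auto dest: bij_betwE)
  have agree: "mark_agree n a b" if "mark_dist a b \<le> \<epsilon>" for a b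
    using order_trans[OF that \<epsilon>] by (simp only: mark_dist_le_iff)
  have "local_iso r n N os N' os' f"
    unfolding iso_between_def
  proof (intro conjI ballI impI b)
    show "map f os = os'" using fg(1) by (simp add: rooted_graph_iso_def)
    fix v assume v: "v \<in> nball N os r"
    show "mark_agree n (vmark N v) (vmark N' (f v))" using fg(2) v agree by blast
    fix u assume u: "u \<in> nball N os r"
    show "{v, u} \<in> edges N \<longleftrightarrow> {f v, f u} \<in> edges N'"
      using fg(1) u v im by (simp add: rooted_graph_iso_def)
    assume e: "{v, u} \<in> edges N"
    then have "g {v, u} = {f v, f u}"
      using fg(1) u v by (simp add: rooted_graph_iso_def)
    then show "mark_agree n (emark N v {v, u}) (emark N' (f v) {f v, f u})"
      using fg(3)[OF e, of v] u v agree by auto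
  qed
  then show ?thesis by blast
qed

section \<open>The space of rooted networks and the space of their classes\<close>

lemma local_iso_precision_mono:
  "local_iso r n N os N' os' f \<Longrightarrow> m \<le> n \<Longrightarrow> local_iso r m N os N' os' f"
  unfolding iso_between_def by (blast intro: mark_agree_mono)

definition rooted_nets :: "nat \<Rightarrow> ((nat, real) network \<times> nat list) set" where
  "rooted_nets l = {p. is_network mark_metric (fst p) \<and> set (snd p) \<subseteq> verts (fst p) \<and> length (snd p) = l}"

lemma rooted_netsD:
  assumes "p \<in> rooted_nets l"
  shows "simple_graph (verts (fst p)) (edges (fst p))" "connected_graph (verts (fst p)) (edges (fst p))"
    "locally_finite_graph (verts (fst p)) (edges (fst p))" "set (snd p) \<subseteq> verts (fst p)" "length (snd p) = l"
    "is_network mark_metric (fst p)"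
  using assms by (auto simp: rooted_nets_def is_network_def)

text \<open>
  Radius and precision are tied together, so that this is a decreasing sequence of equivalence
  relations.
\<close>

definition locally_iso :: "nat \<Rightarrow> (nat, real) network \<times> nat list \<Rightarrow> (nat, real) network \<times> nat list \<Rightarrow> bool" where
  "locally_iso n p q \<longleftrightarrow> (\<exists>f. local_iso n n (fst p) (snd p) (fst q) (snd q) f)"

lemma locally_iso_refl: "locally_iso n p p"
  unfolding locally_iso_def using iso_between_refl[where R="mark_agree n"] by fastforce

lemma locally_iso_sym: "p \<in> rooted_nets l \<Longrightarrow> locally_iso n p q \<Longrightarrow> locally_iso n q p"
  unfolding locally_iso_def using local_iso_sym rooted_netsD(4) by blast

lemma locally_iso_trans: "locally_iso n p q \<Longrightarrow> locally_iso n q r \<Longrightarrow> locally_iso n p r"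
  unfolding locally_iso_def using local_iso_trans by blast

lemma locally_iso_mono:
  assumes "p \<in> rooted_nets l" "q \<in> rooted_nets l" "locally_iso n p q" "m \<le> n"
  shows "locally_iso m p q"
proof -
  obtain f where f: "local_iso n n (fst p) (snd p) (fst q) (snd q) f"
    using assms(3) unfolding locally_iso_def by blast
  have "local_iso m m (fst p) (snd p) (fst q) (map f (snd p)) f"
    by (rule local_iso_restrict[OF rooted_netsD(1)[OF assms(1)] rooted_netsD(1)[OF assms(2)] f
          rooted_netsD(4)[OF assms(1)] roots_in_nball[OF rooted_netsD(4)[OF assms(1)], of 0]])
      (use assms in auto)
  moreover have "map f (snd p) = snd q" using f by (simp add: iso_between_def)
  ultimately show ?thesis unfolding locally_iso_def by auto
qed

abbreviation rooted_isomorphic :: "(nat, real) network \<times> nat list \<Rightarrow> (nat, real) network \<times> nat list \<Rightarrow> bool" where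
  "rooted_isomorphic p q \<equiv> rooted_iso (fst p) (snd p) (fst q) (snd q)"

lemma rooted_isomorphic_iff:
  "p \<in> rooted_nets l \<Longrightarrow> q \<in> rooted_nets l \<Longrightarrow>
    rooted_isomorphic p q \<longleftrightarrow> (\<exists>f. full_iso (fst p) (snd p) (fst q) (snd q) f)"
  by (intro rooted_iso_iff rooted_netsD(1))

lemma rooted_isomorphic_imp_locally_iso:
  assumes "p \<in> rooted_nets l" "q \<in> rooted_nets l" "rooted_isomorphic p q"
  shows "locally_iso n p q"
proof -
  obtain f where "full_iso (fst p) (snd p) (fst q) (snd q) f"
    using rooted_iso_iff[OF rooted_netsD(1)[OF assms(1)] rooted_netsD(1)[OF assms(2)]] assms(3) by blast
  then show ?thesis
    unfolding locally_iso_def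
    using full_iso_imp_local_iso[OF rooted_netsD(1)[OF assms(1)] rooted_netsD(1)[OF assms(2)]]
      rooted_netsD(4)[OF assms(1)] by blast
qed

text \<open>
  The properties that can be decided from the ball of radius \<open>n\<close> and \<open>n\<close> bits of its marks.
\<close>

definition local_set :: "nat \<Rightarrow> nat \<Rightarrow> ((nat, real) network \<times> nat list) set \<Rightarrow> bool" where
  "local_set l n S \<longleftrightarrow> S \<subseteq> rooted_nets l \<and> (\<forall>p\<in>S. \<forall>q\<in>rooted_nets l. locally_iso n p q \<longrightarrow> q \<in> S)"

text \<open>
  A \<open>\<sigma>\<close>-algebra on concrete networks with vertices in \<^typ>\<open>nat\<close>. All its sets are invariant under
  isomorphism (\<open>rooted_space_sets_invariant\<close>), so it is the \<open>\<sigma>\<close>-algebra of the space of classes,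
  pulled back; but measurable functions can be written down without choosing representatives.
\<close>

definition rooted_space :: "nat \<Rightarrow> ((nat, real) network \<times> nat list) measure" where
  "rooted_space l = sigma (rooted_nets l) {S. \<exists>n. local_set l n S}"

lemma local_sets_subset: "{S. \<exists>n. local_set l n S} \<subseteq> Pow (rooted_nets l)"
  by (auto simp: local_set_def)

lemma space_rooted_space [simp]: "space (rooted_space l) = rooted_nets l"
  unfolding rooted_space_def by (rule space_measure_of[OF local_sets_subset])

lemma sets_rooted_space: "sets (rooted_space l) = sigma_sets (rooted_nets l) {S. \<exists>n. local_set l n S}"
  unfolding rooted_space_def by (rule sets_measure_of[OF local_sets_subset])

lemma local_set_measurable: "local_set l n S \<Longrightarrow> S \<in> sets (rooted_space l)"
  unfolding sets_rooted_space by (auto intro: sigma_sets.Basic)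

lemma local_pred_measurable:
  assumes "\<And>p q. p \<in> rooted_nets l \<Longrightarrow> q \<in> rooted_nets l \<Longrightarrow> locally_iso n p q \<Longrightarrow> \<phi> p \<Longrightarrow> \<phi> q"
  shows "Measurable.pred (rooted_space l) \<phi>"
proof -
  have "local_set l n {p\<in>rooted_nets l. \<phi> p}"
    using assms unfolding local_set_def by blast
  from local_set_measurable[OF this] show ?thesis unfolding pred_def by simp
qed

lemma Int_stable_local_sets: "Int_stable {S. \<exists>n. local_set l n S}"
proof (rule Int_stableI)
  fix S T assume "S \<in> {S. \<exists>n. local_set l n S}" "T \<in> {S. \<exists>n. local_set l n S}"
  then obtain m n where mn: "local_set l m S" "local_set l n T" by blast
  have "local_set l (max m n) (S \<inter> T)"
    unfolding local_set_def
  proof (intro conjI ballI impI)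
    fix p q assume p: "p \<in> S \<inter> T" "q \<in> rooted_nets l" "locally_iso (max m n) p q"
    then have "p \<in> rooted_nets l" using mn by (auto simp: local_set_def)
    then have "locally_iso m p q" "locally_iso n p q"
      using locally_iso_mono[OF _ p(2,3)] by simp_all
    then show "q \<in> S \<inter> T" using mn p unfolding local_set_def by blast
  qed (use mn in \<open>auto simp: local_set_def\<close>)
  then show "S \<inter> T \<in> {S. \<exists>n. local_set l n S}" by blast
qed

text \<open>
  Generating sets are invariant, and invariance survives complements and unions.
\<close>

lemma rooted_space_sets_invariant:
  assumes "A \<in> sets (rooted_space l)" "p \<in> rooted_nets l" "q \<in> rooted_nets l" "rooted_isomorphic p q"
  shows "p \<in> A \<longleftrightarrow> q \<in> A"
  using assms(1) unfolding sets_rooted_space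
proof (induction A rule: sigma_sets.induct)
  case (Basic S)
  then obtain n where n: "local_set l n S" by blast
  have "locally_iso n p q" by (rule rooted_isomorphic_imp_locally_iso[OF assms(2-4)])
  moreover from this have "locally_iso n q p" by (rule locally_iso_sym[OF assms(2)])
  ultimately show ?case using n assms(2,3) unfolding local_set_def by blast
next
  case (Compl A)
  then show ?case using assms(2,3) by blast
qed auto

lemma measurable_rooted_space_invariant:
  fixes F :: "_ \<Rightarrow> 'b::t1_space"
  assumes F: "F \<in> borel_measurable (rooted_space l)" and "p \<in> rooted_nets l" "q \<in> rooted_nets l" "rooted_isomorphic p q"
  shows "F p = F q"
proof -
  have "F -` {F p} \<inter> rooted_nets l \<in> sets (rooted_space l)"
    using measurable_sets[OF F, of "{F p}"] by simp
  from rooted_space_sets_invariant[OF this assms(2-4)] show ?thesis using assms(2,3) by auto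
qed

abbreviation cls :: "(nat, real) network \<times> nat list \<Rightarrow> real net_class" where
  "cls p \<equiv> net_class mark_metric (fst p) (snd p)"

definition rep :: "real net_class \<Rightarrow> (nat, real) network \<times> nat list" where
  "rep c = (SOME p. p \<in> c)"

lemma net_classes_eq: "net_classes mark_metric l = cls ` rooted_nets l"
proof (intro set_eqI iffI)
  fix c assume "c \<in> net_classes mark_metric l"
  then obtain N os where "c = net_class mark_metric N os" "(N, os) \<in> rooted_nets l"
    unfolding net_classes_def rooted_nets_def by auto
  then show "c \<in> cls ` rooted_nets l" by (intro image_eqI[of _ _ "(N, os)"]) simp_all
next
  fix c assume "c \<in> cls ` rooted_nets l"
  then show "c \<in> net_classes mark_metric l"
    unfolding net_classes_def rooted_nets_def by blast
qed

lemma space_net_space [simp]: "space (net_space mark_metric l) = net_classes mark_metric l"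
  unfolding net_space_def by (rule space_measure_of) auto

lemma rooted_iso_sym:
  assumes "p \<in> rooted_nets l" "q \<in> rooted_nets l" "rooted_isomorphic p q"
  shows "rooted_isomorphic q p"
  using assms(3) full_iso_sym[OF _ rooted_netsD(4)[OF assms(1)]]
  unfolding rooted_isomorphic_iff[OF assms(1,2)] rooted_isomorphic_iff[OF assms(2,1)] by blast

lemma rooted_iso_trans:
  assumes "p \<in> rooted_nets l" "q \<in> rooted_nets l" "r \<in> rooted_nets l" "rooted_isomorphic p q" "rooted_isomorphic q r"
  shows "rooted_isomorphic p r"
  using assms(4,5) full_iso_trans
  unfolding rooted_isomorphic_iff[OF assms(1,2)] rooted_isomorphic_iff[OF assms(2,3)]
    rooted_isomorphic_iff[OF assms(1,3)] by blast

lemma in_cls_iff: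
  "q \<in> cls p \<longleftrightarrow> is_network mark_metric (fst q) \<and> set (snd q) \<subseteq> verts (fst q) \<and> rooted_isomorphic p q"
  by (auto simp: net_class_def case_prod_beta)

lemma cls_member:
  assumes "p \<in> rooted_nets l" "q \<in> cls p"
  shows "q \<in> rooted_nets l" "rooted_isomorphic p q"
proof -
  have q: "is_network mark_metric (fst q)" "set (snd q) \<subseteq> verts (fst q)" "rooted_isomorphic p q"
    using assms(2) unfolding in_cls_iff by auto
  then show "rooted_isomorphic p q" by blast
  then have "length (snd q) = length (snd p)"
    unfolding rooted_iso_def rooted_graph_iso_def by (metis length_map)
  then show "q \<in> rooted_nets l" using q assms(1) by (simp add: rooted_nets_def)
qed

lemma cls_self:
  assumes "p \<in> rooted_nets l"
  shows "p \<in> cls p"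
proof -
  have "rooted_isomorphic p p"
    unfolding rooted_iso_iff[OF rooted_netsD(1)[OF assms] rooted_netsD(1)[OF assms]]
    using iso_between_refl[where R="(=)", OF refl] by fastforce
  then show ?thesis
    using rooted_netsD[OF assms] unfolding in_cls_iff by simp
qed

lemma cls_eqI:
  assumes "p \<in> rooted_nets l" "q \<in> rooted_nets l" "rooted_isomorphic p q"
  shows "cls p = cls q"
proof -
  have "r \<in> cls p \<longleftrightarrow> r \<in> cls q" for r
  proof
    assume r: "r \<in> cls p"
    note r' = cls_member[OF assms(1) r]
    have "rooted_isomorphic q r"
      by (rule rooted_iso_trans[OF assms(2,1) r'(1) rooted_iso_sym[OF assms] r'(2)])
    then show "r \<in> cls q"
      using rooted_netsD[OF r'(1)] unfolding in_cls_iff by simp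
  next
    assume r: "r \<in> cls q"
    note r' = cls_member[OF assms(2) r]
    have "rooted_isomorphic p r"
      by (rule rooted_iso_trans[OF assms(1,2) r'(1) assms(3) r'(2)])
    then show "r \<in> cls p"
      using rooted_netsD[OF r'(1)] unfolding in_cls_iff by simp
  qed
  then show ?thesis by blast
qed

lemma rep_cls:
  assumes "p \<in> rooted_nets l"
  shows "rep (cls p) \<in> rooted_nets l" "rooted_isomorphic p (rep (cls p))"
proof -
  have "rep (cls p) \<in> cls p"
    unfolding rep_def using cls_self[OF assms] by (rule someI)
  from cls_member[OF assms this] show "rep (cls p) \<in> rooted_nets l" "rooted_isomorphic p (rep (cls p))" .
qed

lemma rep_in_rooted_nets: "c \<in> net_classes mark_metric l \<Longrightarrow> rep c \<in> rooted_nets l"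
  unfolding net_classes_eq using rep_cls(1) by blast

lemma cls_rep: "c \<in> net_classes mark_metric l \<Longrightarrow> cls (rep c) = c"
proof -
  assume "c \<in> net_classes mark_metric l"
  then obtain p where p: "p \<in> rooted_nets l" "c = cls p" unfolding net_classes_eq by blast
  show ?thesis unfolding p(2) by (rule cls_eqI[OF p(1) rep_cls[OF p(1)], symmetric])
qed

text \<open>
  The radii whose supremum determines the distance of two classes.
\<close>

definition agree_radii :: "real net_class \<Rightarrow> real net_class \<Rightarrow> real set" where
  "agree_radii c c' = {r. r > 0 \<and> (\<exists>p\<in>c. \<exists>q\<in>c'.
     rooted_iso_upto mark_metric (1 / r) (graph_ball (fst p) (snd p) (nat \<lceil>r\<rceil>)) (snd p)
       (graph_ball (fst q) (snd q) (nat \<lceil>r\<rceil>)) (snd q))}"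

lemma net_dist_eq:
  "net_dist mark_metric c c' =
     (if (SUP r\<in>agree_radii c c'. ennreal r) = \<top> then 0
      else 2 powr - enn2real (SUP r\<in>agree_radii c c'. ennreal r))"
  by (simp add: net_dist_def agree_radii_def case_prod_beta Let_def)

text \<open>
  Together with \<open>locally_iso_of_net_dist\<close> this says that balls for the distance and local
  equivalence classes generate the same open sets. The radius \<open>r = n + 1\<close> qualifies, since agreement in
  \<open>n\<close> bits means distance at most \<open>1 / (n + 1)\<close>.
\<close>

lemma net_dist_le:
  assumes p: "p \<in> rooted_nets l" and q: "q \<in> rooted_nets l" and iso: "locally_iso (Suc n) p q"
  shows "net_dist mark_metric (cls p) (cls q) \<le> 2 powr - real (Suc n)"
proof -
  let ?R = "agree_radii (cls p) (cls q)"
  obtain f where "local_iso (Suc n) (Suc n) (fst p) (snd p) (fst q) (snd q) f"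
    using iso unfolding locally_iso_def by blast
  then have "local_iso (Suc n) n (fst p) (snd p) (fst q) (snd q) f"
    by (rule local_iso_precision_mono) simp
  from local_iso_imp_upto[OF rooted_netsD(1)[OF p] rooted_netsD(1)[OF q] this]
  have "rooted_iso_upto mark_metric (1 / real (Suc n))
     (graph_ball (fst p) (snd p) (nat \<lceil>real (Suc n)\<rceil>)) (snd p)
     (graph_ball (fst q) (snd q) (nat \<lceil>real (Suc n)\<rceil>)) (snd q)"
    by (simp only: ceiling_of_nat nat_int)
  then have "real (Suc n) \<in> ?R"
    using cls_self[OF p] cls_self[OF q] of_nat_0_less_iff[of "Suc n", THEN iffD2, OF zero_less_Suc]
    unfolding agree_radii_def by blast
  then have le: "ennreal (real (Suc n)) \<le> (SUP r\<in>?R. ennreal r)" (is "_ \<le> ?a")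
    by (rule SUP_upper)
  show ?thesis
  proof (cases "?a = \<top>")
    case True
    then show ?thesis unfolding net_dist_eq by simp
  next
    case False
    then have "real (Suc n) \<le> enn2real ?a"
      using le by (metis enn2real_ennreal enn2real_mono less_top of_nat_0_le_iff)
    then show ?thesis unfolding net_dist_eq using False by simp
  qed
qed

text \<open>
  Some radius \<open>r > n + 1\<close> qualifies, for some representatives of the two classes; local isomorphism does
  not depend on the representatives.
\<close>

lemma locally_iso_of_net_dist:
  assumes p: "p \<in> rooted_nets l" and q: "q \<in> rooted_nets l"
    and d: "net_dist mark_metric (cls p) (cls q) < 2 powr - real (Suc n)"
  shows "locally_iso n p q"
proof -
  let ?R = "agree_radii (cls p) (cls q)"
  let ?a = "SUP r\<in>?R. ennreal r"
  have "ennreal (real (Suc n)) < ?a"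
  proof (cases "?a = \<top>")
    case True
    show ?thesis unfolding True by (rule ennreal_less_top)
  next
    case False
    then have "2 powr - enn2real ?a < 2 powr - real (Suc n)"
      using d unfolding net_dist_eq by (simp only: if_False)
    then have "real (Suc n) < enn2real ?a"
      by (simp del: of_nat_Suc)
    then show ?thesis
      using False by (metis ennreal_enn2real ennreal_lessI less_le_trans less_top of_nat_0_le_iff le_less_trans)
  qed
  then obtain r where r: "r \<in> ?R" "ennreal (real (Suc n)) < ennreal r"
    unfolding less_SUP_iff by blast
  then have rn: "real (Suc n) < r"
    by (simp add: ennreal_less_iff del: of_nat_Suc)
  obtain p' q' where pq: "p' \<in> cls p" "q' \<in> cls q"
    "rooted_iso_upto mark_metric (1 / r) (graph_ball (fst p') (snd p') (nat \<lceil>r\<rceil>)) (snd p')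
       (graph_ball (fst q') (snd q') (nat \<lceil>r\<rceil>)) (snd q')"
    using r(1) unfolding agree_radii_def by blast
  note p' = cls_member[OF p pq(1)] and q' = cls_member[OF q pq(2)]
  have "1 / r \<le> 1 / real (Suc n)"
    using rn by (intro divide_left_mono) auto
  from upto_imp_local_iso[OF rooted_netsD(1)[OF p'(1)] rooted_netsD(1)[OF q'(1)] pq(3) this]
  obtain f where f: "local_iso (nat \<lceil>r\<rceil>) n (fst p') (snd p') (fst q') (snd q') f" by blast
  have "n \<le> nat \<lceil>r\<rceil>" using rn by linarith
  then have "local_iso n n (fst p') (snd p') (fst q') (map f (snd p')) f"
    by (intro local_iso_restrict[OF rooted_netsD(1)[OF p'(1)] rooted_netsD(1)[OF q'(1)] f
          rooted_netsD(4)[OF p'(1)] roots_in_nball[OF rooted_netsD(4)[OF p'(1)], of 0]]) auto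
  moreover have "map f (snd p') = snd q'" using f by (simp add: iso_between_def)
  ultimately have "locally_iso n p' q'" unfolding locally_iso_def by auto
  moreover have "locally_iso n p p'"
    by (rule rooted_isomorphic_imp_locally_iso[OF p p'])
  moreover have "locally_iso n q' q"
    by (rule rooted_isomorphic_imp_locally_iso[OF q'(1) q rooted_iso_sym[OF q q']])
  ultimately show ?thesis using locally_iso_trans by blast
qed

lemma cls_measurable: "cls \<in> measurable (rooted_space l) (net_space mark_metric l)"
  unfolding net_space_def
proof (rule measurable_measure_of)
  show "cls \<in> space (rooted_space l) \<rightarrow> net_classes mark_metric l"
    by (auto simp: net_classes_eq)
  fix U assume "U \<in> {U. U \<subseteq> net_classes mark_metric l \<and>
           (\<forall>c\<in>U. \<exists>\<epsilon>>0. \<forall>c'\<in>net_classes mark_metric l. net_dist mark_metric c c' < \<epsilon> \<longrightarrow> c' \<in> U)}"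
  then have U: "\<And>c. c \<in> U \<Longrightarrow> \<exists>\<epsilon>>0. \<forall>c'\<in>net_classes mark_metric l. net_dist mark_metric c c' < \<epsilon> \<longrightarrow> c' \<in> U"
    by blast
  (* The points around which U contains a whole local class form a local set, by transitivity. *)
  define V where "V n = {p\<in>rooted_nets l. \<forall>q\<in>rooted_nets l. locally_iso n p q \<longrightarrow> cls q \<in> U}" for n
  have "cls -` U \<inter> space (rooted_space l) = (\<Union>n. V n)"
  proof (intro set_eqI iffI)
    fix p assume p: "p \<in> cls -` U \<inter> space (rooted_space l)"
    then obtain \<epsilon> where e: "\<epsilon> > 0" "\<And>c'. c' \<in> net_classes mark_metric l \<Longrightarrow> net_dist mark_metric (cls p) c' < \<epsilon> \<Longrightarrow> c' \<in> U"
      using U[of "cls p"] by auto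
    obtain n where n: "(1/2) ^ n < \<epsilon>"
      using real_arch_pow_inv[OF e(1), of "1/2"] by auto
    have "(2::real) powr - real (Suc n) = (1/2) ^ Suc n"
      by (simp add: powr_minus powr_realpow power_one_over inverse_eq_divide del: of_nat_Suc)
    also have "\<dots> \<le> (1/2) ^ n" by simp
    finally have n2: "2 powr - real (Suc n) < \<epsilon>" using n by linarith
    have "p \<in> V (Suc n)"
      unfolding V_def
    proof (intro CollectI conjI ballI impI)
      fix q assume "q \<in> rooted_nets l" "locally_iso (Suc n) p q"
      then show "cls q \<in> U"
        using net_dist_le[of p l q n] p n2 by (intro e(2)) (auto simp: net_classes_eq)
    qed (use p in simp)
    then show "p \<in> (\<Union>n. V n)" by blast
  next
    fix p assume "p \<in> (\<Union>n. V n)"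
    then show "p \<in> cls -` U \<inter> space (rooted_space l)"
      unfolding V_def space_rooted_space using locally_iso_refl by blast
  qed
  moreover have "local_set l n (V n)" for n
    unfolding local_set_def V_def using locally_iso_trans by blast
  ultimately show "cls -` U \<inter> space (rooted_space l) \<in> sets (rooted_space l)"
    using local_set_measurable by auto
qed auto

text \<open>
  The classes with representative in a local set form an open set, because the representatives of
  close classes are locally isomorphic.
\<close>

lemma rep_measurable: "rep \<in> measurable (net_space mark_metric l) (rooted_space l)"
  unfolding rooted_space_def
proof (rule measurable_measure_of)
  show "{S. \<exists>n. local_set l n S} \<subseteq> Pow (rooted_nets l)" by (rule local_sets_subset)
  show "rep \<in> space (net_space mark_metric l) \<rightarrow> rooted_nets l"
    using rep_in_rooted_nets by auto
  fix S assume "S \<in> {S. \<exists>n. local_set l n S}"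
  then obtain n where n: "local_set l n S" by blast
  have "\<forall>c\<in>rep -` S \<inter> net_classes mark_metric l. \<exists>\<epsilon>>0. \<forall>c'\<in>net_classes mark_metric l.
      net_dist mark_metric c c' < \<epsilon> \<longrightarrow> c' \<in> rep -` S \<inter> net_classes mark_metric l"
  proof
    fix c assume c: "c \<in> rep -` S \<inter> net_classes mark_metric l"
    have "c' \<in> rep -` S" if c': "c' \<in> net_classes mark_metric l"
      and d: "net_dist mark_metric c c' < 2 powr - real (Suc n)" for c'
    proof -
      have "locally_iso n (rep c) (rep c')"
        using c c' d by (intro locally_iso_of_net_dist[where l=l] rep_in_rooted_nets) (auto simp: cls_rep)
      then show ?thesis
        using n c rep_in_rooted_nets[OF c'] unfolding local_set_def by auto
    qed
    then show "\<exists>\<epsilon>>0. \<forall>c'\<in>net_classes mark_metric l.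
      net_dist mark_metric c c' < \<epsilon> \<longrightarrow> c' \<in> rep -` S \<inter> net_classes mark_metric l"
      by (intro exI[of _ "2 powr - real (Suc n)"]) auto
  qed
  then show "rep -` S \<inter> space (net_space mark_metric l) \<in> sets (net_space mark_metric l)"
    unfolding space_net_space unfolding net_space_def by (intro in_measure_of) auto
qed

lemma measurable_rep_cls_eq:
  fixes F :: "_ \<Rightarrow> 'b::t1_space"
  assumes "F \<in> borel_measurable (rooted_space l)" "p \<in> rooted_nets l"
  shows "F (rep (cls p)) = F p"
  using measurable_rooted_space_invariant[OF assms(1,2) rep_cls[OF assms(2)]] by simp

section \<open>Counting vertices and changing roots\<close>

lemma finite_neighbours:
  assumes "simple_graph V E" "locally_finite_graph V E" "u \<in> V"
  shows "finite {v. {u, v} \<in> E}"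
proof -
  have "finite {e\<in>E. u \<in> e}" using assms(2,3) by (simp add: locally_finite_graph_def)
  then have "finite ((\<lambda>v. {u, v}) -` {e\<in>E. u \<in> e})"
    by (rule finite_vimageI) (auto simp: inj_on_def doubleton_eq_iff)
  then show ?thesis by (rule rev_finite_subset) auto
qed

lemma finite_nball:
  assumes sg: "simple_graph (verts N) (edges N)" and lf: "locally_finite_graph (verts N) (edges N)"
  shows "finite (nball N os n)"
proof -
  have fin: "finite {v\<in>verts N. (u, v) \<in> adj (edges N) ^^ k}" for u k
  proof (induction k)
    case 0
    show ?case by (rule finite_subset[of _ "{u}"]) auto
  next
    case (Suc k)
    have "{v\<in>verts N. (u, v) \<in> adj (edges N) ^^ Suc k} \<subseteq>
        (\<Union>w\<in>{w\<in>verts N. (u, w) \<in> adj (edges N) ^^ k}. {v. {w, v} \<in> edges N})"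
    proof
      fix v assume "v \<in> {v\<in>verts N. (u, v) \<in> adj (edges N) ^^ Suc k}"
      then obtain w where "(u, w) \<in> adj (edges N) ^^ k" "{w, v} \<in> edges N"
        by (auto simp: adj_def)
      then show "v \<in> (\<Union>w\<in>{w\<in>verts N. (u, w) \<in> adj (edges N) ^^ k}. {v. {w, v} \<in> edges N})"
        using edge_verts[OF sg] by blast
    qed
    then show ?case
      by (rule finite_subset) (intro finite_UN_I Suc.IH, auto intro: finite_neighbours[OF sg lf])
  qed
  have "nball N os n = (\<Union>u\<in>set os. \<Union>k\<in>{..n}. {v\<in>verts N. (u, v) \<in> adj (edges N) ^^ k})"
    by (auto simp: nball_def)
  then show ?thesis using fin by simp
qed

lemma UN_nball:
  assumes "connected_graph (verts N) (edges N)" "set os \<subseteq> verts N" "os \<noteq> []"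
  shows "(\<Union>n. nball N os n) = verts N"
proof (intro subset_antisym subsetI)
  fix v assume v: "v \<in> verts N"
  have "hd os \<in> set os" using assms(3) by simp
  moreover from this have "(hd os, v) \<in> (adj (edges N))\<^sup>*"
    using assms v unfolding connected_graph_def by blast
  then obtain k where "(hd os, v) \<in> adj (edges N) ^^ k" by (auto simp: rtrancl_power)
  ultimately have "v \<in> nball N os k"
    using v unfolding nball_def by blast
  then show "v \<in> (\<Union>n. nball N os n)" by blast
qed (auto simp: nball_def)

lemma append_vertex_rooted:
  "p \<in> rooted_nets l \<Longrightarrow> v \<in> verts (fst p) \<Longrightarrow> (fst p, snd p @ [v]) \<in> rooted_nets (Suc l)"
  by (auto simp: rooted_nets_def)

definition ext_count :: "nat \<Rightarrow> ((nat, real) network \<times> nat list) set \<Rightarrow> (nat, real) network \<times> nat list \<Rightarrow> ennreal" where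
  "ext_count j A p = emeasure (count_space UNIV) {v\<in>nball (fst p) (snd p) j. (fst p, snd p @ [v]) \<in> A}"

text \<open>
  A local isomorphism maps the vertices counted on one side injectively to vertices counted on the
  other.
\<close>

lemma ext_count_le:
  assumes S: "local_set (Suc l) n S" and p: "p \<in> rooted_nets l" and q: "q \<in> rooted_nets l"
    and iso: "locally_iso (j + n) p q"
  shows "ext_count j S p \<le> ext_count j S q"
proof -
  obtain f where f: "local_iso (j + n) (j + n) (fst p) (snd p) (fst q) (snd q) f"
    using iso unfolding locally_iso_def by blast
  have fos: "map f (snd p) = snd q" using f by (simp add: iso_between_def)
  note sgp = rooted_netsD(1)[OF p] and sgq = rooted_netsD(1)[OF q]
  let ?P = "{v\<in>nball (fst p) (snd p) j. (fst p, snd p @ [v]) \<in> S}"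
  let ?Q = "{v\<in>nball (fst q) (snd q) j. (fst q, snd q @ [v]) \<in> S}"
  have fin: "finite ?P" "finite ?Q"
    using finite_nball[OF sgp rooted_netsD(3)[OF p]] finite_nball[OF sgq rooted_netsD(3)[OF q]] by auto
  have j0: "nball (fst p) (snd p) j \<subseteq> nball (fst p) (snd p) (j + n)" by (rule nball_mono) simp
  have "local_iso j 0 (fst p) (snd p) (fst q) (map f (snd p)) f"
    by (rule local_iso_restrict[OF sgp sgq f rooted_netsD(4)[OF p] roots_in_nball[OF rooted_netsD(4)[OF p], of 0]])
      auto
  then have bj: "bij_betw f (nball (fst p) (snd p) j) (nball (fst q) (snd q) j)"
    by (simp add: iso_between_def fos)
  have "f ` ?P \<subseteq> ?Q"
  proof safe
    fix v assume v: "v \<in> nball (fst p) (snd p) j" "(fst p, snd p @ [v]) \<in> S"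
    show fv: "f v \<in> nball (fst q) (snd q) j" using bj v(1) by (auto dest: bij_betwE)
    have "set (snd p @ [v]) \<subseteq> nball (fst p) (snd p) j"
      using v(1) roots_in_nball[OF rooted_netsD(4)[OF p]] by auto
    from local_iso_restrict[OF sgp sgq f rooted_netsD(4)[OF p] this, of n n]
    have "local_iso n n (fst p) (snd p @ [v]) (fst q) (snd q @ [f v]) f"
      by (simp add: fos)
    then have "locally_iso n (fst p, snd p @ [v]) (fst q, snd q @ [f v])"
      unfolding locally_iso_def by auto
    moreover have "(fst q, snd q @ [f v]) \<in> rooted_nets (Suc l)"
      by (rule append_vertex_rooted[OF q subsetD[OF nball_subset_verts fv]])
    ultimately show "(fst q, snd q @ [f v]) \<in> S"
      using S v(2) unfolding local_set_def by blast
  qed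
  moreover have "inj_on f ?P"
    by (rule inj_on_subset[OF bij_betw_imp_inj_on[OF bj]]) auto
  ultimately have "card ?P \<le> card ?Q"
    using fin(2) by (intro card_inj_on_le)
  then show ?thesis
    unfolding ext_count_def using fin by (simp add: emeasure_count_space)
qed

lemma ext_count_measurable_local:
  assumes S: "local_set (Suc l) n S"
  shows "ext_count j S \<in> borel_measurable (rooted_space l)"
proof (rule borel_measurableI_less)
  fix y :: ennreal
  have "Measurable.pred (rooted_space l) (\<lambda>p. ext_count j S p < y)"
  proof (rule local_pred_measurable)
    fix p q assume pq: "p \<in> rooted_nets l" "q \<in> rooted_nets l" "locally_iso (j + n) p q" "ext_count j S p < y"
    show "ext_count j S q < y"
      using ext_count_le[OF S pq(2,1) locally_iso_sym[OF pq(1,3)]] pq(4) by (rule le_less_trans)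
  qed
  then show "{p \<in> space (rooted_space l). ext_count j S p < y} \<in> sets (rooted_space l)"
    by (simp add: pred_def)
qed

text \<open>
  Dynkin's lemma, starting from the local sets, for which counts are locally constant. Complements are
  the reason for counting in a fixed ball: there the counts are finite and can be subtracted.
\<close>

lemma ext_count_measurable:
  assumes A: "A \<in> sets (rooted_space (Suc l))"
  shows "ext_count j A \<in> borel_measurable (rooted_space l)"
  using Int_stable_local_sets local_sets_subset A[unfolded sets_rooted_space]
proof (induction A rule: sigma_sets_induct_disjoint)
  case (basic A)
  then show ?case using ext_count_measurable_local by blast
next
  case empty
  show ?case unfolding ext_count_def by simp
next
  case (compl A)
  have top: "local_set (Suc l) 0 (rooted_nets (Suc l))" by (simp add: local_set_def)
  have "ext_count j (rooted_nets (Suc l) - A) p = ext_count j (rooted_nets (Suc l)) p - ext_count j A p"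
    if p: "p \<in> rooted_nets l" for p
  proof -
    have fin: "finite (nball (fst p) (snd p) j)"
      by (rule finite_nball[OF rooted_netsD(1,3)[OF p]])
    have mem: "(fst p, snd p @ [v]) \<in> rooted_nets (Suc l)" if "v \<in> nball (fst p) (snd p) j" for v
      by (rule append_vertex_rooted[OF p subsetD[OF nball_subset_verts that]])
    have "ext_count j (rooted_nets (Suc l) - A) p = emeasure (count_space UNIV)
      ({v\<in>nball (fst p) (snd p) j. (fst p, snd p @ [v]) \<in> rooted_nets (Suc l)} -
        {v\<in>nball (fst p) (snd p) j. (fst p, snd p @ [v]) \<in> A})"
      unfolding ext_count_def by (rule arg_cong[where f="emeasure _"]) auto
    also have "\<dots> = ext_count j (rooted_nets (Suc l)) p - ext_count j A p"
      unfolding ext_count_def using fin mem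
      by (intro emeasure_Diff) (auto simp: emeasure_count_space)
    finally show ?thesis .
  qed
  moreover have "(\<lambda>p. ext_count j (rooted_nets (Suc l)) p - ext_count j A p) \<in> borel_measurable (rooted_space l)"
    using ext_count_measurable_local[OF top] compl by simp
  ultimately show ?case
    by (subst measurable_cong) auto
next
  case (union A)
  have "ext_count j (\<Union>i. A i) p = (\<Sum>i. ext_count j (A i) p)" for p
  proof -
    have "ext_count j (\<Union>i. A i) p = emeasure (count_space UNIV)
        (\<Union>i. {v\<in>nball (fst p) (snd p) j. (fst p, snd p @ [v]) \<in> A i})"
      unfolding ext_count_def by (rule arg_cong[where f="emeasure _"]) auto
    also have "\<dots> = (\<Sum>i. ext_count j (A i) p)"
      unfolding ext_count_def using union(1)
      by (intro suminf_emeasure[symmetric]) (auto simp: disjoint_family_on_def)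
    finally show ?thesis .
  qed
  then have "ext_count j (\<Union>i. A i) = (\<lambda>p. \<Sum>i. ext_count j (A i) p)" by (rule ext)
  then show ?case using union(3) by simp
qed

text \<open>
  The counts in balls increase to the count in the whole network, which is connected. At least one
  root is needed for the balls to exhaust it.
\<close>

lemma measurable_count_vertices:
  assumes \<phi>: "Measurable.pred (rooted_space (Suc l)) \<phi>" and l: "0 < l"
  shows "(\<lambda>p. emeasure (count_space UNIV) {v\<in>verts (fst p). \<phi> (fst p, snd p @ [v])}) \<in> borel_measurable (rooted_space l)"
proof -
  let ?A = "{q\<in>rooted_nets (Suc l). \<phi> q}"
  have A: "?A \<in> sets (rooted_space (Suc l))" using \<phi> by (simp add: pred_def)
  have "emeasure (count_space UNIV) {v\<in>verts (fst p). \<phi> (fst p, snd p @ [v])} = (SUP j. ext_count j ?A p)"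
    if p: "p \<in> rooted_nets l" for p
  proof -
    have un: "(\<Union>n. nball (fst p) (snd p) n) = verts (fst p)"
      using UN_nball[OF rooted_netsD(2,4)[OF p]] rooted_netsD(5)[OF p] l by auto
    have "{v\<in>verts (fst p). \<phi> (fst p, snd p @ [v])} = {v\<in>verts (fst p). (fst p, snd p @ [v]) \<in> ?A}"
      using append_vertex_rooted[OF p] by auto
    also have "\<dots> = (\<Union>j. {v\<in>nball (fst p) (snd p) j. (fst p, snd p @ [v]) \<in> ?A})"
      unfolding un[symmetric] by auto
    finally have eq: "{v\<in>verts (fst p). \<phi> (fst p, snd p @ [v])} =
      (\<Union>j. {v\<in>nball (fst p) (snd p) j. (fst p, snd p @ [v]) \<in> ?A})" .
    show ?thesis
      unfolding eq ext_count_def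
      by (rule SUP_emeasure_incseq[symmetric]) (auto simp: incseq_def intro: subsetD[OF nball_mono])
  qed
  moreover have "(\<lambda>p. SUP j. ext_count j ?A p) \<in> borel_measurable (rooted_space l)"
    using ext_count_measurable[OF A] by simp
  ultimately show ?thesis by (subst measurable_cong) auto
qed

lemma pred_ex_vertex:
  assumes "Measurable.pred (rooted_space (Suc l)) \<phi>" "0 < l"
  shows "Measurable.pred (rooted_space l) (\<lambda>p. \<exists>v\<in>verts (fst p). \<phi> (fst p, snd p @ [v]))"
proof -
  have "(\<lambda>p. \<exists>v\<in>verts (fst p). \<phi> (fst p, snd p @ [v])) =
    (\<lambda>p. emeasure (count_space UNIV) {v\<in>verts (fst p). \<phi> (fst p, snd p @ [v])} \<noteq> 0)"
    by (auto simp: emeasure_count_space_eq_0)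
  then show ?thesis using measurable_count_vertices[OF assms] by simp
qed

lemma pred_all_vertex:
  assumes "Measurable.pred (rooted_space (Suc l)) \<phi>" "0 < l"
  shows "Measurable.pred (rooted_space l) (\<lambda>p. \<forall>v\<in>verts (fst p). \<phi> (fst p, snd p @ [v]))"
proof -
  have "Measurable.pred (rooted_space l) (\<lambda>p. \<not> (\<exists>v\<in>verts (fst p). \<not> \<phi> (fst p, snd p @ [v])))"
    using pred_ex_vertex[where l=l and \<phi>="\<lambda>p. \<not> \<phi> p"] assms by (intro pred_intros_logic) simp_all
  then show ?thesis by simp
qed

definition reroot :: "nat list \<Rightarrow> (nat, real) network \<times> nat list \<Rightarrow> (nat, real) network \<times> nat list" where
  "reroot is p = (fst p, map (\<lambda>i. snd p ! i) is)"

lemma reroot_rooted: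
  assumes "p \<in> rooted_nets l" "\<forall>i\<in>set is. i < l"
  shows "reroot is p \<in> rooted_nets (length is)"
  using assms nth_mem unfolding rooted_nets_def reroot_def by fastforce

lemma reroot_measurable:
  assumes "\<forall>i\<in>set is. i < l"
  shows "reroot is \<in> measurable (rooted_space l) (rooted_space (length is))"
proof -
  have "reroot is -` S \<inter> rooted_nets l \<in> sets (rooted_space l)" if S: "local_set (length is) n S" for n S
  proof -
    have "local_set l n (reroot is -` S \<inter> rooted_nets l)"
      unfolding local_set_def
    proof (intro conjI ballI impI)
      fix p q assume p: "p \<in> reroot is -` S \<inter> rooted_nets l" and q: "q \<in> rooted_nets l" and pq: "locally_iso n p q"
      obtain f where f: "local_iso n n (fst p) (snd p) (fst q) (snd q) f"
        using pq unfolding locally_iso_def by blast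
      have pl: "p \<in> rooted_nets l" using p by simp
      have "set (snd (reroot is p)) \<subseteq> set (snd p)"
        using assms rooted_netsD(5)[OF pl] by (auto simp: reroot_def)
      also have "\<dots> \<subseteq> nball (fst p) (snd p) 0" by (rule roots_in_nball[OF rooted_netsD(4)[OF pl]])
      finally have "local_iso n n (fst p) (snd (reroot is p)) (fst q) (map f (snd (reroot is p))) f"
        by (rule local_iso_restrict[OF rooted_netsD(1)[OF pl] rooted_netsD(1)[OF q] f rooted_netsD(4)[OF pl]]) auto
      moreover have "map f (snd (reroot is p)) = snd (reroot is q)"
      proof -
        have "snd q = map f (snd p)" using f by (simp add: iso_between_def)
        then show ?thesis using assms rooted_netsD(5)[OF pl] by (simp add: reroot_def)
      qed
      ultimately have "local_iso n n (fst p) (snd (reroot is p)) (fst q) (snd (reroot is q)) f"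
        by (simp only:)
      moreover have "fst (reroot is p) = fst p" "fst (reroot is q) = fst q"
        by (simp_all add: reroot_def)
      ultimately have "locally_iso n (reroot is p) (reroot is q)"
        unfolding locally_iso_def by (simp only:) blast
      then show "q \<in> reroot is -` S \<inter> rooted_nets l"
        using S p q reroot_rooted[OF q assms] unfolding local_set_def by auto
    qed simp
    then show ?thesis by (rule local_set_measurable)
  qed
  then show ?thesis
    unfolding rooted_space_def[of "length is"]
    by (intro measurable_measure_of local_sets_subset) (auto intro: reroot_rooted[OF _ assms])
qed

section \<open>Random networks\<close>

text \<open>
  The content of a ball up to precision \<open>n\<close>, written down in finite sets. There are countably many
  such codes, and equal codes imply local isomorphism.
\<close>

definition ball_code ::
  "nat \<Rightarrow> (nat, real) network \<times> nat list \<Rightarrow> nat list \<times> nat set \<times> (nat \<times> nat) set \<times> (nat \<times> nat) set \<times> (nat \<times> nat \<times> nat) set" where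
  "ball_code n p = (let N = fst p; B = nball N (snd p) n in
     (snd p, B, {(u, v). u \<in> B \<and> v \<in> B \<and> {u, v} \<in> edges N},
      {(v, k). v \<in> B \<and> k < n \<and> k \<in> mark_bits (vmark N v)},
      {(u, v, k). u \<in> B \<and> v \<in> B \<and> {u, v} \<in> edges N \<and> k < n \<and> k \<in> mark_bits (emark N u {u, v})}))"

lemma ball_code_eq_imp_locally_iso:
  assumes "ball_code n p = ball_code n q"
  shows "locally_iso n p q"
proof -
  have os: "snd p = snd q" and B: "nball (fst p) (snd p) n = nball (fst q) (snd q) n"
    using assms unfolding ball_code_def Let_def prod.inject by blast+
  have E: "{u, v} \<in> edges (fst p) \<longleftrightarrow> {u, v} \<in> edges (fst q)"
    if "u \<in> nball (fst q) (snd q) n" "v \<in> nball (fst q) (snd q) n" for u v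
  proof -
    have "(u, v) \<in> fst (snd (snd (ball_code n p))) \<longleftrightarrow> (u, v) \<in> fst (snd (snd (ball_code n q)))"
      using assms by simp
    then show ?thesis using that by (simp add: ball_code_def Let_def os B[unfolded os])
  qed
  have V: "k \<in> mark_bits (vmark (fst p) v) \<longleftrightarrow> k \<in> mark_bits (vmark (fst q) v)"
    if "v \<in> nball (fst q) (snd q) n" "k < n" for v k
  proof -
    have "(v, k) \<in> fst (snd (snd (snd (ball_code n p)))) \<longleftrightarrow> (v, k) \<in> fst (snd (snd (snd (ball_code n q))))"
      using assms by simp
    then show ?thesis using that by (simp add: ball_code_def Let_def os B[unfolded os])
  qed
  have F: "k \<in> mark_bits (emark (fst p) u {u, v}) \<longleftrightarrow> k \<in> mark_bits (emark (fst q) u {u, v})"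
    if "u \<in> nball (fst q) (snd q) n" "v \<in> nball (fst q) (snd q) n" "{u, v} \<in> edges (fst q)" "k < n" for u v k
  proof -
    have "(u, v, k) \<in> snd (snd (snd (snd (ball_code n p)))) \<longleftrightarrow> (u, v, k) \<in> snd (snd (snd (snd (ball_code n q))))"
      using assms by simp
    then show ?thesis using that E[OF that(1,2)] by (simp add: ball_code_def Let_def os B[unfolded os])
  qed
  have "local_iso n n (fst p) (snd p) (fst q) (snd q) id"
    unfolding iso_between_def mark_agree_iff B using E V F by (simp add: os)
  then show ?thesis unfolding locally_iso_def by blast
qed

lemma countable_ball_codes: "countable (ball_code n ` rooted_nets l)"
proof -
  have "ball_code n ` rooted_nets l \<subseteq>
    UNIV \<times> Collect finite \<times> Collect finite \<times> Collect finite \<times> Collect finite"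
  proof
    fix c assume "c \<in> ball_code n ` rooted_nets l"
    then obtain p where p: "p \<in> rooted_nets l" "c = ball_code n p" by blast
    let ?B = "nball (fst p) (snd p) n"
    have fin: "finite ?B" by (rule finite_nball[OF rooted_netsD(1,3)[OF p(1)]])
    have "finite {(u, v). u \<in> ?B \<and> v \<in> ?B \<and> {u, v} \<in> edges (fst p)}"
      by (rule finite_subset[of _ "?B \<times> ?B"]) (use fin in auto)
    moreover have "finite {(v, k). v \<in> ?B \<and> k < n \<and> k \<in> mark_bits (vmark (fst p) v)}"
      by (rule finite_subset[of _ "?B \<times> {..<n}"]) (use fin in auto)
    moreover have "finite {(u, v, k). u \<in> ?B \<and> v \<in> ?B \<and> {u, v} \<in> edges (fst p) \<and> k < n \<and> k \<in> mark_bits (emark (fst p) u {u, v})}"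
      by (rule finite_subset[of _ "?B \<times> ?B \<times> {..<n}"]) (use fin in auto)
    ultimately show "c \<in> UNIV \<times> Collect finite \<times> Collect finite \<times> Collect finite \<times> Collect finite"
      using fin unfolding p(2) ball_code_def Let_def by simp
  qed
  then show ?thesis
    by (rule countable_subset) (intro countable_SIGMA countable_Collect_finite countableI_type)
qed

text \<open>
  The preimage of a local set is a countable union of events that prescribe the code of a ball. Each of
  these is a countable combination of events about single vertices, edges and bits.
\<close>

lemma measurable_random_network:
  fixes G :: "'w \<Rightarrow> (nat, real) network" and os :: "'w \<Rightarrow> nat list"
  assumes net: "\<And>\<omega>. \<omega> \<in> space M \<Longrightarrow> (G \<omega>, os \<omega>) \<in> rooted_nets l"
    and os [measurable]: "os \<in> measurable M (count_space UNIV)"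
    and verts [measurable]: "\<And>i. Measurable.pred M (\<lambda>\<omega>. i \<in> verts (G \<omega>))"
    and edges [measurable]: "\<And>i j. Measurable.pred M (\<lambda>\<omega>. {i, j} \<in> edges (G \<omega>))"
    and vm [measurable]: "\<And>i k. Measurable.pred M (\<lambda>\<omega>. k \<in> mark_bits (vmark (G \<omega>) i))"
    and em [measurable]: "\<And>i j k. Measurable.pred M (\<lambda>\<omega>. k \<in> mark_bits (emark (G \<omega>) i {i, j}))"
  shows "(\<lambda>\<omega>. (G \<omega>, os \<omega>)) \<in> measurable M (rooted_space l)"
proof -
  have [measurable]: "Measurable.pred M (\<lambda>\<omega>. (i, j) \<in> adj (edges (G \<omega>)) ^^ k)" for i j k
  proof (induction k arbitrary: j)
    case (Suc k)
    note Suc.IH[measurable]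
    have "(\<lambda>\<omega>. (i, j) \<in> adj (edges (G \<omega>)) ^^ Suc k) =
      (\<lambda>\<omega>. \<exists>h. (i, h) \<in> adj (edges (G \<omega>)) ^^ k \<and> {h, j} \<in> edges (G \<omega>))"
      by (auto simp: adj_def relcomp.simps)
    moreover have "Measurable.pred M \<dots>" by measurable
    ultimately show ?case by simp
  qed simp
  have [measurable]: "Measurable.pred M (\<lambda>\<omega>. i \<in> set (os \<omega>))" for i
    by (rule measurable_compose[OF os]) simp
  have ball [measurable]: "Measurable.pred M (\<lambda>\<omega>. v \<in> nball (G \<omega>) (os \<omega>) n)" for v n
    unfolding nball_def mem_Collect_eq Bex_def by measurable
  have code: "Measurable.pred M (\<lambda>\<omega>. ball_code n (G \<omega>, os \<omega>) = c)" for n c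
  proof -
    obtain ps B E V F where c: "c = (ps, B, E, V, F)" by (metis prod.exhaust)
    have "(\<lambda>\<omega>. ball_code n (G \<omega>, os \<omega>) = c) = (\<lambda>\<omega>.
       os \<omega> = ps \<and> (\<forall>v. v \<in> nball (G \<omega>) (os \<omega>) n \<longleftrightarrow> v \<in> B) \<and>
       (\<forall>u v. u \<in> nball (G \<omega>) (os \<omega>) n \<and> v \<in> nball (G \<omega>) (os \<omega>) n \<and> {u, v} \<in> edges (G \<omega>) \<longleftrightarrow> (u, v) \<in> E) \<and>
       (\<forall>v k. v \<in> nball (G \<omega>) (os \<omega>) n \<and> k < n \<and> k \<in> mark_bits (vmark (G \<omega>) v) \<longleftrightarrow> (v, k) \<in> V) \<and>
       (\<forall>u v k. u \<in> nball (G \<omega>) (os \<omega>) n \<and> v \<in> nball (G \<omega>) (os \<omega>) n \<and> {u, v} \<in> edges (G \<omega>) \<and>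
          k < n \<and> k \<in> mark_bits (emark (G \<omega>) u {u, v}) \<longleftrightarrow> (u, v, k) \<in> F))"
      unfolding c ball_code_def Let_def prod.inject fst_conv snd_conv set_eq_iff split_paired_All by simp
    moreover have "Measurable.pred M \<dots>" by measurable
    ultimately show ?thesis by simp
  qed
  have "(\<lambda>\<omega>. (G \<omega>, os \<omega>)) -` S \<inter> space M \<in> sets M" if S: "local_set l n S" for n S
  proof -
    have "(\<lambda>\<omega>. (G \<omega>, os \<omega>)) -` S \<inter> space M =
      (\<Union>c\<in>ball_code n ` S. {\<omega>\<in>space M. ball_code n (G \<omega>, os \<omega>) = c})"
    proof (intro set_eqI iffI)
      fix \<omega> assume "\<omega> \<in> (\<Union>c\<in>ball_code n ` S. {\<omega>\<in>space M. ball_code n (G \<omega>, os \<omega>) = c})"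
      then obtain p where p: "p \<in> S" "\<omega> \<in> space M" "ball_code n p = ball_code n (G \<omega>, os \<omega>)" by auto
      then have "(G \<omega>, os \<omega>) \<in> S"
        using S net[OF p(2)] ball_code_eq_imp_locally_iso[OF p(3)] unfolding local_set_def by blast
      then show "\<omega> \<in> (\<lambda>\<omega>. (G \<omega>, os \<omega>)) -` S \<inter> space M" using p by simp
    qed auto
    moreover have "countable (ball_code n ` S)"
      using S by (intro countable_subset[OF _ countable_ball_codes[of n l]]) (auto simp: local_set_def)
    moreover have "{\<omega>\<in>space M. ball_code n (G \<omega>, os \<omega>) = c} \<in> sets M" for c
      using code[of n c] by (simp add: pred_def)
    ultimately show ?thesis by (simp only: sets.countable_UN'')
  qed
  then show ?thesis
    unfolding rooted_space_def
    by (intro measurable_measure_of local_sets_subset) (use net in auto)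
qed

section \<open>Displacements from edge marks\<close>

lemma borel_measurable_group_uminus [measurable (raw)]:
  fixes f :: "'a \<Rightarrow> 'x::{topological_group_add, second_countable_topology}"
  assumes "f \<in> borel_measurable M"
  shows "(\<lambda>x. - f x) \<in> borel_measurable M"
  by (rule borel_measurable_continuous_on[OF _ assms]) (intro continuous_intros)

lemma pred_root_eq:
  assumes "i < l" "j < l"
  shows "Measurable.pred (rooted_space l) (\<lambda>q. snd q ! i = snd q ! j)"
proof (rule local_pred_measurable)
  fix p q assume pq: "p \<in> rooted_nets l" "q \<in> rooted_nets l" "locally_iso 0 p q" "snd p ! i = snd p ! j"
  obtain f where "snd q = map f (snd p)"
    using pq(3) unfolding locally_iso_def iso_between_def by metis
  then show "snd q ! i = snd q ! j"
    using pq(4) assms rooted_netsD(5)[OF pq(1)] by simp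
qed

lemma locally_iso_roots:
  assumes p: "p \<in> rooted_nets l" and q: "q \<in> rooted_nets l" and pq: "locally_iso n p q" and ij: "i < l" "j < l"
  shows "{snd p ! i, snd p ! j} \<in> edges (fst p) \<longleftrightarrow> {snd q ! i, snd q ! j} \<in> edges (fst q)"
    "{snd p ! i, snd p ! j} \<in> edges (fst p) \<Longrightarrow>
      mark_agree n (emark (fst p) (snd p ! i) {snd p ! i, snd p ! j}) (emark (fst q) (snd q ! i) {snd q ! i, snd q ! j})"
proof -
  obtain f where f: "local_iso n n (fst p) (snd p) (fst q) (snd q) f"
    using pq unfolding locally_iso_def by blast
  have len: "length (snd p) = l" by (rule rooted_netsD(5)[OF p])
  have os: "snd q = map f (snd p)" using f by (simp add: iso_between_def)
  have eq: "snd q ! i = f (snd p ! i)" "snd q ! j = f (snd p ! j)"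
    using os ij len by simp_all
  have mem: "snd p ! k \<in> nball (fst p) (snd p) n" if "k < l" for k
    using roots_in_nball[OF rooted_netsD(4)[OF p], of n] nth_mem that len by blast
  show "{snd p ! i, snd p ! j} \<in> edges (fst p) \<longleftrightarrow> {snd q ! i, snd q ! j} \<in> edges (fst q)"
    using f mem[OF ij(1)] mem[OF ij(2)] unfolding iso_between_def eq by blast
  show "{snd p ! i, snd p ! j} \<in> edges (fst p) \<Longrightarrow>
      mark_agree n (emark (fst p) (snd p ! i) {snd p ! i, snd p ! j}) (emark (fst q) (snd q ! i) {snd q ! i, snd q ! j})"
    using f mem[OF ij(1)] mem[OF ij(2)] unfolding iso_between_def eq by blast
qed

lemma pred_root_edge:
  assumes "i < l" "j < l"
  shows "Measurable.pred (rooted_space l) (\<lambda>q. {snd q ! i, snd q ! j} \<in> edges (fst q))"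
proof (rule local_pred_measurable)
  fix p q assume "p \<in> rooted_nets l" "q \<in> rooted_nets l" "locally_iso 0 p q" "{snd p ! i, snd p ! j} \<in> edges (fst p)"
  then show "{snd q ! i, snd q ! j} \<in> edges (fst q)"
    using locally_iso_roots(1)[of p l q 0 i j] assms by blast
qed

text \<open>
  The default \<open>0\<close> for non-adjacent roots is needed for invariance: the marks of a network at
  non-edges are arbitrary and not respected by isomorphisms.
\<close>

definition edge_mark :: "nat \<Rightarrow> nat \<Rightarrow> (nat, real) network \<times> nat list \<Rightarrow> real" where
  "edge_mark i j q = (if {snd q ! i, snd q ! j} \<in> edges (fst q)
     then emark (fst q) (snd q ! i) {snd q ! i, snd q ! j} else 0)"

lemma edge_mark_measurable:
  assumes "i < l" "j < l"
  shows "edge_mark i j \<in> measurable (rooted_space l) mark_algebra"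
proof (rule measurable_mark_algebraI)
  fix k
  show "Measurable.pred (rooted_space l) (\<lambda>q. k \<in> mark_bits (edge_mark i j q))"
  proof (rule local_pred_measurable)
    fix p q assume pq: "p \<in> rooted_nets l" "q \<in> rooted_nets l" "locally_iso (Suc k) p q" "k \<in> mark_bits (edge_mark i j p)"
    have "mark_agree (Suc k) (edge_mark i j p) (edge_mark i j q)"
      using locally_iso_roots[OF pq(1-3) assms] by (simp add: edge_mark_def)
    then show "k \<in> mark_bits (edge_mark i j q)"
      using pq(4) by (simp add: mark_agree_iff)
  qed
qed

locale mark_decoding =
  fixes decode :: "real \<Rightarrow> 'x::{topological_group_add, second_countable_topology, t2_space}"
  assumes locally_compact: "locally_compact_space (euclidean :: 'x topology)"
    and decode_measurable: "decode \<in> measurable mark_algebra borel"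
begin

fun joins :: "(nat, real) network \<Rightarrow> nat \<Rightarrow> 'x \<Rightarrow> nat \<Rightarrow> nat \<Rightarrow> bool" where
  "joins N 0 x u v \<longleftrightarrow> u = v \<and> x = 0"
| "joins N (Suc k) x u w \<longleftrightarrow>
     (\<exists>v y. joins N k y u v \<and> {v, w} \<in> edges N \<and> x = y + decode (emark N v {v, w}))"

text \<open>
  The summand \<open>F\<close> is what makes the induction work. A walk of length \<open>k + 1\<close> to the root at \<open>p\<close> is a
  walk of length \<open>k\<close> to a further vertex, appended as a root at position \<open>l\<close>, whose mark is added to \<open>F\<close>.
\<close>

lemma pred_joins:
  assumes "p < l" "F \<in> borel_measurable (rooted_space l)" "B \<in> sets borel"
  shows "Measurable.pred (rooted_space l)
    (\<lambda>q. \<exists>x. joins (fst q) k x (snd q ! 0) (snd q ! p) \<and> x + F q \<in> B)"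
  using assms
proof (induction k arbitrary: l p F)
  case 0
  have "Measurable.pred (rooted_space l) (\<lambda>q. snd q ! 0 = snd q ! p \<and> F q \<in> B)"
    using 0 by (intro pred_intros_logic pred_root_eq pred_sets2[OF 0(3,2)]) auto
  then show ?case by simp
next
  case (Suc k)
  (* The old F refers to the first l of the l + 1 roots. *)
  define F' where "F' q = decode (edge_mark l p q) + F (reroot [0..<l] q)" for q
  have "reroot [0..<l] \<in> measurable (rooted_space (Suc l)) (rooted_space (length [0..<l]))"
    by (rule reroot_measurable) simp
  then have "(\<lambda>q. F (reroot [0..<l] q)) \<in> borel_measurable (rooted_space (Suc l))"
    using measurable_compose[OF _ Suc.prems(2)] by simp
  moreover have "(\<lambda>q. decode (edge_mark l p q)) \<in> borel_measurable (rooted_space (Suc l))"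
    using Suc.prems(1) by (intro measurable_compose[OF edge_mark_measurable decode_measurable]) auto
  ultimately have F': "F' \<in> borel_measurable (rooted_space (Suc l))"
    unfolding F'_def by measurable
  define \<phi> where "\<phi> q \<longleftrightarrow> {snd q ! l, snd q ! p} \<in> edges (fst q) \<and>
    (\<exists>y. joins (fst q) k y (snd q ! 0) (snd q ! l) \<and> y + F' q \<in> B)" for q
  have "Measurable.pred (rooted_space (Suc l)) \<phi>"
    unfolding \<phi>_def using Suc.prems(1)
    by (intro pred_intros_logic pred_root_edge Suc.IH[OF _ F' Suc.prems(3)]) auto
  then have "Measurable.pred (rooted_space l) (\<lambda>q. \<exists>v\<in>verts (fst q). \<phi> (fst q, snd q @ [v]))"
    using Suc.prems(1) by (intro pred_ex_vertex) auto
  moreover have "(\<exists>v\<in>verts (fst q). \<phi> (fst q, snd q @ [v])) \<longleftrightarrow>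
    (\<exists>x. joins (fst q) (Suc k) x (snd q ! 0) (snd q ! p) \<and> x + F q \<in> B)"
    if q: "q \<in> rooted_nets l" for q
  proof -
    have len: "length (snd q) = l" by (rule rooted_netsD(5)[OF q])
    have re: "reroot [0..<l] (fst q, snd q @ [v]) = q" for v
      using len by (auto simp: reroot_def prod_eq_iff nth_append intro!: nth_equalityI)
    have "\<phi> (fst q, snd q @ [v]) \<longleftrightarrow> {v, snd q ! p} \<in> edges (fst q) \<and>
      (\<exists>y. joins (fst q) k y (snd q ! 0) v \<and> y + (decode (emark (fst q) v {v, snd q ! p}) + F q) \<in> B)" for v
      using len Suc.prems(1) by (auto simp: \<phi>_def F'_def re edge_mark_def nth_append)
    moreover have "v \<in> verts (fst q)" if "{v, snd q ! p} \<in> edges (fst q)" for v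
      using edge_verts[OF rooted_netsD(1)[OF q] that] by simp
    ultimately show ?thesis
      by (simp add: add.assoc[symmetric]) blast
  qed
  ultimately show ?case
    by (subst measurable_cong) auto
qed

definition connects :: "'x set \<Rightarrow> (nat, real) network \<times> nat list \<Rightarrow> bool" where
  "connects B q \<longleftrightarrow> (\<exists>k. \<exists>x\<in>B. joins (fst q) k x (snd q ! 0) (snd q ! 1))"

lemma pred_connects:
  assumes "B \<in> sets borel"
  shows "Measurable.pred (rooted_space 2) (connects B)"
proof -
  have "Measurable.pred (rooted_space 2)
      (\<lambda>q. \<exists>k. \<exists>x. joins (fst q) k x (snd q ! 0) (snd q ! 1) \<and> x + (0::'x) \<in> B)"
    by (intro pred_intros_countable pred_joins assms) auto
  moreover have "connects B = (\<lambda>q. \<exists>k. \<exists>x. joins (fst q) k x (snd q ! 0) (snd q ! 1) \<and> x + (0::'x) \<in> B)"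
    unfolding connects_def by auto
  ultimately show ?thesis by simp
qed

lemma connects_UNIV:
  assumes q: "q \<in> rooted_nets 2"
  shows "connects UNIV q"
proof -
  have "snd q ! 0 \<in> verts (fst q)" "snd q ! 1 \<in> verts (fst q)"
    using rooted_netsD(4,5)[OF q] nth_mem[of 0 "snd q"] nth_mem[of 1 "snd q"] by auto
  then have "(snd q ! 0, snd q ! 1) \<in> (adj (edges (fst q)))\<^sup>*"
    using rooted_netsD(2)[OF q] by (simp add: connected_graph_def)
  then have "\<exists>k x. joins (fst q) k x (snd q ! 0) (snd q ! 1)"
  proof (induction rule: rtrancl_induct)
    case base
    then show ?case by (intro exI[of _ 0]) simp
  next
    case (step v w)
    then obtain k x where "joins (fst q) k x (snd q ! 0) v" by blast
    with step(2) show ?case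
      by (intro exI[of _ "Suc k"]) (auto simp: adj_def)
  qed
  then show ?thesis by (auto simp: connects_def)
qed

definition displacement :: "(nat, real) network \<times> nat list \<Rightarrow> 'x" where
  "displacement q = (if \<exists>!x. \<exists>k. joins (fst q) k x (snd q ! 0) (snd q ! 1)
     then THE x. \<exists>k. joins (fst q) k x (snd q ! 0) (snd q ! 1) else 0)"

text \<open>
  Uniqueness of the sum is tested with countably many open sets that separate points: no base set may be
  hit by one walk and missed by another.
\<close>

lemma displacement_measurable: "displacement \<in> borel_measurable (rooted_space 2)"
proof -
  obtain B :: "nat \<Rightarrow> 'x set" where B: "\<And>n. open (B n)"
    "\<And>U x. open U \<Longrightarrow> x \<in> U \<Longrightarrow> \<exists>n. x \<in> B n \<and> B n \<subseteq> U"
    by (rule relatively_compact_base[OF locally_compact]) (rule that)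
  define J where "J q x \<longleftrightarrow> (\<exists>k. joins (fst q) k x (snd q ! 0) (snd q ! 1))" for q x
  have J: "connects C q \<longleftrightarrow> (\<exists>x\<in>C. J q x)" for C q
    unfolding connects_def J_def by blast
  have ex: "\<exists>x. J q x" if "q \<in> rooted_nets 2" for q
    using connects_UNIV[OF that] unfolding J by blast
  have uniq: "(\<exists>!x. J q x) \<longleftrightarrow> (\<forall>n. \<not> (connects (B n) q \<and> connects (- B n) q))" if q: "q \<in> rooted_nets 2" for q
  proof
    assume R: "\<forall>n. \<not> (connects (B n) q \<and> connects (- B n) q)"
    have "x = y" if "J q x" "J q y" for x y
    proof (rule ccontr)
      assume "x \<noteq> y"
      then obtain U where U: "open U" "x \<in> U" "y \<notin> U" using t1_space by blast
      then obtain n where "x \<in> B n" "B n \<subseteq> U" using B(2)[OF U(1,2)] by auto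
      then have "connects (B n) q \<and> connects (- B n) q"
        unfolding J using that U by auto
      then show False using R by simp
    qed
    then show "\<exists>!x. J q x" using ex[OF q] by auto
  qed (unfold J, auto)
  show ?thesis
  proof (rule measurableI)
    fix C :: "'x set" assume C: "C \<in> sets borel"
    have "displacement -` C \<inter> space (rooted_space 2) = {q\<in>space (rooted_space 2).
      ((\<forall>n. \<not> (connects (B n) q \<and> connects (- B n) q)) \<and> connects C q) \<or>
      (\<not> (\<forall>n. \<not> (connects (B n) q \<and> connects (- B n) q)) \<and> 0 \<in> C)}"
    proof (intro set_eqI)
      fix q
      have "displacement q \<in> C \<longleftrightarrow> ((\<exists>!x. J q x) \<and> connects C q) \<or> (\<not> (\<exists>!x. J q x) \<and> 0 \<in> C)"
      proof (cases "\<exists>!x. J q x")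
        case True
        then obtain x where x: "J q x" "\<And>y. J q y \<Longrightarrow> y = x" by blast
        then have "(THE x. J q x) = x" by (rule the_equality)
        then have "displacement q = x" using True unfolding displacement_def J_def by simp
        moreover have "connects C q \<longleftrightarrow> x \<in> C" unfolding J using x by blast
        ultimately show ?thesis using True by simp
      next
        case False
        then show ?thesis unfolding displacement_def J_def by simp
      qed
      then show "q \<in> displacement -` C \<inter> space (rooted_space 2) \<longleftrightarrow> q \<in> {q\<in>space (rooted_space 2).
        ((\<forall>n. \<not> (connects (B n) q \<and> connects (- B n) q)) \<and> connects C q) \<or>
        (\<not> (\<forall>n. \<not> (connects (B n) q \<and> connects (- B n) q)) \<and> 0 \<in> C)}"
        using uniq[of q] by auto
    qed
    also have "\<dots> \<in> sets (rooted_space 2)"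
    proof -
      have [measurable]: "Measurable.pred (rooted_space 2) (connects C)"
        "Measurable.pred (rooted_space 2) (connects (B n))" "Measurable.pred (rooted_space 2) (connects (- B n))" for n
        using C B(1) by (auto intro!: pred_connects)
      show ?thesis by measurable
    qed
    finally show "displacement -` C \<inter> space (rooted_space 2) \<in> sets (rooted_space 2)" .
  qed simp
qed

text \<open>
  If the marks come from positions \<open>Y\<close>, the sums along walks telescope.
\<close>

lemma displacement_eq:
  assumes q: "(N, [u, v]) \<in> rooted_nets 2"
    and Y: "\<And>a b. {a, b} \<in> edges N \<Longrightarrow> decode (emark N a {a, b}) = - Y a + Y b"
  shows "displacement (N, [u, v]) = - Y u + Y v"
proof -
  have J: "joins N k x a b \<Longrightarrow> x = - Y a + Y b" for k x a b
  proof (induction k arbitrary: x b)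
    case (Suc k)
    then obtain c y where "joins N k y a c" "{c, b} \<in> edges N" "x = y + decode (emark N c {c, b})" by auto
    then have "x = (- Y a + Y c) + (- Y c + Y b)" using Suc.IH Y by simp
    then show ?case by (simp add: add.assoc)
  qed simp
  obtain k x where kx: "joins N k x u v"
    using connects_UNIV[OF q] by (auto simp: connects_def)
  have "(\<exists>k. joins N k y u v) \<longleftrightarrow> y = - Y u + Y v" for y
    using J[OF kx] kx J[of _ y u v] by blast
  then show ?thesis unfolding displacement_def by simp
qed

end

section \<open>The embedding of a class of networks\<close>

lemma compact_translate:
  fixes C :: "'x::topological_group_add set"
  assumes "compact C"
  shows "compact ((\<lambda>y. x + y) ` C)"
  using assms by (intro compact_continuous_image continuous_intros)

lemma rooted_nets_1E:
  assumes "p \<in> rooted_nets 1"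
  obtains N u where "p = (N, [u])" "is_network mark_metric N" "u \<in> verts N"
proof -
  obtain N os where p: "p = (N, os)" by force
  then obtain u where "os = [u]"
    using rooted_netsD(5)[OF assms] by (auto simp: length_Suc_conv)
  then show thesis using that[of N u] assms p by (auto simp: rooted_nets_def)
qed

lemma rooted_nets_pairI:
  "is_network mark_metric N \<Longrightarrow> u \<in> verts N \<Longrightarrow> v \<in> verts N \<Longrightarrow> (N, [u, v]) \<in> rooted_nets 2"
  by (simp add: rooted_nets_def)

lemma rooted_nets_singleI:
  "is_network mark_metric N \<Longrightarrow> u \<in> verts N \<Longrightarrow> (N, [u]) \<in> rooted_nets 1"
  by (simp add: rooted_nets_def)

lemma space_counting_measure_space:
  "space (counting_measure_space :: 'x::topological_space measure measure) = lf_counting_measures"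
proof -
  have "sets (borel :: 'x measure) \<noteq> {}" by (metis empty_iff sets.top)
  then show ?thesis
    unfolding counting_measure_space_def by (simp add: space_Sup_eq_UN)
qed

lemma measurable_counting_measure_spaceI:
  fixes f :: "'w \<Rightarrow> 'x::topological_space measure"
  assumes "\<And>\<omega>. \<omega> \<in> space M \<Longrightarrow> f \<omega> \<in> lf_counting_measures"
    and "\<And>B. B \<in> sets borel \<Longrightarrow> (\<lambda>\<omega>. emeasure (f \<omega>) B) \<in> borel_measurable M"
  shows "f \<in> measurable M counting_measure_space"
  unfolding counting_measure_space_def
proof (rule measurable_SUP2)
  show "sets (borel :: 'x measure) \<noteq> {}" by (metis empty_iff sets.top)
qed (use assms in \<open>auto intro: measurable_vimage_algebra2\<close>)

lemma measurable_emeasure_counting: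
  assumes f: "f \<in> measurable M counting_measure_space" and B: "B \<in> sets borel"
  shows "(\<lambda>\<omega>. emeasure (f \<omega>) B) \<in> borel_measurable M"
proof -
  have "(\<lambda>\<mu>. emeasure \<mu> B) \<in> borel_measurable counting_measure_space"
    unfolding counting_measure_space_def
    by (rule measurable_SUP1[OF B]) (auto intro: measurable_vimage_algebra1)
  from measurable_compose[OF f this] show ?thesis .
qed

context mark_decoding
begin

definition cocycle :: "(nat, real) network \<Rightarrow> bool" where
  "cocycle N \<longleftrightarrow> (\<forall>u\<in>verts N. \<forall>v\<in>verts N. \<forall>w\<in>verts N.
     displacement (N, [u, v]) + displacement (N, [v, w]) = displacement (N, [u, w]))"

text \<open>
  The networks that are really embedded. The first condition makes displacements those of a
  configuration of points, the second makes this configuration locally finite.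
\<close>

definition embeddable :: "(nat, real) network \<times> nat list \<Rightarrow> bool" where
  "embeddable q \<longleftrightarrow> cocycle (fst q) \<and>
     (\<forall>C. compact C \<longrightarrow> finite {v\<in>verts (fst q). displacement (fst q, [snd q ! 0, v]) \<in> C})"

lemma cocycle_self: "cocycle N \<Longrightarrow> u \<in> verts N \<Longrightarrow> displacement (N, [u, u]) = 0"
  unfolding cocycle_def by (metis add_right_imp_eq add_0)

lemma cocycle_inverse:
  assumes "cocycle N" "u \<in> verts N" "v \<in> verts N"
  shows "displacement (N, [v, u]) = - displacement (N, [u, v])"
  using assms cocycle_self[OF assms(1,3)] unfolding cocycle_def by (metis eq_neg_iff_add_eq_0)

lemma cocycle_difference:
  assumes "cocycle N" "u \<in> verts N" "v \<in> verts N" "w \<in> verts N"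
  shows "displacement (N, [v, w]) = - displacement (N, [u, v]) + displacement (N, [u, w])"
  using assms cocycle_inverse[OF assms(1-3)] unfolding cocycle_def by metis

text \<open>
  Changing the root translates the displacements, and translates of compact sets are compact.
\<close>

lemma embeddable_reroot:
  assumes "embeddable (N, [u])" "u \<in> verts N" "v \<in> verts N"
  shows "embeddable (N, [v])"
proof -
  have c: "cocycle N" using assms(1) by (simp add: embeddable_def)
  have "finite {w\<in>verts N. displacement (N, [v, w]) \<in> C}" if C: "compact C" for C
  proof -
    have "finite {w\<in>verts N. displacement (N, [u, w]) \<in> (\<lambda>y. displacement (N, [u, v]) + y) ` C}"
      using assms(1) compact_translate[OF C] by (simp add: embeddable_def)
    moreover have "{w\<in>verts N. displacement (N, [v, w]) \<in> C} \<subseteq>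
      {w\<in>verts N. displacement (N, [u, w]) \<in> (\<lambda>y. displacement (N, [u, v]) + y) ` C}"
    proof
      fix w assume w: "w \<in> {w\<in>verts N. displacement (N, [v, w]) \<in> C}"
      then have "displacement (N, [u, w]) = displacement (N, [u, v]) + displacement (N, [v, w])"
        using c assms(2,3) unfolding cocycle_def by simp
      then show "w \<in> {w\<in>verts N. displacement (N, [u, w]) \<in> (\<lambda>y. displacement (N, [u, v]) + y) ` C}"
        using w by auto
    qed
    ultimately show ?thesis by (rule rev_finite_subset)
  qed
  then show ?thesis using c by (simp add: embeddable_def)
qed

lemma displacement_reroot_measurable:
  assumes "i < l" "j < l"
  shows "(\<lambda>q. displacement (reroot [i, j] q)) \<in> borel_measurable (rooted_space l)"
proof -
  have "reroot [i, j] \<in> measurable (rooted_space l) (rooted_space (length [i, j]))"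
    by (rule reroot_measurable) (use assms in auto)
  then have "reroot [i, j] \<in> measurable (rooted_space l) (rooted_space 2)" by (simp add: numeral_2_eq_2)
  then show ?thesis by (rule measurable_compose[OF _ displacement_measurable])
qed

lemma count_displacement_measurable:
  assumes "B \<in> sets borel"
  shows "(\<lambda>q. emeasure (count_space UNIV) {v\<in>verts (fst q). displacement (fst q, [snd q ! 0, v]) \<in> B})
    \<in> borel_measurable (rooted_space 1)"
proof -
  have "(\<lambda>q. emeasure (count_space UNIV) {v\<in>verts (fst q). displacement (fst q, snd q @ [v]) \<in> B})
    \<in> borel_measurable (rooted_space 1)"
    using displacement_measurable assms
    by (intro measurable_count_vertices) (auto simp: numeral_2_eq_2)
  moreover have "emeasure (count_space UNIV) {v\<in>verts (fst q). displacement (fst q, [snd q ! 0, v]) \<in> B} =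
      emeasure (count_space UNIV) {v\<in>verts (fst q). displacement (fst q, snd q @ [v]) \<in> B}"
    if "q \<in> space (rooted_space 1)" for q
  proof -
    have "q \<in> rooted_nets 1" using that by simp
    then show ?thesis by (rule rooted_nets_1E) simp
  qed
  ultimately show ?thesis by (rule measurable_cong[THEN iffD2, rotated])
qed

text \<open>
  The cocycle condition quantifies over three vertices in addition to the root; local finiteness needs
  to be tested only on a countable exhaustion by compact sets.
\<close>

lemma pred_embeddable: "Measurable.pred (rooted_space 1) embeddable"
proof -
  obtain K :: "nat \<Rightarrow> 'x set" where K: "\<And>n. compact (K n)" "\<And>C. compact C \<Longrightarrow> \<exists>n. C \<subseteq> K n"
    by (rule compact_exhaustion[OF locally_compact]) (rule that)
  define \<phi> where "\<phi> q \<longleftrightarrow> displacement (reroot [1, 2] q) + displacement (reroot [2, 3] q) = displacement (reroot [1, 3] q)" for q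
  have d: "(\<lambda>q. displacement (reroot [i, j] q)) \<in> borel_measurable (rooted_space (Suc (Suc (Suc 1))))"
    if "i < 4" "j < 4" for i j
    by (rule displacement_reroot_measurable) (use that in auto)
  have "Measurable.pred (rooted_space (Suc (Suc (Suc 1)))) \<phi>"
    unfolding \<phi>_def pred_def by (intro measurable_equality_set borel_measurable_add d) auto
  then have "Measurable.pred (rooted_space 1) (\<lambda>p. \<forall>u\<in>verts (fst p). \<forall>v\<in>verts (fst p). \<forall>w\<in>verts (fst p).
      \<phi> (fst p, ((snd p @ [u]) @ [v]) @ [w]))"
    using pred_all_vertex[where l=1 and \<phi>="\<lambda>p. \<forall>v\<in>verts (fst p). \<forall>w\<in>verts (fst p). \<phi> (fst p, (snd p @ [v]) @ [w])"]
      pred_all_vertex[where l="Suc 1" and \<phi>="\<lambda>p. \<forall>w\<in>verts (fst p). \<phi> (fst p, snd p @ [w])"]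
      pred_all_vertex[where l="Suc (Suc 1)" and \<phi>=\<phi>] by simp
  moreover have "Measurable.pred (rooted_space 1) (\<lambda>q. \<forall>n.
     emeasure (count_space UNIV) {v\<in>verts (fst q). displacement (fst q, [snd q ! 0, v]) \<in> K n} < \<top>)"
    using count_displacement_measurable[OF borel_compact[OF K(1)]] by measurable
  ultimately have "Measurable.pred (rooted_space 1) (\<lambda>p. (\<forall>u\<in>verts (fst p). \<forall>v\<in>verts (fst p). \<forall>w\<in>verts (fst p).
      \<phi> (fst p, ((snd p @ [u]) @ [v]) @ [w])) \<and> (\<forall>n.
     emeasure (count_space UNIV) {v\<in>verts (fst p). displacement (fst p, [snd p ! 0, v]) \<in> K n} < \<top>))"
    by (rule pred_intros_logic)
  moreover have "((\<forall>u\<in>verts (fst p). \<forall>v\<in>verts (fst p). \<forall>w\<in>verts (fst p).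
      \<phi> (fst p, ((snd p @ [u]) @ [v]) @ [w])) \<and> (\<forall>n.
     emeasure (count_space UNIV) {v\<in>verts (fst p). displacement (fst p, [snd p ! 0, v]) \<in> K n} < \<top>)) \<longleftrightarrow> embeddable p"
    if p1: "p \<in> space (rooted_space 1)" for p
  proof -
    have "p \<in> rooted_nets 1" using p1 by simp
    then obtain N u where p: "p = (N, [u])" by (rule rooted_nets_1E) (rule that)
    have "(\<forall>n. finite {v\<in>verts N. displacement (N, [u, v]) \<in> K n}) \<longleftrightarrow>
      (\<forall>C. compact C \<longrightarrow> finite {v\<in>verts N. displacement (N, [u, v]) \<in> C})"
    proof (intro iffI allI impI)
      fix C :: "'x set" assume fin: "\<forall>n. finite {v\<in>verts N. displacement (N, [u, v]) \<in> K n}" and "compact C"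
      then obtain n where "C \<subseteq> K n" using K(2) by blast
      then show "finite {v\<in>verts N. displacement (N, [u, v]) \<in> C}"
        using fin[rule_format, of n] by (rule_tac rev_finite_subset) auto
    qed (use K(1) in blast)
    then show ?thesis
      unfolding p embeddable_def cocycle_def \<phi>_def reroot_def
      by (simp add: emeasure_count_space less_top[symmetric])
  qed
  ultimately show ?thesis by (rule measurable_cong[THEN iffD1, rotated])
qed

definition embed :: "(nat, real) network \<times> nat list \<Rightarrow> 'x measure" where
  "embed q = (if embeddable q
     then distr (count_space (verts (fst q))) borel (\<lambda>v. displacement (fst q, [snd q ! 0, v]))
     else return borel 0)"

lemma sets_embed [simp]: "sets (embed q) = sets borel"
  by (simp add: embed_def)

lemma emeasure_embed:
  assumes "B \<in> sets borel"
  shows "emeasure (embed q) B = (if embeddable q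
    then emeasure (count_space UNIV) {v\<in>verts (fst q). displacement (fst q, [snd q ! 0, v]) \<in> B}
    else indicator B 0)"
proof (cases "embeddable q")
  case True
  have "(\<lambda>v. displacement (fst q, [snd q ! 0, v])) -` B \<inter> verts (fst q) =
    {v\<in>verts (fst q). displacement (fst q, [snd q ! 0, v]) \<in> B}" by auto
  then show ?thesis
    using assms True by (simp add: embed_def emeasure_distr emeasure_count_space)
qed (use assms in \<open>simp add: embed_def\<close>)

lemma embed_lf_counting: "embed q \<in> lf_counting_measures"
proof -
  have "emeasure (embed q) B \<in> insert \<top> (range of_nat)" if "B \<in> sets borel" for B
  proof (cases "embeddable q")
    case True
    then show ?thesis unfolding emeasure_embed[OF that] by (simp add: emeasure_count_space)
  next
    case False
    then show ?thesis unfolding emeasure_embed[OF that]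
      by (auto simp: indicator_def image_iff intro: exI[of _ 0] exI[of _ 1])
  qed
  moreover have "emeasure (embed q) C < \<top>" if C: "compact C" for C
    using C unfolding emeasure_embed[OF borel_compact[OF C]]
    by (auto simp: embeddable_def emeasure_count_space indicator_def less_top[symmetric])
  ultimately show ?thesis by (simp add: lf_counting_measures_def)
qed

lemma emeasure_embed_measurable:
  assumes B: "B \<in> sets borel"
  shows "(\<lambda>q. emeasure (embed q) B) \<in> borel_measurable (rooted_space 1)"
  unfolding emeasure_embed[OF B]
  using count_displacement_measurable[OF B] pred_embeddable by (intro measurable_If) (auto simp: pred_def)

text \<open>
  Every value of the measure is a measurable function of the network, hence invariant.
\<close>

lemma embed_rep_cls:
  assumes "p \<in> rooted_nets 1"
  shows "embed (rep (cls p)) = embed p"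
  using measurable_rep_cls_eq[OF emeasure_embed_measurable assms] by (intro measure_eqI) auto

definition class_embed :: "real net_class \<Rightarrow> 'x measure" where
  "class_embed c = embed (rep c)"

definition class_displacement :: "real net_class \<Rightarrow> 'x" where
  "class_displacement c = (if embeddable (reroot [0] (rep c)) then displacement (rep c) else 0)"

lemma class_embed_measurable: "class_embed \<in> measurable (G_star mark_metric) counting_measure_space"
  unfolding class_embed_def
  by (intro measurable_counting_measure_spaceI embed_lf_counting
      measurable_compose[OF rep_measurable emeasure_embed_measurable])

lemma displacement_if_embeddable_measurable:
  "(\<lambda>q. if embeddable (reroot [0] q) then displacement q else 0) \<in> borel_measurable (rooted_space 2)"
proof -
  have "reroot [0] \<in> measurable (rooted_space 2) (rooted_space (length [0::nat]))"
    by (rule reroot_measurable) simp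
  then have "reroot [0] \<in> measurable (rooted_space 2) (rooted_space 1)" by simp
  then have "Measurable.pred (rooted_space 2) (\<lambda>q. embeddable (reroot [0] q))"
    by (rule measurable_compose[OF _ pred_embeddable])
  then show ?thesis
    using displacement_measurable by (intro measurable_If) (auto simp: pred_def)
qed

lemma class_displacement_measurable: "class_displacement \<in> borel_measurable (G_star_star mark_metric)"
  unfolding class_displacement_def
  by (rule measurable_compose[OF rep_measurable displacement_if_embeddable_measurable])

lemma class_displacement_eq:
  assumes "is_network mark_metric N" "u \<in> verts N" "v \<in> verts N"
  shows "class_displacement (net_class mark_metric N [u, v]) =
    (if embeddable (N, [u]) then displacement (N, [u, v]) else 0)"
  using measurable_rep_cls_eq[OF displacement_if_embeddable_measurable rooted_nets_pairI[OF assms]]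
  unfolding class_displacement_def by (simp only: fst_conv snd_conv reroot_def) simp

lemma class_embed_eq:
  assumes "is_network mark_metric N" "u \<in> verts N"
  shows "class_embed (net_class mark_metric N [u]) = embed (N, [u])"
  using embed_rep_cls[OF rooted_nets_singleI[OF assms]] unfolding class_embed_def by simp

lemma zero_in_points_class_embed:
  assumes "c \<in> space (G_star mark_metric)"
  shows "0 \<in> points (class_embed c)"
proof -
  have "rep c \<in> rooted_nets 1" using assms rep_in_rooted_nets by simp
  then obtain N u where q: "rep c = (N, [u])" "u \<in> verts N" by (rule rooted_nets_1E)
  show ?thesis
  proof (cases "embeddable (N, [u])")
    case True
    then have "displacement (N, [u, u]) = 0"
      using q(2) by (intro cocycle_self) (auto simp: embeddable_def)
    then have "u \<in> {v\<in>verts N. displacement (N, [u, v]) \<in> {0}}" using q(2) by simp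
    then show ?thesis
      using True unfolding points_def class_embed_def q(1)
      by (simp add: emeasure_embed emeasure_count_space_eq_0) blast
  next
    case False
    then show ?thesis
      unfolding points_def class_embed_def q(1) by (simp add: emeasure_embed)
  qed
qed

text \<open>
  The cocycle identity \<open>- t[u,v] + t[u,w] = t[v,w]\<close> is the covariance of the embedding. For networks that
  are not embeddable both measures are the point mass at \<open>0\<close>, and the displacement is \<open>0\<close>.
\<close>

lemma class_embed_covariant:
  assumes N: "is_network mark_metric N" and u: "u \<in> verts N" and v: "v \<in> verts N"
  shows "class_embed (net_class mark_metric N [v]) =
      translate (- class_displacement (net_class mark_metric N [u, v])) (class_embed (net_class mark_metric N [u]))"
    and "class_displacement (net_class mark_metric N [v, u]) = - class_displacement (net_class mark_metric N [u, v])"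
proof -
  have iff: "embeddable (N, [u]) \<longleftrightarrow> embeddable (N, [v])"
    using embeddable_reroot u v by blast
  have [measurable]: "(\<lambda>y. - x + y) \<in> borel_measurable borel" for x :: 'x
    by measurable
  show "class_displacement (net_class mark_metric N [v, u]) = - class_displacement (net_class mark_metric N [u, v])"
    using cocycle_inverse[OF _ u v] iff unfolding class_displacement_eq[OF N u v] class_displacement_eq[OF N v u]
    by (auto simp: embeddable_def)
  show "class_embed (net_class mark_metric N [v]) =
      translate (- class_displacement (net_class mark_metric N [u, v])) (class_embed (net_class mark_metric N [u]))"
    unfolding class_displacement_eq[OF N u v] class_embed_eq[OF N u] class_embed_eq[OF N v]
  proof (cases "embeddable (N, [u])")
    case True
    then have c: "cocycle N" by (simp add: embeddable_def)
    have "embed (N, [v]) = translate (- displacement (N, [u, v])) (embed (N, [u]))"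
    proof (rule measure_eqI)
      show "sets (embed (N, [v])) = sets (translate (- displacement (N, [u, v])) (embed (N, [u])))"
        by (simp add: translate_def)
      fix B assume "B \<in> sets (embed (N, [v]))"
      then have B: "B \<in> sets borel" by simp
      have B': "(\<lambda>y. - displacement (N, [u, v]) + y) -` B \<in> sets borel"
        using measurable_sets[OF _ B, of "\<lambda>y. - displacement (N, [u, v]) + y" borel] by simp
      have "emeasure (translate (- displacement (N, [u, v])) (embed (N, [u]))) B =
        emeasure (embed (N, [u])) ((\<lambda>y. - displacement (N, [u, v]) + y) -` B)"
        unfolding translate_def using B sets_eq_imp_space_eq[OF sets_embed]
        by (subst emeasure_distr) (auto cong: measurable_cong_sets)
      also have "\<dots> = emeasure (count_space UNIV)
         {w\<in>verts N. - displacement (N, [u, v]) + displacement (N, [u, w]) \<in> B}"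
        using True by (simp add: emeasure_embed[OF B'])
      also have "{w\<in>verts N. - displacement (N, [u, v]) + displacement (N, [u, w]) \<in> B} =
         {w\<in>verts N. displacement (N, [v, w]) \<in> B}"
        using cocycle_difference[OF c u v] by auto
      also have "emeasure (count_space UNIV) \<dots> = emeasure (embed (N, [v])) B"
        using True iff by (simp add: emeasure_embed[OF B])
      finally show "emeasure (embed (N, [v])) B =
        emeasure (translate (- displacement (N, [u, v])) (embed (N, [u]))) B" ..
    qed
    then show "embed (N, [v]) =
      translate (- (if embeddable (N, [u]) then displacement (N, [u, v]) else 0)) (embed (N, [u]))"
      using True by simp
  next
    case False
    then have "embed (N, [u]) = return borel 0" "embed (N, [v]) = return borel 0"
      using iff by (auto simp: embed_def)
    then show "embed (N, [v]) =
      translate (- (if embeddable (N, [u]) then displacement (N, [u, v]) else 0)) (embed (N, [u]))"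
      using False by (simp add: translate_def distr_return)
  qed
qed

end

section \<open>Haar measure on a unimodular group\<close>

locale unimodular_haar =
  fixes lam :: "'x::{topological_group_add, second_countable_topology, t2_space} measure"
  assumes locally_compact: "locally_compact_space (euclidean :: 'x topology)"
    and left_haar: "left_haar_measure lam" and right_inv: "right_invariant lam"
begin

lemma sets_lam [simp, measurable_cong]: "sets lam = sets borel"
  using left_haar by (simp add: left_haar_measure_def)

lemma space_lam [simp]: "space lam = UNIV"
  using sets_eq_imp_space_eq[OF sets_lam] by simp

lemma sigma_finite_lam: "sigma_finite_measure lam"
proof -
  obtain K :: "nat \<Rightarrow> 'x set" where K: "\<And>n. compact (K n)" "(\<Union>n. K n) = UNIV"
    by (rule compact_exhaustion[OF locally_compact]) (rule that)
  show ?thesis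
  proof (rule sigma_finite_measure.intro, intro exI[of _ "range K"] conjI ballI)
    fix a assume "a \<in> range K"
    then obtain n where "a = K n" by blast
    then show "emeasure lam a \<noteq> \<infinity>"
      using K(1)[of n] left_haar by (simp add: left_haar_measure_def less_top)
  qed (use K borel_compact in auto)
qed

lemma finite_positive_set:
  obtains C where "C \<in> sets borel" "0 < emeasure lam C" "emeasure lam C < \<top>"
proof -
  obtain K :: "nat \<Rightarrow> 'x set" where K: "\<And>n. compact (K n)" "(\<Union>n. K n) = UNIV"
    by (rule compact_exhaustion[OF locally_compact]) (rule that)
  have Kb: "K n \<in> sets lam" for n using borel_compact[OF K(1)] by simp
  have "\<exists>n. emeasure lam (K n) \<noteq> 0"
  proof (rule ccontr)
    assume "\<nexists>n. emeasure lam (K n) \<noteq> 0"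
    then have "emeasure lam (\<Union>n. K n) = 0"
      using Kb by (intro emeasure_UN_eq_0) auto
    then show False using K(2) left_haar by (simp add: left_haar_measure_def)
  qed
  then obtain n where "emeasure lam (K n) \<noteq> 0" ..
  then show thesis
    using that[of "K n"] K(1) Kb left_haar by (simp add: left_haar_measure_def zero_less_iff_neq_zero)
qed

lemma [measurable]: "(\<lambda>y. x + y) \<in> borel_measurable borel" "(\<lambda>y. y + x) \<in> borel_measurable borel"
    "uminus \<in> borel_measurable (borel :: 'x measure)" for x :: 'x
  using borel_measurable_group_uminus[of "\<lambda>y. y" borel] by simp_all

lemma nn_integral_lam_left:
  assumes f: "f \<in> borel_measurable borel"
  shows "(\<integral>\<^sup>+y. f (x + y) \<partial>lam) = (\<integral>\<^sup>+y. f y \<partial>lam)"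
proof -
  have "distr lam borel (\<lambda>y. x + y) = lam"
  proof (rule measure_eqI)
    fix A assume "A \<in> sets (distr lam borel (\<lambda>y. x + y))"
    then have A: "A \<in> sets borel" by simp
    have "(\<lambda>y. x + y) -` A = (\<lambda>y. - x + y) ` A"
      by (auto simp: image_iff add.assoc[symmetric] intro!: bexI[of _ "x + _"])
    then show "emeasure (distr lam borel (\<lambda>y. x + y)) A = emeasure lam A"
      using A left_haar by (subst emeasure_distr) (auto simp: left_haar_measure_def)
  qed simp
  then have "(\<integral>\<^sup>+y. f y \<partial>lam) = (\<integral>\<^sup>+y. f y \<partial>distr lam borel (\<lambda>y. x + y))" by simp
  also have "\<dots> = (\<integral>\<^sup>+y. f (x + y) \<partial>lam)"
    using f by (subst nn_integral_distr) auto
  finally show ?thesis ..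
qed

lemma nn_integral_lam_right:
  assumes f: "f \<in> borel_measurable borel"
  shows "(\<integral>\<^sup>+y. f (y + x) \<partial>lam) = (\<integral>\<^sup>+y. f y \<partial>lam)"
proof -
  have "distr lam borel (\<lambda>y. y + x) = lam"
  proof (rule measure_eqI)
    fix A assume "A \<in> sets (distr lam borel (\<lambda>y. y + x))"
    then have A: "A \<in> sets borel" by simp
    have "(\<lambda>y. y + x) -` A = (\<lambda>y. y + - x) ` A"
      by (auto simp: image_iff add.assoc intro!: bexI[of _ "_ + x"])
    then show "emeasure (distr lam borel (\<lambda>y. y + x)) A = emeasure lam A"
      using A right_inv unfolding right_invariant_def
      by (subst emeasure_distr) (simp_all del: add_uminus_conv_diff)
  qed simp
  then have "(\<integral>\<^sup>+y. f y \<partial>lam) = (\<integral>\<^sup>+y. f y \<partial>distr lam borel (\<lambda>y. y + x))" by simp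
  also have "\<dots> = (\<integral>\<^sup>+y. f (y + x) \<partial>lam)"
    using f by (subst nn_integral_distr) auto
  finally show ?thesis ..
qed

lemma nn_integral_lam_reflect_translate:
  assumes [measurable]: "f \<in> borel_measurable borel"
  shows "(\<integral>\<^sup>+z. f (- z + x) \<partial>lam) = (\<integral>\<^sup>+z. f (- z) \<partial>lam)"
proof -
  have "(\<integral>\<^sup>+z. f (- (x + z) + x) \<partial>lam) = (\<integral>\<^sup>+z. f (- z + x) \<partial>lam)"
    by (rule nn_integral_lam_left) measurable
  then show ?thesis by (simp add: minus_add add.assoc)
qed

text \<open>
  Invariance under inversion, by computing the integral of \<open>a x * b (z + x)\<close> over all \<open>z\<close> and \<open>x\<close> in two
  ways. Integrating \<open>z\<close> first and using right invariance gives the product of the integrals of \<open>a\<close> and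
  \<open>b\<close>; substituting \<open>x\<close> by \<open>- z + x\<close> first gives the same with \<open>a\<close> reflected.
\<close>

lemma nn_integral_lam_uminus:
  assumes a [measurable]: "a \<in> borel_measurable borel"
  shows "(\<integral>\<^sup>+z. a (- z) \<partial>lam) = (\<integral>\<^sup>+z. a z \<partial>lam)"
proof -
  obtain C where C: "C \<in> sets borel" "0 < emeasure lam C" "emeasure lam C < \<top>"
    by (rule finite_positive_set)
  define b :: "'x \<Rightarrow> ennreal" where "b = indicator C"
  have b [measurable]: "b \<in> borel_measurable borel" unfolding b_def using C by simp
  have lb: "(\<integral>\<^sup>+x. b x \<partial>lam) = emeasure lam C" unfolding b_def using C by simp
  interpret pair_sigma_finite lam lam
    using sigma_finite_lam by (intro pair_sigma_finite.intro)
  have "emeasure lam C * (\<integral>\<^sup>+x. a x \<partial>lam) = (\<integral>\<^sup>+x. a x * (\<integral>\<^sup>+z. b (z + x) \<partial>lam) \<partial>lam)"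
    using lb by (simp add: nn_integral_lam_right[OF b] nn_integral_multc mult.commute)
  also have "\<dots> = (\<integral>\<^sup>+x. \<integral>\<^sup>+z. a x * b (z + x) \<partial>lam \<partial>lam)"
    by (intro nn_integral_cong nn_integral_cmult[symmetric]) measurable
  also have "\<dots> = (\<integral>\<^sup>+z. \<integral>\<^sup>+x. a x * b (z + x) \<partial>lam \<partial>lam)"
    by (rule Fubini') measurable
  also have "\<dots> = (\<integral>\<^sup>+z. \<integral>\<^sup>+x. a (- z + x) * b x \<partial>lam \<partial>lam)"
  proof (rule nn_integral_cong)
    fix z
    have "(\<integral>\<^sup>+x. a (- z + x) * b (z + (- z + x)) \<partial>lam) = (\<integral>\<^sup>+x. a x * b (z + x) \<partial>lam)"
      by (rule nn_integral_lam_left[where f="\<lambda>x. a x * b (z + x)"]) measurable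
    then show "(\<integral>\<^sup>+x. a x * b (z + x) \<partial>lam) = (\<integral>\<^sup>+x. a (- z + x) * b x \<partial>lam)"
      by (simp add: add.assoc[symmetric])
  qed
  also have "\<dots> = (\<integral>\<^sup>+x. \<integral>\<^sup>+z. a (- z + x) * b x \<partial>lam \<partial>lam)"
    by (rule Fubini') measurable
  also have "\<dots> = (\<integral>\<^sup>+x. (\<integral>\<^sup>+z. a (- z) \<partial>lam) * b x \<partial>lam)"
  proof (rule nn_integral_cong)
    fix x
    have "(\<integral>\<^sup>+z. a (- z + x) * b x \<partial>lam) = (\<integral>\<^sup>+z. a (- z + x) \<partial>lam) * b x"
      by (rule nn_integral_multc) measurable
    then show "(\<integral>\<^sup>+z. a (- z + x) * b x \<partial>lam) = (\<integral>\<^sup>+z. a (- z) \<partial>lam) * b x"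
      by (simp add: nn_integral_lam_reflect_translate[OF a])
  qed
  also have "\<dots> = (\<integral>\<^sup>+z. a (- z) \<partial>lam) * (\<integral>\<^sup>+x. b x \<partial>lam)"
    by (rule nn_integral_cmult) measurable
  also have "\<dots> = emeasure lam C * (\<integral>\<^sup>+z. a (- z) \<partial>lam)"
    using lb by (simp add: mult.commute)
  finally show ?thesis
    using C by (auto simp: ennreal_mult_cancel_left)
qed

end

section \<open>Enumerated counting measures\<close>

text \<open>
  The meaningful indices of an enumeration of the points: those below the total mass.
\<close>

definition index_set :: "'x measure \<Rightarrow> nat set" where
  "index_set \<mu> = {i. of_nat i < emeasure \<mu> UNIV}"

definition enumerates :: "(nat \<Rightarrow> 'x) \<Rightarrow> 'x::topological_space measure \<Rightarrow> bool" where
  "enumerates y \<mu> \<longleftrightarrow> (\<forall>B\<in>sets borel. emeasure \<mu> B =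
     (\<Sum>i. if of_nat i < emeasure \<mu> UNIV then indicator B (y i) else 0))"

lemma enumerates_emeasure:
  assumes "enumerates y \<mu>" "B \<in> sets borel"
  shows "emeasure \<mu> B = emeasure (count_space UNIV) {i\<in>index_set \<mu>. y i \<in> B}"
proof -
  have "emeasure \<mu> B = (\<integral>\<^sup>+i. (if of_nat i < emeasure \<mu> UNIV then indicator B (y i) else 0) \<partial>count_space UNIV)"
    using assms by (simp add: enumerates_def nn_integral_count_space_nat)
  also have "\<dots> = (\<integral>\<^sup>+i. indicator {i\<in>index_set \<mu>. y i \<in> B} i \<partial>count_space UNIV)"
    by (intro nn_integral_cong) (auto simp: index_set_def indicator_def)
  finally show ?thesis by simp
qed

lemma enumerates_distr:
  assumes "enumerates y \<mu>" "sets \<mu> = sets borel"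
  shows "\<mu> = distr (count_space (index_set \<mu>)) borel y"
proof (rule measure_eqI)
  fix B assume "B \<in> sets \<mu>"
  then have B: "B \<in> sets borel" using assms(2) by simp
  have "y -` B \<inter> index_set \<mu> = {i\<in>index_set \<mu>. y i \<in> B}" by auto
  then show "emeasure \<mu> B = emeasure (distr (count_space (index_set \<mu>)) borel y) B"
    using B by (simp add: enumerates_emeasure[OF assms(1)] emeasure_distr emeasure_count_space)
qed (use assms in simp)

text \<open>
  A point listed twice would be an atom of mass at least \<open>2\<close>.
\<close>

lemma enumerates_bij_betw:
  fixes \<mu> :: "'x::t1_space measure"
  assumes en: "enumerates y \<mu>" and simple: "\<And>x. x \<in> points \<mu> \<Longrightarrow> emeasure \<mu> {x} = 1"
  shows "bij_betw y (index_set \<mu>) (points \<mu>)"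
proof (rule bij_betw_imageI)
  have at: "emeasure \<mu> {x} = emeasure (count_space UNIV) {i\<in>index_set \<mu>. y i = x}" for x
    using enumerates_emeasure[OF en, of "{x}"] by simp
  have "x \<in> points \<mu> \<longleftrightarrow> x \<in> y ` index_set \<mu>" for x
    unfolding points_def mem_Collect_eq at by (auto simp: emeasure_count_space_eq_0)
  then show img: "y ` index_set \<mu> = points \<mu>" by blast
  show "inj_on y (index_set \<mu>)"
  proof (rule inj_onI)
    fix i j assume ij: "i \<in> index_set \<mu>" "j \<in> index_set \<mu>" "y i = y j"
    then have "y i \<in> points \<mu>" using img by blast
    then have 1: "emeasure (count_space UNIV) {k\<in>index_set \<mu>. y k = y i} = 1"
      using simple at by simp
    then have fin: "finite {k\<in>index_set \<mu>. y k = y i}"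
      by (metis emeasure_count_space_infinite infinity_ennreal_def subset_UNIV ennreal_one_neq_top)
    then have "card {k\<in>index_set \<mu>. y k = y i} = 1"
      using 1 by (simp add: emeasure_count_space_finite)
    then obtain k where "{k\<in>index_set \<mu>. y k = y i} = {k}" by (auto simp: card_1_singleton_iff)
    then show "i = j" using ij by (metis (mono_tags, lifting) mem_Collect_eq singletonD)
  qed
qed

lemma enumerates_nn_integral:
  fixes \<mu> :: "'x::t1_space measure"
  assumes en: "enumerates y \<mu>" and simple: "\<And>x. x \<in> points \<mu> \<Longrightarrow> emeasure \<mu> {x} = 1"
    and sets: "sets \<mu> = sets borel" and f: "f \<in> borel_measurable borel"
  shows "(\<integral>\<^sup>+x. f x \<partial>\<mu>) = (\<integral>\<^sup>+x. f x \<partial>count_space (points \<mu>))"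
proof -
  have "(\<integral>\<^sup>+x. f x \<partial>\<mu>) = (\<integral>\<^sup>+i. f (y i) \<partial>count_space (index_set \<mu>))"
    by (subst enumerates_distr[OF en sets], subst nn_integral_distr) (use f in auto)
  also have "\<dots> = (\<integral>\<^sup>+x. f x \<partial>count_space (points \<mu>))"
    by (rule nn_integral_bij_count_space[OF enumerates_bij_betw[OF en simple]])
  finally show ?thesis .
qed

lemma nn_integral_count_space_nat_set:
  "(\<integral>\<^sup>+x. f x \<partial>count_space A) = (\<Sum>i. if i \<in> A then f i else 0)" for A :: "nat set" and f :: "nat \<Rightarrow> ennreal"
proof -
  have "(\<integral>\<^sup>+x. f x \<partial>count_space A) = (\<integral>\<^sup>+x. f x * indicator A x \<partial>count_space UNIV)"
    by (rule nn_integral_count_space_indicator) (simp add: NO_MATCH_def)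
  also have "\<dots> = (\<Sum>i. f i * indicator A i)" by (rule nn_integral_count_space_nat)
  also have "\<dots> = (\<Sum>i. if i \<in> A then f i else 0)"
    by (intro suminf_cong) simp
  finally show ?thesis .
qed

section \<open>Mass transport and the intensity\<close>

text \<open>
  A flow-adapted simple point process with its connecting graph. On the event \<open>\<Omega>0\<close>, of probability one,
  the vertices are the points and \<open>Y\<close> enumerates them. The graph itself is adapted for every \<open>\<omega>\<close>, but
  \<open>\<Omega>0\<close> need not be invariant under the flow.
\<close>

locale connected_process = unimodular_haar lam for lam :: "'x::{topological_group_add, second_countable_topology, t2_space} measure" +
  fixes P :: "'w measure" and \<theta> :: "'x \<Rightarrow> 'w \<Rightarrow> 'w" and m :: "'w \<Rightarrow> 'x measure"
    and V :: "'w \<Rightarrow> 'x set" and E :: "'w \<Rightarrow> 'x set set" and Y :: "nat \<Rightarrow> 'w \<Rightarrow> 'x" and \<Omega>0 :: "'w set"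
  assumes stationary: "stationary_framework P \<theta>"
    and process: "simple_point_process P m" and adapted: "flow_adapted P \<theta> m"
    and graph: "\<And>\<omega>. \<omega> \<in> space P \<Longrightarrow> simple_graph (V \<omega>) (E \<omega>)"
      "\<And>\<omega>. \<omega> \<in> space P \<Longrightarrow> connected_graph (V \<omega>) (E \<omega>)"
      "\<And>\<omega>. \<omega> \<in> space P \<Longrightarrow> locally_finite_graph (V \<omega>) (E \<omega>)"
    and Y_measurable [measurable]: "\<And>i. Y i \<in> borel_measurable P"
    and \<Omega>0 [measurable]: "\<Omega>0 \<in> sets P" and AE_\<Omega>0: "AE \<omega> in P. \<omega> \<in> \<Omega>0"
    and \<Omega>0_points: "\<And>\<omega>. \<omega> \<in> \<Omega>0 \<Longrightarrow> V \<omega> = points (m \<omega>)"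
    and \<Omega>0_enumerates: "\<And>\<omega>. \<omega> \<in> \<Omega>0 \<Longrightarrow> enumerates (\<lambda>i. Y i \<omega>) (m \<omega>)"
    and edge_sets: "\<And>i j. {\<omega>\<in>space P. i \<in> index_set (m \<omega>) \<and> j \<in> index_set (m \<omega>) \<and> {Y i \<omega>, Y j \<omega>} \<in> E \<omega>} \<in> sets P"
    and V_adapted: "\<And>\<omega> a z. \<omega> \<in> space P \<Longrightarrow> a \<in> V \<omega> \<longleftrightarrow> z + a \<in> V (\<theta> z \<omega>)"
    and E_adapted: "\<And>\<omega> a b z. \<omega> \<in> space P \<Longrightarrow> {a, b} \<in> E \<omega> \<longleftrightarrow> {z + a, z + b} \<in> E (\<theta> z \<omega>)"
begin

abbreviation idx :: "'w \<Rightarrow> nat set" where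
  "idx \<omega> \<equiv> index_set (m \<omega>)"

abbreviation vsum :: "'w \<Rightarrow> ('x \<Rightarrow> ennreal) \<Rightarrow> ennreal" where
  "vsum \<omega> f \<equiv> (\<integral>\<^sup>+x. f x \<partial>count_space (V \<omega>))"

sublocale P: prob_space P
  using stationary by (simp add: stationary_framework_def)

lemma \<theta>_joint [measurable]: "(\<lambda>(x, \<omega>). \<theta> x \<omega>) \<in> measurable (borel \<Otimes>\<^sub>M P) P"
  using stationary by (simp add: stationary_framework_def)

lemma \<theta>_measurable [measurable (raw)]:
  assumes [measurable]: "f \<in> borel_measurable M" "g \<in> measurable M P"
  shows "(\<lambda>x. \<theta> (f x) (g x)) \<in> measurable M P"
  using measurable_compose[OF measurable_Pair[OF assms] \<theta>_joint] by simp

lemma \<theta>_space: "\<omega> \<in> space P \<Longrightarrow> \<theta> x \<omega> \<in> space P"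
  using measurable_space[OF \<theta>_measurable[of "\<lambda>_. x" P "\<lambda>\<omega>. \<omega>"]] by simp

lemma \<theta>_zero: "\<omega> \<in> space P \<Longrightarrow> \<theta> 0 \<omega> = \<omega>"
  using stationary by (simp add: stationary_framework_def)

lemma \<theta>_add: "\<omega> \<in> space P \<Longrightarrow> \<theta> x (\<theta> y \<omega>) = \<theta> (x + y) \<omega>"
  using stationary by (simp add: stationary_framework_def)

lemma distr_\<theta>: "distr P P (\<theta> x) = P"
  using stationary by (simp add: stationary_framework_def)

lemma nn_integral_\<theta>:
  assumes [measurable]: "f \<in> borel_measurable P"
  shows "(\<integral>\<^sup>+\<omega>. f (\<theta> x \<omega>) \<partial>P) = (\<integral>\<^sup>+\<omega>. f \<omega> \<partial>P)"
proof -
  have "(\<integral>\<^sup>+\<omega>. f \<omega> \<partial>distr P P (\<theta> x)) = (\<integral>\<^sup>+\<omega>. f (\<theta> x \<omega>) \<partial>P)"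
    by (rule nn_integral_distr) measurable
  then show ?thesis by (simp add: distr_\<theta>)
qed

lemma AE_\<theta>:
  assumes "AE \<omega> in P. \<phi> \<omega>"
  shows "AE \<omega> in P. \<phi> (\<theta> x \<omega>)"
proof -
  have "\<theta> x \<in> measurable P P" by measurable
  from AE_distrD[OF this, of \<phi>, unfolded distr_\<theta>, OF assms] show ?thesis .
qed

lemma \<Omega>0_space: "\<omega> \<in> \<Omega>0 \<Longrightarrow> \<omega> \<in> space P"
  using sets.sets_into_space[OF \<Omega>0] by blast

lemma m_measurable [measurable]: "m \<in> measurable P counting_measure_space"
  using process by (simp add: simple_point_process_def)

lemma m_lf: "\<omega> \<in> space P \<Longrightarrow> m \<omega> \<in> lf_counting_measures"
  using measurable_space[OF m_measurable] by (simp add: space_counting_measure_space)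

lemma sets_m [simp]: "\<omega> \<in> space P \<Longrightarrow> sets (m \<omega>) = sets borel"
  using m_lf by (simp add: lf_counting_measures_def)

lemma m_simple: "\<omega> \<in> space P \<Longrightarrow> x \<in> points (m \<omega>) \<Longrightarrow> emeasure (m \<omega>) {x} = 1"
  using process by (simp add: simple_point_process_def)

lemma emeasure_m_measurable [measurable]:
  "B \<in> sets borel \<Longrightarrow> (\<lambda>\<omega>. emeasure (m \<omega>) B) \<in> borel_measurable P"
  by (rule measurable_emeasure_counting[OF m_measurable])

lemma index_measurable [measurable]: "Measurable.pred P (\<lambda>\<omega>. i \<in> idx \<omega>)"
  unfolding index_set_def mem_Collect_eq by measurable

lemma edge_pred: "Measurable.pred P (\<lambda>\<omega>. i \<in> idx \<omega> \<and> j \<in> idx \<omega> \<and> {Y i \<omega>, Y j \<omega>} \<in> E \<omega>)"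
  using edge_sets by (simp add: pred_def)

lemma emeasure_m_\<theta>:
  assumes "\<omega> \<in> space P" "B \<in> sets borel"
  shows "emeasure (m (\<theta> z \<omega>)) B = emeasure (m \<omega>) {x. z + x \<in> B}"
proof -
  have "(\<lambda>y. - z + y) ` B = {x. z + x \<in> B}"
    by (auto simp: image_iff add.assoc[symmetric] intro!: bexI[of _ "z + _"])
  then show ?thesis using adapted assms by (simp add: flow_adapted_def)
qed

lemma points_\<theta>:
  assumes \<omega>: "\<omega> \<in> space P"
  shows "z + x \<in> points (m (\<theta> z \<omega>)) \<longleftrightarrow> x \<in> points (m \<omega>)"
proof -
  have "{y. z + y \<in> {z + x}} = {x}" by auto
  then show ?thesis
    using emeasure_m_\<theta>[OF \<omega>, of "{z + x}" z] by (simp add: points_def)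
qed

lemma index_set_\<theta>: "\<omega> \<in> space P \<Longrightarrow> idx (\<theta> z \<omega>) = idx \<omega>"
  unfolding index_set_def using emeasure_m_\<theta>[of \<omega> UNIV z] by simp

lemma V_\<theta>: "\<omega> \<in> space P \<Longrightarrow> bij_betw (\<lambda>x. z + x) (V \<omega>) (V (\<theta> z \<omega>))"
proof (rule bij_betw_imageI)
  assume \<omega>: "\<omega> \<in> space P"
  show "(\<lambda>x. z + x) ` V \<omega> = V (\<theta> z \<omega>)"
  proof (intro set_eqI iffI)
    fix x assume "x \<in> V (\<theta> z \<omega>)"
    then have "z + (- z + x) \<in> V (\<theta> z \<omega>)" by (simp add: add.assoc[symmetric])
    then have "- z + x \<in> V \<omega>" using V_adapted[OF \<omega>] by blast
    then show "x \<in> (\<lambda>x. z + x) ` V \<omega>"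
      by (intro image_eqI[of _ _ "- z + x"]) (simp_all add: add.assoc[symmetric])
  qed (use V_adapted[OF \<omega>] in blast)
qed (simp add: inj_on_def)

lemma bij_betw_Y: "\<omega> \<in> \<Omega>0 \<Longrightarrow> bij_betw (\<lambda>i. Y i \<omega>) (idx \<omega>) (V \<omega>)"
  unfolding \<Omega>0_points
  by (rule enumerates_bij_betw[OF \<Omega>0_enumerates m_simple[OF \<Omega>0_space]])

lemma nn_integral_m:
  assumes "\<omega> \<in> \<Omega>0" "f \<in> borel_measurable borel"
  shows "(\<integral>\<^sup>+x. f x \<partial>m \<omega>) = vsum \<omega> f"
  unfolding \<Omega>0_points[OF assms(1)]
  by (rule enumerates_nn_integral[OF \<Omega>0_enumerates[OF assms(1)] m_simple[OF \<Omega>0_space[OF assms(1)]]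
        sets_m[OF \<Omega>0_space[OF assms(1)]] assms(2)])

lemma nn_integral_V:
  assumes "\<omega> \<in> \<Omega>0"
  shows "vsum \<omega> f = (\<Sum>i. if i \<in> idx \<omega> then f (Y i \<omega>) else 0)"
  using nn_integral_bij_count_space[OF bij_betw_Y[OF assms], of f]
  by (simp add: nn_integral_count_space_nat_set)

text \<open>
  Put \<open>S (\<lambda>x y. a x * b (z + y))\<close>, the sum of \<open>a x * b (z + y) * H \<omega> x y\<close> over all pairs of points, and
  integrate it over \<open>z\<close> and \<open>\<omega>\<close>. Integrating \<open>z\<close> first gives the left-hand side, by right invariance.
  By stationarity \<open>\<omega>\<close> may be replaced by \<open>\<theta> (- z) \<omega>\<close>, which turns the integrand into
  \<open>a (- z + x) * b y * H \<omega> x y\<close>; now integrating \<open>z\<close> first gives the right-hand side, by left invariance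
  and invariance under inversion.
  
  Sums over points are not visibly measurable in \<open>\<omega>\<close>. Therefore they are computed with sums \<open>S'\<close> over
  indices, which agree with \<open>S\<close> on \<open>\<Omega>0\<close>.
\<close>

lemma mass_exchange:
  fixes a b :: "'x \<Rightarrow> ennreal" and H :: "'w \<Rightarrow> 'x \<Rightarrow> 'x \<Rightarrow> ennreal"
  assumes a [measurable]: "a \<in> borel_measurable borel" and b [measurable]: "b \<in> borel_measurable borel"
    and inv: "\<And>\<omega> z x y. \<omega> \<in> space P \<Longrightarrow> x \<in> V \<omega> \<Longrightarrow> y \<in> V \<omega> \<Longrightarrow> H (\<theta> z \<omega>) (z + x) (z + y) = H \<omega> x y"
    and meas: "\<And>i j. (\<lambda>\<omega>. if \<omega> \<in> \<Omega>0 \<and> i \<in> idx \<omega> \<and> j \<in> idx \<omega>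
       then H \<omega> (Y i \<omega>) (Y j \<omega>) else 0) \<in> borel_measurable P"
  shows "(\<integral>\<^sup>+x. b x \<partial>lam) * (\<integral>\<^sup>+\<omega>. vsum \<omega> (\<lambda>x. vsum \<omega> (\<lambda>y. a x * H \<omega> x y)) \<partial>P) =
    (\<integral>\<^sup>+x. a x \<partial>lam) * (\<integral>\<^sup>+\<omega>. vsum \<omega> (\<lambda>x. vsum \<omega> (\<lambda>y. b y * H \<omega> x y)) \<partial>P)"
proof -
  define h where "h i j \<omega> = (if \<omega> \<in> \<Omega>0 \<and> i \<in> idx \<omega> \<and> j \<in> idx \<omega>
       then H \<omega> (Y i \<omega>) (Y j \<omega>) else 0)" for i j \<omega>
  have [measurable]: "h i j \<in> borel_measurable P" for i j unfolding h_def by (rule meas)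
  define S where "S f \<omega> = vsum \<omega> (\<lambda>x. vsum \<omega> (\<lambda>y. f x y * H \<omega> x y))"
    for f :: "'x \<Rightarrow> 'x \<Rightarrow> ennreal" and \<omega>
  define S' where "S' f \<omega> = (\<Sum>i. \<Sum>j. f (Y i \<omega>) (Y j \<omega>) * h i j \<omega>)"
    for f :: "'x \<Rightarrow> 'x \<Rightarrow> ennreal" and \<omega>
  have S_S': "S f \<omega> = S' f \<omega>" if \<omega>: "\<omega> \<in> \<Omega>0" for f \<omega>
    unfolding S_def S'_def nn_integral_V[OF \<omega>] using \<omega>
    by (intro suminf_cong) (auto simp: h_def intro!: suminf_cong)
  have S_\<theta>: "S f (\<theta> z \<omega>) = S (\<lambda>x y. f (z + x) (z + y)) \<omega>" if \<omega>: "\<omega> \<in> space P" for f z \<omega>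
    unfolding S_def nn_integral_bij_count_space[OF V_\<theta>[OF \<omega>, of z], symmetric]
    by (intro nn_integral_cong) (simp add: inv[OF \<omega>])
  interpret PL: pair_sigma_finite lam P
    by (intro pair_sigma_finite.intro sigma_finite_lam) unfold_locales
  have 1: "(\<integral>\<^sup>+\<omega>. S' (\<lambda>x y. a x * b (z + y)) \<omega> \<partial>P) = (\<integral>\<^sup>+\<omega>. S' (\<lambda>x y. a (- z + x) * b y) \<omega> \<partial>P)" for z
  proof -
    have "(\<integral>\<^sup>+\<omega>. S' (\<lambda>x y. a x * b (z + y)) \<omega> \<partial>P) = (\<integral>\<^sup>+\<omega>. S' (\<lambda>x y. a x * b (z + y)) (\<theta> (- z) \<omega>) \<partial>P)"
      by (rule nn_integral_\<theta>[symmetric]) (unfold S'_def, measurable)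
    also have "\<dots> = (\<integral>\<^sup>+\<omega>. S' (\<lambda>x y. a (- z + x) * b y) \<omega> \<partial>P)"
    proof (rule nn_integral_cong_AE)
      show "AE \<omega> in P. S' (\<lambda>x y. a x * b (z + y)) (\<theta> (- z) \<omega>) = S' (\<lambda>x y. a (- z + x) * b y) \<omega>"
        using AE_\<Omega>0 AE_\<theta>[OF AE_\<Omega>0, of "- z"]
      proof eventually_elim
        (* S' and S agree at \<omega> and at the translate of \<omega>; only S is invariant. *)
        case (elim \<omega>)
        have "S' (\<lambda>x y. a x * b (z + y)) (\<theta> (- z) \<omega>) = S (\<lambda>x y. a (- z + x) * b (z + (- z + y))) \<omega>"
          unfolding S_S'[OF elim(2), symmetric] S_\<theta>[OF \<Omega>0_space[OF elim(1)]] ..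
        also have "\<dots> = S' (\<lambda>x y. a (- z + x) * b y) \<omega>"
          using S_S'[OF elim(1)] by (simp add: add.assoc[symmetric])
        finally show ?case .
      qed
    qed
    finally show ?thesis .
  qed
  have 2: "(\<integral>\<^sup>+z. \<integral>\<^sup>+\<omega>. S' (\<lambda>x y. a x * b (z + y)) \<omega> \<partial>P \<partial>lam) =
      (\<integral>\<^sup>+x. b x \<partial>lam) * (\<integral>\<^sup>+\<omega>. S' (\<lambda>x y. a x) \<omega> \<partial>P)"
  proof -
    have "(\<integral>\<^sup>+z. \<integral>\<^sup>+\<omega>. S' (\<lambda>x y. a x * b (z + y)) \<omega> \<partial>P \<partial>lam) =
      (\<integral>\<^sup>+\<omega>. \<integral>\<^sup>+z. S' (\<lambda>x y. a x * b (z + y)) \<omega> \<partial>lam \<partial>P)"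
      by (rule PL.Fubini'[symmetric]) (unfold S'_def, measurable)
    also have "\<dots> = (\<integral>\<^sup>+\<omega>. (\<integral>\<^sup>+x. b x \<partial>lam) * S' (\<lambda>x y. a x) \<omega> \<partial>P)"
    proof (rule nn_integral_cong)
      fix \<omega>
      have "(\<integral>\<^sup>+z. S' (\<lambda>x y. a x * b (z + y)) \<omega> \<partial>lam) =
        (\<Sum>i. \<Sum>j. \<integral>\<^sup>+z. a (Y i \<omega>) * b (z + Y j \<omega>) * h i j \<omega> \<partial>lam)"
        unfolding S'_def by (simp add: nn_integral_suminf)
      also have "\<dots> = (\<Sum>i. \<Sum>j. (\<integral>\<^sup>+x. b x \<partial>lam) * (a (Y i \<omega>) * h i j \<omega>))"
        by (intro suminf_cong) (simp add: nn_integral_cmult nn_integral_multc nn_integral_lam_right[OF b] ac_simps)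
      also have "\<dots> = (\<integral>\<^sup>+x. b x \<partial>lam) * S' (\<lambda>x y. a x) \<omega>"
        unfolding S'_def by simp
      finally show "(\<integral>\<^sup>+z. S' (\<lambda>x y. a x * b (z + y)) \<omega> \<partial>lam) = (\<integral>\<^sup>+x. b x \<partial>lam) * S' (\<lambda>x y. a x) \<omega>" .
    qed
    also have "\<dots> = (\<integral>\<^sup>+x. b x \<partial>lam) * (\<integral>\<^sup>+\<omega>. S' (\<lambda>x y. a x) \<omega> \<partial>P)"
      by (rule nn_integral_cmult) (unfold S'_def, measurable)
    finally show ?thesis .
  qed
  have 3: "(\<integral>\<^sup>+z. \<integral>\<^sup>+\<omega>. S' (\<lambda>x y. a (- z + x) * b y) \<omega> \<partial>P \<partial>lam) =
      (\<integral>\<^sup>+x. a x \<partial>lam) * (\<integral>\<^sup>+\<omega>. S' (\<lambda>x y. b y) \<omega> \<partial>P)"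
  proof -
    have "(\<integral>\<^sup>+z. \<integral>\<^sup>+\<omega>. S' (\<lambda>x y. a (- z + x) * b y) \<omega> \<partial>P \<partial>lam) =
      (\<integral>\<^sup>+\<omega>. \<integral>\<^sup>+z. S' (\<lambda>x y. a (- z + x) * b y) \<omega> \<partial>lam \<partial>P)"
      by (rule PL.Fubini'[symmetric]) (unfold S'_def, measurable)
    also have "\<dots> = (\<integral>\<^sup>+\<omega>. (\<integral>\<^sup>+x. a x \<partial>lam) * S' (\<lambda>x y. b y) \<omega> \<partial>P)"
    proof (rule nn_integral_cong)
      fix \<omega>
      have "(\<integral>\<^sup>+z. S' (\<lambda>x y. a (- z + x) * b y) \<omega> \<partial>lam) =
        (\<Sum>i. \<Sum>j. \<integral>\<^sup>+z. a (- z + Y i \<omega>) * b (Y j \<omega>) * h i j \<omega> \<partial>lam)"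
        unfolding S'_def by (simp add: nn_integral_suminf)
      also have "\<dots> = (\<Sum>i. \<Sum>j. (\<integral>\<^sup>+x. a x \<partial>lam) * (b (Y j \<omega>) * h i j \<omega>))"
        by (intro suminf_cong) (simp add: nn_integral_cmult nn_integral_multc
            nn_integral_lam_reflect_translate[OF a] nn_integral_lam_uminus[OF a] ac_simps)
      also have "\<dots> = (\<integral>\<^sup>+x. a x \<partial>lam) * S' (\<lambda>x y. b y) \<omega>"
        unfolding S'_def by simp
      finally show "(\<integral>\<^sup>+z. S' (\<lambda>x y. a (- z + x) * b y) \<omega> \<partial>lam) = (\<integral>\<^sup>+x. a x \<partial>lam) * S' (\<lambda>x y. b y) \<omega>" .
    qed
    also have "\<dots> = (\<integral>\<^sup>+x. a x \<partial>lam) * (\<integral>\<^sup>+\<omega>. S' (\<lambda>x y. b y) \<omega> \<partial>P)"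
      by (rule nn_integral_cmult) (unfold S'_def, measurable)
    finally show ?thesis .
  qed
  have 4: "(\<integral>\<^sup>+\<omega>. S' f \<omega> \<partial>P) = (\<integral>\<^sup>+\<omega>. S f \<omega> \<partial>P)" for f
    using AE_\<Omega>0 by (intro nn_integral_cong_AE) (auto elim!: eventually_mono simp: S_S')
  show ?thesis
    using 2 3 unfolding 1 4 S_def by simp
qed

text \<open>
  Mass transport along the diagonal.
\<close>

lemma mean_measure_proportional:
  assumes a [measurable]: "a \<in> borel_measurable borel" and b [measurable]: "b \<in> borel_measurable borel"
  shows "(\<integral>\<^sup>+x. b x \<partial>lam) * (\<integral>\<^sup>+\<omega>. \<integral>\<^sup>+x. a x \<partial>m \<omega> \<partial>P) = (\<integral>\<^sup>+x. a x \<partial>lam) * (\<integral>\<^sup>+\<omega>. \<integral>\<^sup>+x. b x \<partial>m \<omega> \<partial>P)"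
proof -
  have eq: "(\<integral>\<^sup>+\<omega>. vsum \<omega> (\<lambda>x. vsum \<omega> (\<lambda>y. f x y * indicator {x} y)) \<partial>P) =
    (\<integral>\<^sup>+\<omega>. \<integral>\<^sup>+x. c x \<partial>m \<omega> \<partial>P)" if c: "c \<in> borel_measurable borel" and f: "\<And>x. f x x = c x" for f c
  proof (rule nn_integral_cong_AE)
    have 1: "(vsum \<omega> (\<lambda>x. vsum \<omega> (\<lambda>y. f x y * indicator {x} y))) =
        (\<integral>\<^sup>+x. c x \<partial>m \<omega>)" if \<omega>: "\<omega> \<in> \<Omega>0" for \<omega>
      unfolding nn_integral_m[OF \<omega> c]
    proof (rule nn_integral_cong)
      fix x assume "x \<in> space (count_space (V \<omega>))"
      then have x: "x \<in> V \<omega>" by simp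
      have "(vsum \<omega> (\<lambda>y. f x y * indicator {x} y)) = f x x * emeasure (count_space (V \<omega>)) {x}"
        using x by (intro nn_integral_indicator_singleton) auto
      then show "(vsum \<omega> (\<lambda>y. f x y * indicator {x} y)) = c x"
        using x f by simp
    qed
    show "AE \<omega> in P. (vsum \<omega> (\<lambda>x. vsum \<omega> (\<lambda>y. f x y * indicator {x} y))) =
        (\<integral>\<^sup>+x. c x \<partial>m \<omega>)"
      using AE_\<Omega>0 by (rule eventually_mono) (rule 1)
  qed
  have "(\<integral>\<^sup>+x. b x \<partial>lam) * (\<integral>\<^sup>+\<omega>. vsum \<omega> (\<lambda>x. vsum \<omega> (\<lambda>y. a x * indicator {x} y)) \<partial>P) =
    (\<integral>\<^sup>+x. a x \<partial>lam) * (\<integral>\<^sup>+\<omega>. vsum \<omega> (\<lambda>x. vsum \<omega> (\<lambda>y. b y * indicator {x} y)) \<partial>P)"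
  proof (rule mass_exchange[OF a b])
    fix i j
    have "(\<lambda>\<omega>. if \<omega> \<in> \<Omega>0 \<and> i \<in> idx \<omega> \<and> j \<in> idx \<omega> then indicator {Y i \<omega>} (Y j \<omega>) else 0) =
      (\<lambda>\<omega>. if \<omega> \<in> \<Omega>0 \<and> i \<in> idx \<omega> \<and> j \<in> idx \<omega> \<and> Y j \<omega> = Y i \<omega> then 1 else (0::ennreal))"
      by auto
    also have "\<dots> \<in> borel_measurable P"
    proof -
      have [measurable]: "Measurable.pred P (\<lambda>\<omega>. Y j \<omega> = Y i \<omega>)"
        unfolding pred_def by measurable
      show ?thesis by measurable
    qed
    finally show "(\<lambda>\<omega>. if \<omega> \<in> \<Omega>0 \<and> i \<in> idx \<omega> \<and> j \<in> idx \<omega>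
      then indicator {Y i \<omega>} (Y j \<omega>) else (0::ennreal)) \<in> borel_measurable P" .
  qed (auto simp: indicator_def)
  then show ?thesis using eq[OF a, of "\<lambda>x y. a x"] eq[OF b, of "\<lambda>x y. b y"] by simp
qed

text \<open>
  By proportionality, the mean number of points in \<open>B\<close> divided by the Haar measure of \<open>B\<close> is the same for
  all \<open>B\<close> of positive finite measure, and such sets exist; so the description that defines the
  intensity has exactly one solution.
\<close>

lemma campbell:
  assumes a: "a \<in> borel_measurable borel"
  shows "(\<integral>\<^sup>+\<omega>. \<integral>\<^sup>+x. a x \<partial>m \<omega> \<partial>P) = intensity lam P m * (\<integral>\<^sup>+x. a x \<partial>lam)"
proof -
  obtain C where C: "C \<in> sets borel" "0 < emeasure lam C" "emeasure lam C < \<top>"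
    by (rule finite_positive_set)
  have m_indicator: "(\<integral>\<^sup>+\<omega>. \<integral>\<^sup>+x. indicator B x \<partial>m \<omega> \<partial>P) = (\<integral>\<^sup>+\<omega>. emeasure (m \<omega>) B \<partial>P)" if "B \<in> sets borel" for B
    using that by (intro nn_integral_cong) simp
  define \<gamma> where "\<gamma> = (\<integral>\<^sup>+\<omega>. emeasure (m \<omega>) C \<partial>P) / emeasure lam C"
  have g: "(\<integral>\<^sup>+\<omega>. \<integral>\<^sup>+x. c x \<partial>m \<omega> \<partial>P) = \<gamma> * (\<integral>\<^sup>+x. c x \<partial>lam)" if c: "c \<in> borel_measurable borel" for c
  proof -
    have "emeasure lam C * (\<integral>\<^sup>+\<omega>. \<integral>\<^sup>+x. c x \<partial>m \<omega> \<partial>P) = (\<integral>\<^sup>+x. c x \<partial>lam) * (\<integral>\<^sup>+\<omega>. emeasure (m \<omega>) C \<partial>P)"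
      using mean_measure_proportional[OF c, of "indicator C"] C(1) m_indicator[OF C(1)] by simp
    then have "(\<integral>\<^sup>+\<omega>. \<integral>\<^sup>+x. c x \<partial>m \<omega> \<partial>P) = ((\<integral>\<^sup>+x. c x \<partial>lam) * (\<integral>\<^sup>+\<omega>. emeasure (m \<omega>) C \<partial>P)) / emeasure lam C"
      using C by (metis ennreal_mult_divide_eq infinity_ennreal_def less_irrefl mult.commute)
    then show ?thesis
      by (simp add: \<gamma>_def ennreal_times_divide mult.commute)
  qed
  have "intensity lam P m = \<gamma>"
    unfolding intensity_def
  proof (rule the_equality)
    show "\<forall>B\<in>sets borel. 0 < emeasure lam B \<and> emeasure lam B < \<top> \<longrightarrow>
        \<gamma> = (\<integral>\<^sup>+\<omega>. emeasure (m \<omega>) B \<partial>P) / emeasure lam B"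
    proof (intro ballI impI)
      fix B :: "'x set" assume B: "B \<in> sets borel" "0 < emeasure lam B \<and> emeasure lam B < \<top>"
      have "(\<integral>\<^sup>+\<omega>. emeasure (m \<omega>) B \<partial>P) = \<gamma> * emeasure lam B"
        using g[of "indicator B"] B m_indicator[OF B(1)] by simp
      then show "\<gamma> = (\<integral>\<^sup>+\<omega>. emeasure (m \<omega>) B \<partial>P) / emeasure lam B"
        using B by (metis ennreal_mult_divide_eq infinity_ennreal_def less_irrefl)
    qed
  qed (use C in \<open>auto simp: \<gamma>_def\<close>)
  then show ?thesis using g[OF a] by simp
qed

end

section \<open>The Palm measure\<close>

locale palm_process = connected_process lam P \<theta> m V E Y \<Omega>0
  for lam :: "'x::{topological_group_add, second_countable_topology, t2_space} measure"
    and P :: "'w measure" and \<theta> m V E Y \<Omega>0 +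
  fixes w :: "'x \<Rightarrow> ennreal"
  assumes w_measurable [measurable]: "w \<in> borel_measurable borel" and w_integral: "(\<integral>\<^sup>+x. w x \<partial>lam) = 1"
    and intensity_pos: "0 < intensity lam P m" and intensity_finite: "intensity lam P m < \<top>"
begin

definition palm :: "'w measure" where
  "palm = palm_measure lam P \<theta> m w"

definition weight :: "nat \<Rightarrow> 'w \<Rightarrow> ennreal" where
  "weight i \<omega> = (if \<omega> \<in> \<Omega>0 \<and> i \<in> idx \<omega> then w (Y i \<omega>) else 0)"

lemma weight_measurable [measurable]: "weight i \<in> borel_measurable P"
  unfolding weight_def by measurable

lemma recentre_measurable [measurable]: "(\<lambda>\<omega>. \<theta> (- Y i \<omega>) \<omega>) \<in> measurable P P"
  by measurable

text \<open>
  Choose an index and an \<open>\<omega>\<close> with the weight of the point, and move the point to \<open>0\<close>. The Palm measure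
  is this image measure (\<open>palm_eq\<close>), so that it is a measure, and integrals of all
  measurable functions can be computed.
\<close>

definition palm_distr :: "'w measure" where
  "palm_distr = distr (density (count_space UNIV \<Otimes>\<^sub>M P) (\<lambda>(i, \<omega>). weight i \<omega> / intensity lam P m)) P
     (\<lambda>(i, \<omega>). \<theta> (- Y i \<omega>) \<omega>)"

lemma nn_integral_palm_distr:
  assumes f [measurable]: "f \<in> borel_measurable P"
  shows "(\<integral>\<^sup>+\<omega>. f \<omega> \<partial>palm_distr) = (\<integral>\<^sup>+\<omega>. (\<Sum>i. weight i \<omega> * f (\<theta> (- Y i \<omega>) \<omega>)) \<partial>P) / intensity lam P m"
proof -
  interpret CP: pair_sigma_finite "count_space (UNIV :: nat set)" P
    by (intro pair_sigma_finite.intro sigma_finite_measure_count_space) unfold_locales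
  have [measurable]: "(\<lambda>(i, \<omega>). \<theta> (- Y i \<omega>) \<omega>) \<in> measurable (count_space UNIV \<Otimes>\<^sub>M P) P"
    "(\<lambda>(i, \<omega>). weight i \<omega> / intensity lam P m) \<in> borel_measurable (count_space UNIV \<Otimes>\<^sub>M P)"
    "(\<lambda>(i, \<omega>). weight i \<omega> / intensity lam P m * f (\<theta> (- Y i \<omega>) \<omega>)) \<in> borel_measurable (count_space UNIV \<Otimes>\<^sub>M P)"
    by (rule measurable_pair_measure_countable1; simp; measurable)+
  have "(\<integral>\<^sup>+\<omega>. f \<omega> \<partial>palm_distr) = (\<integral>\<^sup>+p. (case p of (i, \<omega>) \<Rightarrow> f (\<theta> (- Y i \<omega>) \<omega>))
      \<partial>density (count_space UNIV \<Otimes>\<^sub>M P) (\<lambda>(i, \<omega>). weight i \<omega> / intensity lam P m))"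
    unfolding palm_distr_def by (subst nn_integral_distr) (auto simp: split_beta intro!: nn_integral_cong)
  also have "\<dots> = (\<integral>\<^sup>+p. (case p of (i, \<omega>) \<Rightarrow> weight i \<omega> / intensity lam P m * f (\<theta> (- Y i \<omega>) \<omega>))
      \<partial>(count_space UNIV \<Otimes>\<^sub>M P))"
    by (subst nn_integral_density) (auto simp: case_prod_beta intro!: nn_integral_cong)
  also have "\<dots> = (\<integral>\<^sup>+\<omega>. \<integral>\<^sup>+i. weight i \<omega> / intensity lam P m * f (\<theta> (- Y i \<omega>) \<omega>) \<partial>count_space UNIV \<partial>P)"
    by (subst CP.nn_integral_snd[symmetric]) auto
  also have "\<dots> = (\<integral>\<^sup>+\<omega>. (\<Sum>i. weight i \<omega> * f (\<theta> (- Y i \<omega>) \<omega>)) / intensity lam P m \<partial>P)"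
    by (intro nn_integral_cong)
      (simp add: nn_integral_count_space_nat divide_ennreal_def ennreal_suminf_multc[symmetric] ac_simps)
  also have "\<dots> = (\<integral>\<^sup>+\<omega>. (\<Sum>i. weight i \<omega> * f (\<theta> (- Y i \<omega>) \<omega>)) \<partial>P) / intensity lam P m"
    by (rule nn_integral_divide) measurable
  finally show ?thesis .
qed

lemma suminf_weight:
  assumes \<omega>: "\<omega> \<in> \<Omega>0"
  shows "(\<Sum>i. weight i \<omega> * f (Y i \<omega>)) = vsum \<omega> (\<lambda>x. w x * f x)"
  unfolding nn_integral_V[OF \<omega>] using \<omega> by (intro suminf_cong) (simp add: weight_def)

lemma palm_eq: "palm = palm_distr"
proof -
  have sets': "sets palm_distr = sets P" by (simp add: palm_distr_def)
  then have space': "space palm_distr = space P" by (rule sets_eq_imp_space_eq)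
  have "palm = measure_of (space P) (sets P) (emeasure palm_distr)"
    unfolding palm_def palm_measure_def
  proof (rule measure_of_eq)
    fix A assume "A \<in> sigma_sets (space P) (sets P)"
    then have A: "A \<in> sets P" by (simp add: sets.sigma_sets_eq)
    have "(\<integral>\<^sup>+\<omega>. \<integral>\<^sup>+x. indicator A (\<theta> (- x) \<omega>) * w x \<partial>m \<omega> \<partial>P) =
      (\<integral>\<^sup>+\<omega>. (\<Sum>i. weight i \<omega> * indicator A (\<theta> (- Y i \<omega>) \<omega>)) \<partial>P)"
    proof (rule nn_integral_cong_AE)
      have "(\<integral>\<^sup>+x. indicator A (\<theta> (- x) \<omega>) * w x \<partial>m \<omega>) = (\<Sum>i. weight i \<omega> * indicator A (\<theta> (- Y i \<omega>) \<omega>))"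
        if \<omega>: "\<omega> \<in> \<Omega>0" for \<omega>
      proof -
        have [measurable]: "(\<lambda>x. \<theta> (- x) \<omega>) \<in> measurable borel P"
          using \<Omega>0_space[OF \<omega>] by measurable
        have "(\<integral>\<^sup>+x. indicator A (\<theta> (- x) \<omega>) * w x \<partial>m \<omega>) =
          (vsum \<omega> (\<lambda>x. w x * indicator A (\<theta> (- x) \<omega>)))"
          using A by (subst nn_integral_m[OF \<omega>]) (auto simp: mult.commute)
        then show ?thesis
          using suminf_weight[OF \<omega>, of "\<lambda>x. indicator A (\<theta> (- x) \<omega>)"] by simp
      qed
      then show "AE \<omega> in P. (\<integral>\<^sup>+x. indicator A (\<theta> (- x) \<omega>) * w x \<partial>m \<omega>) =
          (\<Sum>i. weight i \<omega> * indicator A (\<theta> (- Y i \<omega>) \<omega>))"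
        by (rule eventually_mono[OF AE_\<Omega>0])
    qed
    also have "\<dots> / intensity lam P m = (\<integral>\<^sup>+\<omega>. indicator A \<omega> \<partial>palm_distr)"
      using A by (subst nn_integral_palm_distr) simp_all
    also have "\<dots> = emeasure palm_distr A" using A sets' by simp
    finally show "(\<integral>\<^sup>+\<omega>. \<integral>\<^sup>+x. indicator A (\<theta> (- x) \<omega>) * w x \<partial>m \<omega> \<partial>P) / intensity lam P m = emeasure palm_distr A" .
  qed (rule sets.space_closed)
  also have "\<dots> = palm_distr"
    using measure_of_of_measure[of palm_distr] by (simp add: sets' space')
  finally show ?thesis .
qed

lemma sets_palm [simp, measurable_cong]: "sets palm = sets P"
  unfolding palm_eq by (simp add: palm_distr_def)

lemma space_palm [simp]: "space palm = space P"
  by (rule sets_eq_imp_space_eq[OF sets_palm])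

lemma nn_integral_palm:
  assumes "f \<in> borel_measurable P"
  shows "(\<integral>\<^sup>+\<omega>. f \<omega> \<partial>palm) = (\<integral>\<^sup>+\<omega>. (\<Sum>i. weight i \<omega> * f (\<theta> (- Y i \<omega>) \<omega>)) \<partial>P) / intensity lam P m"
  unfolding palm_eq by (rule nn_integral_palm_distr[OF assms])

text \<open>
  The total mass is Campbell's formula for \<open>w\<close>.
\<close>

lemma prob_space_palm: "prob_space palm"
proof (rule prob_spaceI)
  have "(\<integral>\<^sup>+\<omega>. (\<Sum>i. weight i \<omega> * 1) \<partial>P) = (\<integral>\<^sup>+\<omega>. \<integral>\<^sup>+x. w x \<partial>m \<omega> \<partial>P)"
  proof (rule nn_integral_cong_AE)
    show "AE \<omega> in P. (\<Sum>i. weight i \<omega> * 1) = (\<integral>\<^sup>+x. w x \<partial>m \<omega>)"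
      using AE_\<Omega>0 by (rule eventually_mono) (simp add: nn_integral_m suminf_weight[of _ "\<lambda>_. 1", simplified])
  qed
  also have "\<dots> = intensity lam P m" by (simp add: campbell w_integral)
  finally have "(\<integral>\<^sup>+\<omega>. 1 \<partial>palm) = 1"
    using intensity_pos intensity_finite by (subst nn_integral_palm) (auto simp: ennreal_divide_self)
  then show "emeasure palm (space palm) = 1" by simp
qed

text \<open>
  What holds almost surely under the Palm measure holds, almost surely under \<open>P\<close>, as seen from all points
  of positive weight, since the points of positive weight make up the Palm measure.
\<close>

lemma palm_AE:
  assumes "AE \<omega> in palm. \<phi> \<omega>"
  shows "AE \<omega> in P. \<forall>i. weight i \<omega> \<noteq> 0 \<longrightarrow> \<phi> (\<theta> (- Y i \<omega>) \<omega>)"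
proof -
  obtain N where N: "N \<in> null_sets palm" "{\<omega>\<in>space palm. \<not> \<phi> \<omega>} \<subseteq> N"
    using assms by (auto elim!: AE_E simp: null_sets_def)
  then have NP [measurable]: "N \<in> sets P" by (auto simp: null_sets_def)
  have "(\<integral>\<^sup>+\<omega>. indicator N \<omega> \<partial>palm) = 0" using N NP by (simp add: null_sets_def)
  then have "(\<integral>\<^sup>+\<omega>. (\<Sum>i. weight i \<omega> * indicator N (\<theta> (- Y i \<omega>) \<omega>)) \<partial>P) = 0"
    using intensity_finite by (subst (asm) nn_integral_palm) (auto simp: ennreal_divide_eq_0_iff)
  then have "AE \<omega> in P. (\<Sum>i. weight i \<omega> * indicator N (\<theta> (- Y i \<omega>) \<omega>)) = 0"
    by (subst (asm) nn_integral_0_iff_AE) measurable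
  then show ?thesis
    using AE_space
  proof eventually_elim
    case (elim \<omega>)
    have "\<phi> (\<theta> (- Y i \<omega>) \<omega>)" if i: "weight i \<omega> \<noteq> 0" for i
    proof -
      have "weight i \<omega> * indicator N (\<theta> (- Y i \<omega>) \<omega>) = 0"
        using elim(1) by (simp add: suminf_eq_zero_iff)
      then have "\<theta> (- Y i \<omega>) \<omega> \<notin> N" using i by (auto simp: indicator_def split: if_splits)
      then show ?thesis using N(2) \<theta>_space[OF elim(2)] by auto
    qed
    then show ?case by blast
  qed
qed

text \<open>
  Under the Palm measure \<open>\<theta> z \<omega>\<close> is, for a point \<open>Y\<close> of \<open>\<omega>\<close>, the sample \<open>\<theta> (z - Y) \<omega>\<close> under \<open>P\<close>. Integrated
  over \<open>z\<close>, the random shift by \<open>Y\<close> disappears by right invariance, and \<open>\<theta> z \<omega>\<close> with fixed \<open>z\<close> avoids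
  \<open>P\<close>-null sets by stationarity. So the Palm probability of hitting the null set vanishes for almost
  every \<open>z\<close>, and since Haar measure is not zero there is such a \<open>z\<close>.
\<close>

lemma ex_good_shift: "\<exists>z. AE \<omega> in palm. \<theta> z \<omega> \<in> \<Omega>0"
proof -
  define f :: "'w \<Rightarrow> ennreal" where "f = indicator (space P - \<Omega>0)"
  have f [measurable]: "f \<in> borel_measurable P" unfolding f_def by measurable
  interpret palm: prob_space palm by (rule prob_space_palm)
  interpret PL: pair_sigma_finite lam P
    by (intro pair_sigma_finite.intro sigma_finite_lam) unfold_locales
  have "(\<integral>\<^sup>+z. \<integral>\<^sup>+\<omega>. f (\<theta> z \<omega>) \<partial>palm \<partial>lam) =
      (\<integral>\<^sup>+z. (\<integral>\<^sup>+\<omega>. (\<Sum>i. weight i \<omega> * f (\<theta> z (\<theta> (- Y i \<omega>) \<omega>))) \<partial>P) / intensity lam P m \<partial>lam)"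
    by (intro nn_integral_cong nn_integral_palm) measurable
  also have "\<dots> = (\<integral>\<^sup>+z. \<integral>\<^sup>+\<omega>. (\<Sum>i. weight i \<omega> * f (\<theta> z (\<theta> (- Y i \<omega>) \<omega>))) \<partial>P \<partial>lam) / intensity lam P m"
    by (rule nn_integral_divide) measurable
  also have "(\<integral>\<^sup>+z. \<integral>\<^sup>+\<omega>. (\<Sum>i. weight i \<omega> * f (\<theta> z (\<theta> (- Y i \<omega>) \<omega>))) \<partial>P \<partial>lam) =
      (\<integral>\<^sup>+\<omega>. \<integral>\<^sup>+z. (\<Sum>i. weight i \<omega> * f (\<theta> z (\<theta> (- Y i \<omega>) \<omega>))) \<partial>lam \<partial>P)"
    by (rule PL.Fubini'[symmetric]) measurable
  also have "\<dots> = (\<integral>\<^sup>+\<omega>. \<integral>\<^sup>+z. (\<Sum>i. weight i \<omega> * f (\<theta> z \<omega>)) \<partial>lam \<partial>P)"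
  proof (rule nn_integral_cong)
    fix \<omega> assume \<omega> [measurable]: "\<omega> \<in> space P"
    have "(\<integral>\<^sup>+z. (\<Sum>i. weight i \<omega> * f (\<theta> z (\<theta> (- Y i \<omega>) \<omega>))) \<partial>lam) =
      (\<Sum>i. \<integral>\<^sup>+z. weight i \<omega> * f (\<theta> (z + - Y i \<omega>) \<omega>) \<partial>lam)"
      unfolding \<theta>_add[OF \<omega>] by (rule nn_integral_suminf) measurable
    also have "\<dots> = (\<Sum>i. \<integral>\<^sup>+z. weight i \<omega> * f (\<theta> z \<omega>) \<partial>lam)"
      by (intro suminf_cong nn_integral_lam_right[where f="\<lambda>z. weight _ \<omega> * f (\<theta> z \<omega>)"]) measurable
    also have "\<dots> = (\<integral>\<^sup>+z. (\<Sum>i. weight i \<omega> * f (\<theta> z \<omega>)) \<partial>lam)"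
      by (rule nn_integral_suminf[symmetric]) measurable
    finally show "(\<integral>\<^sup>+z. (\<Sum>i. weight i \<omega> * f (\<theta> z (\<theta> (- Y i \<omega>) \<omega>))) \<partial>lam) =
      (\<integral>\<^sup>+z. (\<Sum>i. weight i \<omega> * f (\<theta> z \<omega>)) \<partial>lam)" .
  qed
  also have "\<dots> = (\<integral>\<^sup>+z. \<integral>\<^sup>+\<omega>. (\<Sum>i. weight i \<omega> * f (\<theta> z \<omega>)) \<partial>P \<partial>lam)"
    by (rule PL.Fubini') measurable
  also have "\<dots> = (\<integral>\<^sup>+z. 0 \<partial>lam)"
  proof (rule nn_integral_cong)
    fix z
    have "(\<integral>\<^sup>+\<omega>. (\<Sum>i. weight i \<omega> * f (\<theta> z \<omega>)) \<partial>P) = (\<integral>\<^sup>+\<omega>. 0 \<partial>P)"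
      using AE_\<theta>[OF AE_\<Omega>0, of z]
      by (intro nn_integral_cong_AE) (auto elim!: eventually_mono simp: f_def)
    then show "(\<integral>\<^sup>+\<omega>. (\<Sum>i. weight i \<omega> * f (\<theta> z \<omega>)) \<partial>P) = 0" by simp
  qed
  finally have "(\<integral>\<^sup>+z. \<integral>\<^sup>+\<omega>. f (\<theta> z \<omega>) \<partial>palm \<partial>lam) = 0"
    by simp
  moreover have "(\<lambda>z. \<integral>\<^sup>+\<omega>. f (\<theta> z \<omega>) \<partial>palm) \<in> borel_measurable lam"
    by measurable
  ultimately have "AE z in lam. (\<integral>\<^sup>+\<omega>. f (\<theta> z \<omega>) \<partial>palm) = 0"
    by (simp add: nn_integral_0_iff_AE)
  moreover have nontrivial: "\<not> (AE z in lam. False)"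
    using left_haar by (simp add: AE_iff_measurable[OF _ refl] left_haar_measure_def)
  ultimately have "\<exists>z. (\<integral>\<^sup>+\<omega>. f (\<theta> z \<omega>) \<partial>palm) = 0"
    using eventually_mono[where Q="\<lambda>_. False" and F="ae_filter lam"] by blast
  then obtain z where "(\<integral>\<^sup>+\<omega>. f (\<theta> z \<omega>) \<partial>palm) = 0" ..
  then have "AE \<omega> in palm. f (\<theta> z \<omega>) = 0"
    by (subst (asm) nn_integral_0_iff_AE) measurable
  then have "AE \<omega> in palm. \<theta> z \<omega> \<in> \<Omega>0"
    using AE_space
  proof eventually_elim
    case (elim \<omega>)
    then have "\<theta> z \<omega> \<in> space P" using \<theta>_space by simp
    then show ?case using elim by (auto simp: f_def indicator_def split: if_splits)
  qed
  then show ?thesis ..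
qed

lemma AE_zero_in_points: "AE \<omega> in palm. 0 \<in> points (m \<omega>)"
proof -
  define f :: "'w \<Rightarrow> ennreal" where "f \<omega> = (if emeasure (m \<omega>) {0} = 0 then 1 else 0)" for \<omega>
  have f [measurable]: "f \<in> borel_measurable P" unfolding f_def by measurable
  have "(\<integral>\<^sup>+\<omega>. (\<Sum>i. weight i \<omega> * f (\<theta> (- Y i \<omega>) \<omega>)) \<partial>P) = (\<integral>\<^sup>+\<omega>. 0 \<partial>P)"
  proof (rule nn_integral_cong)
    fix \<omega> assume \<omega>: "\<omega> \<in> space P"
    have zero: "weight i \<omega> * f (\<theta> (- Y i \<omega>) \<omega>) = 0" for i
    proof (cases "\<omega> \<in> \<Omega>0 \<and> i \<in> idx \<omega>")
      case True
      then have "Y i \<omega> \<in> points (m \<omega>)"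
        using bij_betw_Y[of \<omega>] \<Omega>0_points[of \<omega>] by (auto dest: bij_betwE)
      then have "- Y i \<omega> + Y i \<omega> \<in> points (m (\<theta> (- Y i \<omega>) \<omega>))"
        using points_\<theta>[OF \<omega>] by blast
      then show ?thesis by (simp add: f_def points_def)
    qed (auto simp: weight_def)
    show "(\<Sum>i. weight i \<omega> * f (\<theta> (- Y i \<omega>) \<omega>)) = 0" by (simp only: zero suminf_zero)
  qed
  then have "(\<integral>\<^sup>+\<omega>. f \<omega> \<partial>palm) = 0"
    by (subst nn_integral_palm) (use intensity_pos in auto)
  then have "AE \<omega> in palm. f \<omega> = 0"
    by (subst (asm) nn_integral_0_iff_AE) measurable
  then show ?thesis
    by (rule eventually_mono) (simp add: f_def points_def split: if_splits)
qed

end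

section \<open>Networks of points and networks of indices\<close>

text \<open>
  The class of a network whose vertices are of any type. It makes it possible to speak of the class of the
  network of points, which depends on \<open>\<omega>\<close> in an equivariant way, whereas its copies with vertices in \<^typ>\<open>nat\<close>
  depend on an enumeration.
\<close>

definition iso_class :: "('v, real) network \<Rightarrow> 'v list \<Rightarrow> real net_class" where
  "iso_class N os = {q. is_network mark_metric (fst q) \<and> set (snd q) \<subseteq> verts (fst q) \<and>
     (\<exists>f. full_iso N os (fst q) (snd q) f)}"

lemma iso_class_cong:
  assumes f: "full_iso N os N' os' f" and os: "set os \<subseteq> verts N"
  shows "iso_class N os = iso_class N' os'"
  unfolding iso_class_def using full_iso_trans[OF f] full_iso_trans[OF full_iso_sym[OF f os]] by blast

lemma cls_eq_iso_class:
  assumes p: "p \<in> rooted_nets l"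
  shows "cls p = iso_class (fst p) (snd p)"
proof (intro set_eqI)
  fix q
  have "rooted_isomorphic p q \<longleftrightarrow> (\<exists>f. full_iso (fst p) (snd p) (fst q) (snd q) f)"
    if "is_network mark_metric (fst q)"
    using that by (intro rooted_iso_iff rooted_netsD(1)[OF p]) (simp add: is_network_def)
  then show "q \<in> cls p \<longleftrightarrow> q \<in> iso_class (fst p) (snd p)"
    unfolding in_cls_iff iso_class_def by auto
qed

text \<open>
  The definite description picks the other endpoint of the edge.
\<close>

definition point_network :: "('x::group_add \<Rightarrow> real) \<Rightarrow> 'x set \<Rightarrow> 'x set set \<Rightarrow> ('x, real) network" where
  "point_network code V E = \<lparr>verts = V, edges = E, vmark = (\<lambda>_. 0),
     emark = (\<lambda>a e. code (- a + (THE b. e = {a, b})))\<rparr>"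

definition index_network :: "('x::group_add \<Rightarrow> real) \<Rightarrow> nat set \<Rightarrow> (nat \<Rightarrow> 'x) \<Rightarrow> 'x set set \<Rightarrow> (nat, real) network" where
  "index_network code I y E = \<lparr>verts = I, edges = {{i, j} |i j. i \<in> I \<and> j \<in> I \<and> {y i, y j} \<in> E}, vmark = (\<lambda>_. 0),
     emark = (\<lambda>i e. code (- y i + y (THE j. e = {i, j})))\<rparr>"

lemma other_endpoint [simp]: "(THE b. {u, v} = {u, b}) = v"
  by (rule the_equality) (auto simp: doubleton_eq_iff)

lemma index_network_simps [simp]:
  "verts (index_network code I y E) = I"
  "{i, j} \<in> edges (index_network code I y E) \<longleftrightarrow> i \<in> I \<and> j \<in> I \<and> {y i, y j} \<in> E"
  "vmark (index_network code I y E) = (\<lambda>_. 0)"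
  by (auto simp: index_network_def doubleton_eq_iff insert_commute)

lemma emark_index_network [simp]: "emark (index_network code I y E) i {i, j} = code (- y i + y j)"
  by (simp only: index_network_def network.select_convs other_endpoint)

lemma point_network_simps [simp]:
  "verts (point_network code V E) = V" "edges (point_network code V E) = E"
  "vmark (point_network code V E) = (\<lambda>_. 0)"
  by (simp_all add: point_network_def)

lemma emark_point_network [simp]: "emark (point_network code V E) a {a, b} = code (- a + b)"
  by (simp only: point_network_def network.select_convs other_endpoint)

lemma full_iso_index_network:
  assumes "bij_betw y I V"
  shows "full_iso (index_network code I y E) is (point_network code V E) (map y is) y"
  using assms unfolding iso_between_def by simp

text \<open>
  Translations preserve the marks: \<open>- (z + a) + (z + b) = - a + b\<close>.
\<close>

lemma full_iso_translate:
  fixes V :: "'x::group_add set"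
  assumes "bij_betw (\<lambda>x. z + x) V V'" and "\<And>a b. {a, b} \<in> E \<longleftrightarrow> {z + a, z + b} \<in> E'"
  shows "full_iso (point_network code V E) os (point_network code V' E') (map (\<lambda>x. z + x) os) (\<lambda>x. z + x)"
proof -
  have "- (z + a) + (z + b) = - a + b" for a b
    by (simp only: minus_add add.assoc minus_add_cancel)
  then show ?thesis using assms unfolding iso_between_def by simp
qed

lemma is_network_index_network:
  assumes y: "bij_betw y I V" and sg: "simple_graph V E" and con: "connected_graph V E"
    and lf: "locally_finite_graph V E"
  shows "is_network mark_metric (index_network code I y E)"
proof -
  let ?N = "index_network code I y E" and ?g = "inv_into I y"
  have gy: "?g (y i) = i" if "i \<in> I" for i using y that by (simp add: bij_betw_inv_into_left)
  have yg: "y (?g a) = a" "?g a \<in> I" if "a \<in> V" for a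
    using y that by (auto simp: bij_betw_inv_into_right dest: bij_betwE[OF bij_betw_inv_into])
  have yV: "y i \<in> V" if "i \<in> I" for i using y that by (auto dest: bij_betwE)
  have "simple_graph I (edges ?N)"
    unfolding simple_graph_def
  proof
    fix e assume "e \<in> edges ?N"
    then obtain i j where e: "e = {i, j}" "i \<in> I" "j \<in> I" "{y i, y j} \<in> E"
      by (auto simp: index_network_def)
    then have "i \<noteq> j" using edge_verts[OF sg e(4)] by auto
    then show "\<exists>u\<in>I. \<exists>v\<in>I. u \<noteq> v \<and> e = {u, v}" using e by blast
  qed
  moreover have "connected_graph I (edges ?N)"
    unfolding connected_graph_def
  proof (intro ballI)
    fix u v assume uv: "u \<in> I" "v \<in> I"
    have "(y u, y v) \<in> (adj E)\<^sup>*" using con yV uv by (simp add: connected_graph_def)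
    then have "(u, ?g (y v)) \<in> (adj (edges ?N))\<^sup>*"
    proof (induction rule: rtrancl_induct)
      case base
      then show ?case using gy uv by simp
    next
      case (step b c)
      then have bc: "{b, c} \<in> E" by (simp add: adj_def)
      then have "b \<in> V" "c \<in> V" using edge_verts[OF sg] by auto
      then have "(?g b, ?g c) \<in> adj (edges ?N)"
        using bc yg by (simp add: adj_def)
      then show ?case using step.IH by (rule rtrancl_into_rtrancl[rotated])
    qed
    then show "(u, v) \<in> (adj (edges ?N))\<^sup>*" using gy uv by simp
  qed
  moreover have "locally_finite_graph I (edges ?N)"
    unfolding locally_finite_graph_def
  proof
    fix i assume i: "i \<in> I"
    have "(`) y ` {e\<in>edges ?N. i \<in> e} \<subseteq> {e\<in>E. y i \<in> e}"
      by (auto simp: index_network_def)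
    then have "finite ((`) y ` {e\<in>edges ?N. i \<in> e})"
      using lf yV[OF i] by (auto simp: locally_finite_graph_def intro: finite_subset)
    moreover have "inj_on ((`) y) {e\<in>edges ?N. i \<in> e}"
      by (rule inj_on_subset[OF inj_on_image_Pow[OF bij_betw_imp_inj_on[OF y]]])
        (auto simp: index_network_def)
    ultimately show "finite {e\<in>edges ?N. i \<in> e}" by (rule finite_imageD)
  qed
  ultimately show ?thesis by (simp add: is_network_def)
qed

lemma index_network_measurable:
  fixes y :: "'w \<Rightarrow> nat \<Rightarrow> 'x::{topological_group_add, second_countable_topology}"
  assumes net: "\<And>\<omega>. \<omega> \<in> space M \<Longrightarrow> (index_network code (I \<omega>) (y \<omega>) (E \<omega>), os \<omega>) \<in> rooted_nets l"
    and os: "os \<in> measurable M (count_space UNIV)"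
    and code: "code \<in> measurable borel mark_algebra"
    and y [measurable]: "\<And>i. (\<lambda>\<omega>. y \<omega> i) \<in> borel_measurable M"
    and I: "\<And>i. Measurable.pred M (\<lambda>\<omega>. i \<in> I \<omega>)"
    and E: "\<And>i j. Measurable.pred M (\<lambda>\<omega>. i \<in> I \<omega> \<and> j \<in> I \<omega> \<and> {y \<omega> i, y \<omega> j} \<in> E \<omega>)"
  shows "(\<lambda>\<omega>. (index_network code (I \<omega>) (y \<omega>) (E \<omega>), os \<omega>)) \<in> measurable M (rooted_space l)"
proof (rule measurable_random_network[OF net os])
  fix i j k
  have "(\<lambda>\<omega>. code (- y \<omega> i + y \<omega> j)) \<in> measurable M mark_algebra"
    by (rule measurable_compose[OF _ code]) measurable
  from measurable_compose[OF this mark_bit_measurable]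
  show "Measurable.pred M (\<lambda>\<omega>. k \<in> mark_bits (emark (index_network code (I \<omega>) (y \<omega>) (E \<omega>)) i {i, j}))"
    by simp
qed (use I E in simp_all)

lemma index_network_class_measurable:
  fixes y :: "'w \<Rightarrow> nat \<Rightarrow> 'x::{topological_group_add, second_countable_topology}"
    and g :: "real net_class \<Rightarrow> ennreal"
  assumes A: "A \<in> sets M"
    and net: "\<And>\<omega>. \<omega> \<in> A \<Longrightarrow> (index_network code (I \<omega>) (y \<omega>) (E \<omega>), os \<omega>) \<in> rooted_nets l"
    and os: "os \<in> measurable M (count_space UNIV)"
    and code: "code \<in> measurable borel mark_algebra"
    and y: "\<And>i. (\<lambda>\<omega>. y \<omega> i) \<in> borel_measurable M"
    and I: "\<And>i. Measurable.pred M (\<lambda>\<omega>. i \<in> I \<omega>)"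
    and E: "\<And>i j. Measurable.pred M (\<lambda>\<omega>. i \<in> I \<omega> \<and> j \<in> I \<omega> \<and> {y \<omega> i, y \<omega> j} \<in> E \<omega>)"
    and g: "g \<in> borel_measurable (net_space mark_metric l)"
  shows "(\<lambda>\<omega>. if \<omega> \<in> A then g (net_class mark_metric (index_network code (I \<omega>) (y \<omega>) (E \<omega>)) (os \<omega>)) else 0)
    \<in> borel_measurable M"
proof -
  let ?M = "restrict_space M A"
  have "(\<lambda>\<omega>. (index_network code (I \<omega>) (y \<omega>) (E \<omega>), os \<omega>)) \<in> measurable ?M (rooted_space l)"
    using net by (intro index_network_measurable measurable_restrict_space1 os code y I E)
      (auto simp: space_restrict_space)
  from measurable_compose[OF measurable_compose[OF this cls_measurable] g]
  have "(\<lambda>\<omega>. g (net_class mark_metric (index_network code (I \<omega>) (y \<omega>) (E \<omega>)) (os \<omega>))) \<in> borel_measurable ?M"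
    by simp
  then show ?thesis
    using A by (subst (asm) measurable_restrict_space_iff[where c=0]) auto
qed

lemma nn_integral_count_space_swap:
  assumes "countable A" "countable B"
  shows "(\<integral>\<^sup>+x. \<integral>\<^sup>+y. f x y \<partial>count_space B \<partial>count_space A) = (\<integral>\<^sup>+y. \<integral>\<^sup>+x. f x y \<partial>count_space A \<partial>count_space B)"
proof -
  interpret pair_sigma_finite "count_space B" "count_space A"
    using assms by (intro pair_sigma_finite.intro sigma_finite_measure_count_space_countable)
  have "case_prod (\<lambda>y x. f x y) \<in> borel_measurable (count_space B \<Otimes>\<^sub>M count_space A)"
    by (intro measurable_pair_measure_countable1 assms) simp
  from Fubini'[OF this] show ?thesis .
qed

section \<open>The Palm version as an embedding\<close>

text \<open>
  The translation by \<open>z0\<close> leads from Palm-almost every \<open>\<omega>\<close> to \<open>\<Omega>0\<close>.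
\<close>

locale coded_palm_process = palm_process lam P \<theta> m V E Y \<Omega>0 w + dec: mark_decoding decode
  for lam :: "'x::{topological_group_add, second_countable_topology, t2_space} measure"
    and P :: "'w measure" and \<theta> m V E Y \<Omega>0 w and decode :: "real \<Rightarrow> 'x" +
  fixes code :: "'x \<Rightarrow> real" and z0 :: 'x
  assumes code_measurable: "code \<in> measurable borel mark_algebra"
    and decode_code: "\<And>x. decode (code x) = x"
    and AE_shift: "AE \<omega> in palm. \<theta> z0 \<omega> \<in> \<Omega>0"
begin

text \<open>
  The event, of Palm probability one, on which \<open>y\<close> enumerates the points and \<open>0\<close> is one of them.
\<close>

definition \<Omega>1 :: "'w set" where
  "\<Omega>1 = {\<omega>\<in>space P. \<theta> z0 \<omega> \<in> \<Omega>0 \<and> 0 \<in> points (m \<omega>)}"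

text \<open>
  The enumeration of the points of \<open>\<theta> z0 \<omega>\<close>, translated back.
\<close>

definition y :: "'w \<Rightarrow> nat \<Rightarrow> 'x" where
  "y \<omega> i = - z0 + Y i (\<theta> z0 \<omega>)"

text \<open>
  Outside \<open>\<Omega>1\<close> the network consists of a single vertex, because a network is required for every \<open>\<omega>\<close>.
\<close>

definition I :: "'w \<Rightarrow> nat set" where
  "I \<omega> = (if \<omega> \<in> \<Omega>1 then idx \<omega> else {0})"

definition E' :: "'w \<Rightarrow> 'x set set" where
  "E' \<omega> = (if \<omega> \<in> \<Omega>1 then E \<omega> else {})"

definition G :: "'w \<Rightarrow> (nat, real) network" where
  "G \<omega> = index_network code (I \<omega>) (y \<omega>) (E' \<omega>)"

definition rt :: "'w \<Rightarrow> nat" where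
  "rt \<omega> = (if \<omega> \<in> \<Omega>1 then LEAST i. i \<in> idx \<omega> \<and> y \<omega> i = 0 else 0)"

lemma \<Omega>1_sets [measurable]: "\<Omega>1 \<in> sets P"
proof -
  have [measurable]: "Measurable.pred P (\<lambda>\<omega>. emeasure (m \<omega>) {0} \<noteq> 0)" by measurable
  show ?thesis unfolding \<Omega>1_def points_def mem_Collect_eq by measurable
qed

lemma AE_\<Omega>1: "AE \<omega> in palm. \<omega> \<in> \<Omega>1"
  using AE_shift AE_zero_in_points AE_space by eventually_elim (simp add: \<Omega>1_def)

lemma \<Omega>1_space: "\<omega> \<in> \<Omega>1 \<Longrightarrow> \<omega> \<in> space P"
  by (simp add: \<Omega>1_def)

lemma y_measurable [measurable]: "(\<lambda>\<omega>. y \<omega> i) \<in> borel_measurable P"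
  unfolding y_def by measurable

lemma \<Omega>1_points:
  assumes "\<omega> \<in> \<Omega>1"
  shows "V \<omega> = points (m \<omega>)"
proof -
  have \<omega>: "\<omega> \<in> space P" "\<theta> z0 \<omega> \<in> \<Omega>0" using assms by (auto simp: \<Omega>1_def)
  have "x \<in> V \<omega> \<longleftrightarrow> x \<in> points (m \<omega>)" for x
    using V_adapted[OF \<omega>(1), of x z0] points_\<theta>[OF \<omega>(1), of z0 x] \<Omega>0_points[OF \<omega>(2)] by simp
  then show ?thesis by blast
qed

lemma \<Omega>1_enumerates:
  assumes "\<omega> \<in> \<Omega>1"
  shows "enumerates (y \<omega>) (m \<omega>)"
  unfolding enumerates_def
proof
  fix B :: "'x set" assume B: "B \<in> sets borel"
  have \<omega>: "\<omega> \<in> space P" "\<theta> z0 \<omega> \<in> \<Omega>0" using assms by (auto simp: \<Omega>1_def)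
  have undo: "\<theta> (- z0) (\<theta> z0 \<omega>) = \<omega>" using \<omega> by (simp add: \<theta>_add \<theta>_zero)
  let ?B = "{x. - z0 + x \<in> B}"
  have B': "?B \<in> sets borel"
    using measurable_sets[of "\<lambda>x. - z0 + x" borel borel B] B by (simp add: vimage_def)
  have "emeasure (m \<omega>) C = emeasure (m (\<theta> z0 \<omega>)) {x. - z0 + x \<in> C}" if "C \<in> sets borel" for C
    using emeasure_m_\<theta>[OF \<Omega>0_space[OF \<omega>(2)] that, of "- z0"] by (simp add: undo)
  note shift = this
  have total: "emeasure (m \<omega>) UNIV = emeasure (m (\<theta> z0 \<omega>)) UNIV"
    using shift[of UNIV] by simp
  have "emeasure (m \<omega>) B = (\<Sum>i. if of_nat i < emeasure (m (\<theta> z0 \<omega>)) UNIV then indicator ?B (Y i (\<theta> z0 \<omega>)) else 0)"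
    unfolding shift[OF B] using \<Omega>0_enumerates[OF \<omega>(2)] B' unfolding enumerates_def by blast
  also have "\<dots> = (\<Sum>i. if of_nat i < emeasure (m \<omega>) UNIV then indicator B (y \<omega> i) else 0)"
    unfolding total by (intro suminf_cong) (simp add: y_def indicator_def)
  finally show "emeasure (m \<omega>) B = (\<Sum>i. if of_nat i < emeasure (m \<omega>) UNIV then indicator B (y \<omega> i) else 0)" .
qed

lemma bij_betw_y: "\<omega> \<in> \<Omega>1 \<Longrightarrow> bij_betw (y \<omega>) (idx \<omega>) (V \<omega>)"
  unfolding \<Omega>1_points
  by (rule enumerates_bij_betw[OF \<Omega>1_enumerates m_simple[OF \<Omega>1_space]])

lemma rt_root:
  assumes "\<omega> \<in> \<Omega>1"
  shows "rt \<omega> \<in> idx \<omega>" "y \<omega> (rt \<omega>) = 0"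
proof -
  have "0 \<in> V \<omega>" using assms \<Omega>1_points[OF assms] by (simp add: \<Omega>1_def)
  then have "\<exists>i. i \<in> idx \<omega> \<and> y \<omega> i = 0"
    using bij_betw_y[OF assms] unfolding bij_betw_def by (metis imageE)
  from LeastI_ex[OF this] show "rt \<omega> \<in> idx \<omega>" "y \<omega> (rt \<omega>) = 0"
    using assms by (auto simp: rt_def)
qed

lemma rt_in_I: "rt \<omega> \<in> I \<omega>"
  using rt_root(1) by (auto simp: I_def rt_def)

lemma is_network_G:
  assumes \<omega>: "\<omega> \<in> space P"
  shows "is_network mark_metric (G \<omega>)"
proof (cases "\<omega> \<in> \<Omega>1")
  case True
  then show ?thesis
    unfolding G_def I_def E'_def using is_network_index_network[OF bij_betw_y[OF True] graph[OF \<omega>]]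
    by simp
next
  case False
  have "is_network mark_metric (index_network code {0} (y \<omega>) {})"
    by (rule is_network_index_network[of _ _ "{y \<omega> 0}"])
      (auto simp: simple_graph_def connected_graph_def locally_finite_graph_def)
  then show ?thesis using False by (simp add: G_def I_def E'_def)
qed

lemma verts_G [simp]: "verts (G \<omega>) = I \<omega>"
  by (simp add: G_def)

lemma pred_I [measurable]: "Measurable.pred P (\<lambda>\<omega>. i \<in> I \<omega>)"
proof -
  have "(\<lambda>\<omega>. i \<in> I \<omega>) = (\<lambda>\<omega>. (\<omega> \<in> \<Omega>1 \<and> i \<in> idx \<omega>) \<or> (\<not> \<omega> \<in> \<Omega>1 \<and> i = 0))"
    by (auto simp: I_def)
  moreover have "Measurable.pred P \<dots>" by measurable
  ultimately show ?thesis by simp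
qed

lemma pred_E': "Measurable.pred P (\<lambda>\<omega>. i \<in> I \<omega> \<and> j \<in> I \<omega> \<and> {y \<omega> i, y \<omega> j} \<in> E' \<omega>)"
proof -
  have [measurable]: "Measurable.pred P (\<lambda>\<omega>. i \<in> idx (\<theta> z0 \<omega>) \<and> j \<in> idx (\<theta> z0 \<omega>) \<and>
      {Y i (\<theta> z0 \<omega>), Y j (\<theta> z0 \<omega>)} \<in> E (\<theta> z0 \<omega>))"
    by (rule measurable_compose[OF _ edge_pred]) measurable
  have eq: "(i \<in> I \<omega> \<and> j \<in> I \<omega> \<and> {y \<omega> i, y \<omega> j} \<in> E' \<omega>) \<longleftrightarrow>
      (\<omega> \<in> \<Omega>1 \<and> i \<in> idx (\<theta> z0 \<omega>) \<and> j \<in> idx (\<theta> z0 \<omega>) \<and>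
      {Y i (\<theta> z0 \<omega>), Y j (\<theta> z0 \<omega>)} \<in> E (\<theta> z0 \<omega>))" if \<omega>: "\<omega> \<in> space P" for \<omega>
  proof -
    have "{y \<omega> i, y \<omega> j} \<in> E \<omega> \<longleftrightarrow> {Y i (\<theta> z0 \<omega>), Y j (\<theta> z0 \<omega>)} \<in> E (\<theta> z0 \<omega>)"
      using E_adapted[OF \<omega>, of "y \<omega> i" "y \<omega> j" z0] by (simp add: y_def add.assoc[symmetric])
    then show ?thesis by (simp add: I_def E'_def index_set_\<theta>[OF \<omega>])
  qed
  have "Measurable.pred P (\<lambda>\<omega>. \<omega> \<in> \<Omega>1 \<and> i \<in> idx (\<theta> z0 \<omega>) \<and> j \<in> idx (\<theta> z0 \<omega>) \<and>
      {Y i (\<theta> z0 \<omega>), Y j (\<theta> z0 \<omega>)} \<in> E (\<theta> z0 \<omega>))"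
    by measurable
  then show ?thesis by (subst measurable_cong[OF eq]) auto
qed

lemma rt_measurable [measurable]: "rt \<in> measurable P (count_space UNIV)"
proof -
  have [measurable]: "Measurable.pred P (\<lambda>\<omega>. y \<omega> i = 0)" for i
    unfolding pred_def by measurable
  show ?thesis unfolding rt_def by measurable
qed

definition iso_type :: "'w \<Rightarrow> 'x \<Rightarrow> 'x \<Rightarrow> real net_class" where
  "iso_type \<omega> a b = iso_class (point_network code (V \<omega>) (E \<omega>)) [a, b]"

lemma iso_type_adapted:
  assumes "\<omega> \<in> space P" "a \<in> V \<omega>" "b \<in> V \<omega>"
  shows "iso_type (\<theta> z \<omega>) (z + a) (z + b) = iso_type \<omega> a b"
proof -
  have "full_iso (point_network code (V \<omega>) (E \<omega>)) [a, b] (point_network code (V (\<theta> z \<omega>)) (E (\<theta> z \<omega>)))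
      (map (\<lambda>x. z + x) [a, b]) (\<lambda>x. z + x)"
    by (rule full_iso_translate[OF V_\<theta>[OF assms(1)] E_adapted[OF assms(1)]])
  from iso_class_cong[OF this] show ?thesis
    using assms by (simp add: iso_type_def)
qed

lemma net_class_eq_iso_type:
  assumes y: "bij_betw f J (V \<omega>)" and \<omega>: "\<omega> \<in> space P" and ij: "i \<in> J" "j \<in> J"
  shows "net_class mark_metric (index_network code J f (E \<omega>)) [i, j] = iso_type \<omega> (f i) (f j)"
proof -
  have "(index_network code J f (E \<omega>), [i, j]) \<in> rooted_nets 2"
    using is_network_index_network[OF y graph[OF \<omega>]] ij by (intro rooted_nets_pairI) auto
  from cls_eq_iso_class[OF this] show ?thesis
    using iso_class_cong[OF full_iso_index_network[OF y, of code "E \<omega>" "[i, j]"]] ij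
    by (simp add: iso_type_def)
qed

lemma net_class_G:
  assumes "\<omega> \<in> \<Omega>1" "i \<in> I \<omega>" "j \<in> I \<omega>"
  shows "net_class mark_metric (G \<omega>) [i, j] = iso_type \<omega> (y \<omega> i) (y \<omega> j)"
  using net_class_eq_iso_type[OF bij_betw_y[OF assms(1)] \<Omega>1_space[OF assms(1)], of i j] assms
  by (simp add: G_def I_def E'_def)

lemma class_root_measurable: "(\<lambda>\<omega>. net_class mark_metric (G \<omega>) [rt \<omega>]) \<in> measurable palm (G_star mark_metric)"
proof -
  have "(\<lambda>\<omega>. (G \<omega>, [rt \<omega>])) \<in> measurable P (rooted_space 1)"
    unfolding G_def
  proof (rule index_network_measurable)
    show "(index_network code (I \<omega>) (y \<omega>) (E' \<omega>), [rt \<omega>]) \<in> rooted_nets 1" if "\<omega> \<in> space P" for \<omega>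
      using is_network_G[OF that] rt_in_I[of \<omega>] by (simp add: rooted_nets_def G_def)
    show "(\<lambda>\<omega>. [rt \<omega>]) \<in> measurable P (count_space UNIV)" by measurable
  qed (use code_measurable pred_E' in simp_all)
  from measurable_compose[OF this cls_measurable]
  have "(\<lambda>\<omega>. net_class mark_metric (G \<omega>) [rt \<omega>]) \<in> measurable P (G_star mark_metric)" by simp
  then show ?thesis by (simp cong: measurable_cong_sets)
qed

lemma vertex_sum_measurable:
  fixes g :: "real net_class \<Rightarrow> ennreal"
  assumes g: "g \<in> borel_measurable (G_star_star mark_metric)"
    and os: "\<And>v. (\<lambda>\<omega>. os \<omega> v) \<in> measurable P (count_space UNIV)"
    and mem: "\<And>\<omega> v. v \<in> I \<omega> \<Longrightarrow> set (os \<omega> v) \<subseteq> I \<omega> \<and> length (os \<omega> v) = 2"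
  shows "(\<lambda>\<omega>. \<integral>\<^sup>+v. g (net_class mark_metric (G \<omega>) (os \<omega> v)) \<partial>count_space (I \<omega>)) \<in> borel_measurable P"
proof -
  have [measurable]: "(\<lambda>\<omega>. if \<omega> \<in> {\<omega>\<in>space P. v \<in> I \<omega>} then g (net_class mark_metric (G \<omega>) (os \<omega> v)) else 0)
      \<in> borel_measurable P" for v
    unfolding G_def
  proof (rule index_network_class_measurable[OF _ _ os code_measurable y_measurable pred_I pred_E' g])
    show "{\<omega>\<in>space P. v \<in> I \<omega>} \<in> sets P" by measurable
    show "(index_network code (I \<omega>) (y \<omega>) (E' \<omega>), os \<omega> v) \<in> rooted_nets 2" if "\<omega> \<in> {\<omega>\<in>space P. v \<in> I \<omega>}" for \<omega>
      using is_network_G[of \<omega>] mem[of v \<omega>] that by (simp add: rooted_nets_def G_def)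
  qed
  have "(\<lambda>\<omega>. \<Sum>v. if \<omega> \<in> {\<omega>\<in>space P. v \<in> I \<omega>} then g (net_class mark_metric (G \<omega>) (os \<omega> v)) else 0) \<in> borel_measurable P"
    by measurable
  then show ?thesis
    by (rule measurable_cong[THEN iffD2, rotated]) (simp add: nn_integral_count_space_nat_set)
qed

text \<open>
  A sum over the vertices seen from the root, averaged over the Palm measure, is an average under \<open>P\<close> of
  a weighted sum over pairs of points: the sample \<open>\<theta> (- Y i \<omega>) \<omega>\<close> sees from \<open>0\<close> what \<open>\<omega>\<close> sees from \<open>Y i \<omega>\<close>.
\<close>

lemma palm_vertex_sum:
  fixes K :: "'w \<Rightarrow> 'x \<Rightarrow> 'x \<Rightarrow> ennreal"
  assumes F: "F \<in> borel_measurable P"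
    and FK: "\<And>\<omega>. \<omega> \<in> \<Omega>1 \<Longrightarrow> F \<omega> = vsum \<omega> (\<lambda>b. K \<omega> 0 b)"
    and K: "\<And>\<omega> z a b. \<omega> \<in> space P \<Longrightarrow> a \<in> V \<omega> \<Longrightarrow> b \<in> V \<omega> \<Longrightarrow> K (\<theta> z \<omega>) (z + a) (z + b) = K \<omega> a b"
  shows "(\<integral>\<^sup>+\<omega>. F \<omega> \<partial>palm) =
    (\<integral>\<^sup>+\<omega>. vsum \<omega> (\<lambda>a. vsum \<omega> (\<lambda>b. w a * K \<omega> a b)) \<partial>P) / intensity lam P m"
proof -
  have "AE \<omega> in P. (\<Sum>i. weight i \<omega> * F (\<theta> (- Y i \<omega>) \<omega>)) =
      (vsum \<omega> (\<lambda>a. vsum \<omega> (\<lambda>b. w a * K \<omega> a b)))"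
    using AE_\<Omega>0 palm_AE[OF AE_\<Omega>1]
  proof eventually_elim
    case (elim \<omega>)
    note \<omega> = \<Omega>0_space[OF elim(1)]
    have "weight i \<omega> * F (\<theta> (- Y i \<omega>) \<omega>) = weight i \<omega> * (vsum \<omega> (\<lambda>b. K \<omega> (Y i \<omega>) b))" for i
    proof (cases "weight i \<omega> = 0")
      case False
      then have i: "i \<in> idx \<omega>" by (auto simp: weight_def split: if_splits)
      then have Yi: "Y i \<omega> \<in> V \<omega>" using bij_betw_Y[OF elim(1)] by (auto dest: bij_betwE)
      have "F (\<theta> (- Y i \<omega>) \<omega>) = (\<integral>\<^sup>+b. K (\<theta> (- Y i \<omega>) \<omega>) 0 b \<partial>count_space (V (\<theta> (- Y i \<omega>) \<omega>)))"
        using False elim(2) by (intro FK) blast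
      also have "\<dots> = vsum \<omega> (\<lambda>b. K (\<theta> (- Y i \<omega>) \<omega>) (- Y i \<omega> + Y i \<omega>) (- Y i \<omega> + b))"
        by (simp add: nn_integral_bij_count_space[OF V_\<theta>[OF \<omega>], symmetric])
      also have "\<dots> = vsum \<omega> (\<lambda>b. K \<omega> (Y i \<omega>) b)"
        by (intro nn_integral_cong K[OF \<omega> Yi]) simp
      finally show ?thesis by simp
    qed simp
    then have "(\<Sum>i. weight i \<omega> * F (\<theta> (- Y i \<omega>) \<omega>)) =
        (\<Sum>i. weight i \<omega> * (vsum \<omega> (\<lambda>b. K \<omega> (Y i \<omega>) b)))" by (simp only:)
    also have "\<dots> = vsum \<omega> (\<lambda>a. w a * (vsum \<omega> (\<lambda>b. K \<omega> a b)))"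
      by (rule suminf_weight[OF elim(1)])
    also have "\<dots> = vsum \<omega> (\<lambda>a. vsum \<omega> (\<lambda>b. w a * K \<omega> a b))"
      by (intro nn_integral_cong nn_integral_cmult[symmetric]) simp
    finally show ?case .
  qed
  then show ?thesis
    unfolding nn_integral_palm[OF F] by (simp cong: nn_integral_cong_AE)
qed

text \<open>
  In terms of pairs of points the two sides are the averages of \<open>w a * H \<omega> a b\<close> and \<open>w a * H \<omega> b a\<close>.
  They are equal by mass transport from \<open>a\<close> to \<open>b\<close>, as \<open>w\<close> has integral \<open>1\<close>.
\<close>

lemma unimodular:
  fixes g :: "real net_class \<Rightarrow> ennreal"
  assumes g: "g \<in> borel_measurable (G_star_star mark_metric)"
  shows "(\<integral>\<^sup>+\<omega>. \<integral>\<^sup>+v. g (net_class mark_metric (G \<omega>) [rt \<omega>, v]) \<partial>count_space (verts (G \<omega>)) \<partial>palm) =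
    (\<integral>\<^sup>+\<omega>. \<integral>\<^sup>+v. g (net_class mark_metric (G \<omega>) [v, rt \<omega>]) \<partial>count_space (verts (G \<omega>)) \<partial>palm)"
proof -
  define H where "H \<omega> a b = g (iso_type \<omega> a b)" for \<omega> a b
  have H: "H (\<theta> z \<omega>) (z + a) (z + b) = H \<omega> a b" if "\<omega> \<in> space P" "a \<in> V \<omega>" "b \<in> V \<omega>" for \<omega> z a b
    using iso_type_adapted[OF that] by (simp add: H_def)
  have I: "I \<omega> = idx \<omega>" if "\<omega> \<in> \<Omega>1" for \<omega> using that by (simp add: I_def)
  have 1: "(\<integral>\<^sup>+\<omega>. \<integral>\<^sup>+v. g (net_class mark_metric (G \<omega>) [rt \<omega>, v]) \<partial>count_space (I \<omega>) \<partial>palm) =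
    (\<integral>\<^sup>+\<omega>. vsum \<omega> (\<lambda>a. vsum \<omega> (\<lambda>b. w a * H \<omega> a b)) \<partial>P) / intensity lam P m"
  proof (rule palm_vertex_sum[where K=H])
    show "(\<lambda>\<omega>. \<integral>\<^sup>+v. g (net_class mark_metric (G \<omega>) [rt \<omega>, v]) \<partial>count_space (I \<omega>)) \<in> borel_measurable P"
      by (rule vertex_sum_measurable[OF g]) (use rt_in_I in auto)
    fix \<omega> assume \<omega>: "\<omega> \<in> \<Omega>1"
    show "(\<integral>\<^sup>+v. g (net_class mark_metric (G \<omega>) [rt \<omega>, v]) \<partial>count_space (I \<omega>)) = vsum \<omega> (\<lambda>b. H \<omega> 0 b)"
      unfolding nn_integral_bij_count_space[OF bij_betw_y[OF \<omega>], symmetric] I[OF \<omega>, symmetric]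
      using rt_root[OF \<omega>] by (intro nn_integral_cong) (simp add: H_def net_class_G[OF \<omega>] I[OF \<omega>])
  qed (rule H)
  have 2: "(\<integral>\<^sup>+\<omega>. \<integral>\<^sup>+v. g (net_class mark_metric (G \<omega>) [v, rt \<omega>]) \<partial>count_space (I \<omega>) \<partial>palm) =
    (\<integral>\<^sup>+\<omega>. vsum \<omega> (\<lambda>a. vsum \<omega> (\<lambda>b. w a * H \<omega> b a)) \<partial>P) / intensity lam P m"
  proof (rule palm_vertex_sum[where K="\<lambda>\<omega> a b. H \<omega> b a"])
    show "(\<lambda>\<omega>. \<integral>\<^sup>+v. g (net_class mark_metric (G \<omega>) [v, rt \<omega>]) \<partial>count_space (I \<omega>)) \<in> borel_measurable P"
      by (rule vertex_sum_measurable[OF g]) (use rt_in_I in auto)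
    fix \<omega> assume \<omega>: "\<omega> \<in> \<Omega>1"
    show "(\<integral>\<^sup>+v. g (net_class mark_metric (G \<omega>) [v, rt \<omega>]) \<partial>count_space (I \<omega>)) = vsum \<omega> (\<lambda>b. H \<omega> b 0)"
      unfolding nn_integral_bij_count_space[OF bij_betw_y[OF \<omega>], symmetric] I[OF \<omega>, symmetric]
      using rt_root[OF \<omega>] by (intro nn_integral_cong) (simp add: H_def net_class_G[OF \<omega>] I[OF \<omega>])
  qed (rule H)
  have "(\<integral>\<^sup>+\<omega>. vsum \<omega> (\<lambda>a. vsum \<omega> (\<lambda>b. w a * H \<omega> a b)) \<partial>P) =
    (\<integral>\<^sup>+\<omega>. vsum \<omega> (\<lambda>a. vsum \<omega> (\<lambda>b. w b * H \<omega> a b)) \<partial>P)"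
  proof -
    have "(\<lambda>\<omega>. if \<omega> \<in> \<Omega>0 \<and> i \<in> idx \<omega> \<and> j \<in> idx \<omega> then H \<omega> (Y i \<omega>) (Y j \<omega>) else 0)
        \<in> borel_measurable P" for i j
    proof -
      let ?A = "{\<omega>\<in>space P. \<omega> \<in> \<Omega>0 \<and> i \<in> idx \<omega> \<and> j \<in> idx \<omega>}"
      have "(\<lambda>\<omega>. if \<omega> \<in> ?A then g (net_class mark_metric (index_network code (idx \<omega>) (\<lambda>i. Y i \<omega>) (E \<omega>)) [i, j]) else 0)
          \<in> borel_measurable P"
      proof (rule index_network_class_measurable[OF _ _ _ code_measurable Y_measurable index_measurable edge_pred g])
        show "?A \<in> sets P" by measurable
        show "(index_network code (idx \<omega>) (\<lambda>i. Y i \<omega>) (E \<omega>), [i, j]) \<in> rooted_nets 2" if "\<omega> \<in> ?A" for \<omega>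
          using that is_network_index_network[OF bij_betw_Y graph, of \<omega> code] by (simp add: rooted_nets_def)
      qed simp
      also have "(\<lambda>\<omega>. if \<omega> \<in> ?A then g (net_class mark_metric (index_network code (idx \<omega>) (\<lambda>i. Y i \<omega>) (E \<omega>)) [i, j]) else 0) =
        (\<lambda>\<omega>. if \<omega> \<in> \<Omega>0 \<and> i \<in> idx \<omega> \<and> j \<in> idx \<omega> then H \<omega> (Y i \<omega>) (Y j \<omega>) else 0)"
        using \<Omega>0_space by (intro ext) (auto simp: H_def net_class_eq_iso_type[OF bij_betw_Y])
      finally show ?thesis .
    qed
    from mass_exchange[OF w_measurable w_measurable H this] show ?thesis by (simp add: w_integral)
  qed
  also have "\<dots> = (\<integral>\<^sup>+\<omega>. vsum \<omega> (\<lambda>a. vsum \<omega> (\<lambda>b. w a * H \<omega> b a)) \<partial>P)"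
  proof (rule nn_integral_cong_AE)
    have "(vsum \<omega> (\<lambda>a. vsum \<omega> (\<lambda>b. w b * H \<omega> a b))) =
      (vsum \<omega> (\<lambda>a. vsum \<omega> (\<lambda>b. w a * H \<omega> b a)))" if \<omega>: "\<omega> \<in> \<Omega>0" for \<omega>
    proof -
      have "countable (V \<omega>)"
        using bij_betw_Y[OF \<omega>] unfolding bij_betw_def by (metis countable_image countableI_type)
      then show ?thesis by (intro nn_integral_count_space_swap)
    qed
    then show "AE \<omega> in P. (vsum \<omega> (\<lambda>a. vsum \<omega> (\<lambda>b. w b * H \<omega> a b))) =
      (vsum \<omega> (\<lambda>a. vsum \<omega> (\<lambda>b. w a * H \<omega> b a)))"
      by (rule eventually_mono[OF AE_\<Omega>0])
  qed
  finally show ?thesis unfolding verts_G 1 2 by simp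
qed

lemma unimodular_network_G: "unimodular_network mark_metric palm G rt"
  unfolding unimodular_network_def
proof (intro conjI ballI impI)
  fix g :: "real net_class \<Rightarrow> real"
  assume "g \<in> borel_measurable (G_star_star mark_metric)"
  then have "(\<lambda>c. ennreal (g c)) \<in> borel_measurable (G_star_star mark_metric)" by measurable
  from unimodular[OF this]
  show "(\<integral>\<^sup>+\<omega>. \<integral>\<^sup>+v. ennreal (g (net_class mark_metric (G \<omega>) [rt \<omega>, v])) \<partial>count_space (verts (G \<omega>)) \<partial>palm) =
    (\<integral>\<^sup>+\<omega>. \<integral>\<^sup>+v. ennreal (g (net_class mark_metric (G \<omega>) [v, rt \<omega>])) \<partial>count_space (verts (G \<omega>)) \<partial>palm)" .
qed (simp_all add: mark_metric_complete mark_metric_separable is_network_G rt_in_I class_root_measurable[simplified])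

lemma displacement_G:
  assumes \<omega>: "\<omega> \<in> \<Omega>1" and uv: "u \<in> I \<omega>" "v \<in> I \<omega>"
  shows "dec.displacement (G \<omega>, [u, v]) = - y \<omega> u + y \<omega> v"
  by (rule dec.displacement_eq)
    (use uv is_network_G[OF \<Omega>1_space[OF \<omega>]] in \<open>auto simp: rooted_nets_def G_def decode_code\<close>)

lemma I_\<Omega>1: "\<omega> \<in> \<Omega>1 \<Longrightarrow> I \<omega> = idx \<omega>"
  by (simp add: I_def)

lemma displacement_from_root:
  assumes "\<omega> \<in> \<Omega>1" "v \<in> I \<omega>"
  shows "dec.displacement (G \<omega>, [rt \<omega>, v]) = y \<omega> v"
  using displacement_G[OF assms(1) rt_in_I assms(2)] rt_root(2)[OF assms(1)] by simp

text \<open>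
  The displacements from the root are the points of \<open>m \<omega>\<close>, which is locally finite.
\<close>

lemma embeddable_G:
  assumes \<omega>: "\<omega> \<in> \<Omega>1"
  shows "dec.embeddable (G \<omega>, [rt \<omega>])"
  unfolding dec.embeddable_def fst_conv snd_conv
proof (intro conjI allI impI)
  show "dec.cocycle (G \<omega>)"
    unfolding dec.cocycle_def using \<omega> by (auto simp: displacement_G add.assoc)
  fix C :: "'x set" assume C: "compact C"
  have "emeasure (count_space UNIV) {i\<in>idx \<omega>. y \<omega> i \<in> C} < \<top>"
    unfolding enumerates_emeasure[OF \<Omega>1_enumerates[OF \<omega>] borel_compact[OF C], symmetric]
    using m_lf[OF \<Omega>1_space[OF \<omega>]] C by (simp add: lf_counting_measures_def)
  then have "finite {i\<in>idx \<omega>. y \<omega> i \<in> C}"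
    by (simp add: emeasure_count_space less_top[symmetric] split: if_splits)
  moreover have "{v\<in>verts (G \<omega>). dec.displacement (G \<omega>, [[rt \<omega>] ! 0, v]) \<in> C} = {i\<in>idx \<omega>. y \<omega> i \<in> C}"
    unfolding I_\<Omega>1[OF \<omega>, symmetric] using displacement_from_root[OF \<omega>] by auto
  ultimately show "finite {v\<in>verts (G \<omega>). dec.displacement (G \<omega>, [[rt \<omega>] ! 0, v]) \<in> C}" by simp
qed

lemma class_embed_G:
  assumes \<omega>: "\<omega> \<in> \<Omega>1"
  shows "dec.class_embed (net_class mark_metric (G \<omega>) [rt \<omega>]) = m \<omega>"
proof -
  have "dec.embed (G \<omega>, [rt \<omega>]) = m \<omega>"
  proof (rule measure_eqI)
    fix B assume "B \<in> sets (dec.embed (G \<omega>, [rt \<omega>]))"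
    then have B: "B \<in> sets borel" by simp
    have "{v\<in>I \<omega>. dec.displacement (G \<omega>, [rt \<omega>, v]) \<in> B} = {i\<in>idx \<omega>. y \<omega> i \<in> B}"
      unfolding I_\<Omega>1[OF \<omega>, symmetric] using displacement_from_root[OF \<omega>] by auto
    then show "emeasure (dec.embed (G \<omega>, [rt \<omega>])) B = emeasure (m \<omega>) B"
      using embeddable_G[OF \<omega>] enumerates_emeasure[OF \<Omega>1_enumerates[OF \<omega>] B]
      by (simp add: dec.emeasure_embed[OF B])
  qed (use \<Omega>1_space[OF \<omega>] in simp)
  then show ?thesis
    using dec.class_embed_eq[OF is_network_G[OF \<Omega>1_space[OF \<omega>]]] rt_in_I by simp
qed

lemma palm_version_embedding: "palm_version_is_embedding mark_metric palm m G rt"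
  unfolding palm_version_is_embedding_def
proof (intro exI conjI)
  show "AE \<omega> in palm. m \<omega> = dec.class_embed (net_class mark_metric (G \<omega>) [rt \<omega>])"
    using AE_\<Omega>1 by (rule eventually_mono) (simp add: class_embed_G)
  show "embedding mark_metric palm G rt dec.class_embed"
    unfolding embedding_def
  proof (intro conjI bexI[of _ dec.class_displacement] allI impI ballI)
    show "AE \<omega> in palm. bij_betw (\<lambda>v. dec.class_displacement (net_class mark_metric (G \<omega>) [rt \<omega>, v])) (verts (G \<omega>))
        (points (dec.class_embed (net_class mark_metric (G \<omega>) [rt \<omega>])))"
      using AE_\<Omega>1
    proof eventually_elim
      case (elim \<omega>)
      have "dec.class_displacement (net_class mark_metric (G \<omega>) [rt \<omega>, v]) = y \<omega> v" if "v \<in> I \<omega>" for v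
        using dec.class_displacement_eq[OF is_network_G[OF \<Omega>1_space[OF elim]], of "rt \<omega>" v] that
          embeddable_G[OF elim] displacement_from_root[OF elim that] rt_in_I by simp
      then have "bij_betw (\<lambda>v. dec.class_displacement (net_class mark_metric (G \<omega>) [rt \<omega>, v])) (I \<omega>) (points (m \<omega>))
          \<longleftrightarrow> bij_betw (y \<omega>) (I \<omega>) (points (m \<omega>))"
        by (rule bij_betw_cong)
      moreover have "bij_betw (y \<omega>) (I \<omega>) (points (m \<omega>))"
        using bij_betw_y[OF elim] \<Omega>1_points[OF elim] elim by (simp add: I_def)
      ultimately show ?case
        by (simp add: class_embed_G[OF elim])
    qed
  qed (rule prob_space_palm unimodular_network_G dec.class_embed_measurable dec.zero_in_points_class_embed
      dec.class_displacement_measurable dec.class_embed_covariant; assumption)+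
qed

end

theorem theorem5p5:
  fixes lam :: "'x::{topological_group_add, second_countable_topology, t2_space} measure"
    and P :: "'w measure"
    and \<theta> :: "'x \<Rightarrow> 'w \<Rightarrow> 'w"
    and m :: "'w \<Rightarrow> 'x measure"
    and w :: "'x \<Rightarrow> ennreal"
  assumes "locally_compact_space (euclidean :: 'x topology)"
    and "left_haar_measure lam" and "right_invariant lam"
    and "stationary_framework P \<theta>"
    and "simple_point_process P m" and "flow_adapted P \<theta> m"
    and "0 < intensity lam P m" and "intensity lam P m < \<top>"
    and "connectible P \<theta> m"
    and "w \<in> borel_measurable borel" and "(\<integral>\<^sup>+x. w x \<partial>lam) = 1"
  shows "\<exists>(Xi :: real metric) G rt.
           palm_version_is_embedding Xi (palm_measure lam P \<theta> m w) m G rt"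
proof -
  obtain V :: "'w \<Rightarrow> 'x set" and E :: "'w \<Rightarrow> 'x set set" and Y :: "nat \<Rightarrow> 'w \<Rightarrow> 'x" where
    graph: "\<And>\<omega>. \<omega> \<in> space P \<Longrightarrow> simple_graph (V \<omega>) (E \<omega>) \<and> connected_graph (V \<omega>) (E \<omega>) \<and>
           locally_finite_graph (V \<omega>) (E \<omega>)"
    and Y: "\<And>i. Y i \<in> borel_measurable P"
    and ae: "AE \<omega> in P. V \<omega> = points (m \<omega>) \<and> enumerates (\<lambda>i. Y i \<omega>) (m \<omega>)"
    and edges: "\<And>i j. {\<omega>\<in>space P. i \<in> index_set (m \<omega>) \<and> j \<in> index_set (m \<omega>) \<and> {Y i \<omega>, Y j \<omega>} \<in> E \<omega>} \<in> sets P"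
    and VE: "\<And>\<omega> a b z. \<omega> \<in> space P \<Longrightarrow> (a \<in> V \<omega> \<longleftrightarrow> z + a \<in> V (\<theta> z \<omega>)) \<and>
           ({a, b} \<in> E \<omega> \<longleftrightarrow> {z + a, z + b} \<in> E (\<theta> z \<omega>))"
    using assms(9) unfolding connectible_def enumerates_def index_set_def mem_Collect_eq by blast
  obtain N where N: "N \<in> null_sets P" "{\<omega>\<in>space P. \<not> (V \<omega> = points (m \<omega>) \<and> enumerates (\<lambda>i. Y i \<omega>) (m \<omega>))} \<subseteq> N"
    using ae unfolding eventually_ae_filter by blast
  have AE_N: "AE \<omega> in P. \<omega> \<in> space P - N"
    using AE_not_in[OF N(1)] AE_space by eventually_elim simp
  obtain code :: "'x \<Rightarrow> real" and decode where code: "\<And>x. decode (code x) = x"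
    "code \<in> measurable borel mark_algebra" "decode \<in> measurable mark_algebra borel"
    by (rule Borel_coding[OF assms(1)]) (rule that)
  interpret palm_process lam P \<theta> m V E Y "space P - N" w
    using assms graph Y AE_N N edges VE by unfold_locales (auto simp: null_sets_def)
  obtain z0 where z0: "AE \<omega> in palm. \<theta> z0 \<omega> \<in> space P - N"
    using ex_good_shift by blast
  interpret coded_palm_process lam P \<theta> m V E Y "space P - N" w decode code z0
    using assms(1) code z0 by unfold_locales auto
  show ?thesis
    using palm_version_embedding unfolding palm_def by blast
qed

end
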